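(* Let $p>2$ be a prime and let $n\ge 1$ be an integer. The class $\mathbb{K}(n)$ has the Hereditary Property, the Joint Embedding Property and the Amalgamation Property (with respect to $L(n)$-embeddings). Hence the Fraïssé limit $D(n)$ of $\mathbb{K}(n)$ exists. Moreover, $D(n)$ is $\aleph_0$-categorical, and $\mathrm{Th}(D(n))$ has elimination of quantifiers in $L(n)$.
   Context: $L(n)$ is the language of group theory together with $n$ additional constant symbols $c_1,\dots,c_n$. $\mathbb{G}(n)$ is the class of all $L(n)$-structures $G$ that are groups of nilpotency class at most 2 with $x^p=1$ for all $x$, such that $G'\subseteq\langle c_1^G,\dots,c_n^G\rangle\subseteq Z(G)$ and $c_1^G,\dots,c_n^G$ are linearly independent (an abelian group of exponent $p$ is viewed as an $\mathbb{F}_p$-vector space). Here $G'$ is the commutator subgroup and $Z(G)$ the center. $\mathbb{K}(n)$ is the class of finite structures in $\mathbb{G}(n)$. The Fraïssé limit is the countable ultrahomogeneous $L(n)$-structure whose finitely generated substructures are, up to isomorphism, exactly the members of $\mathbb{K}(n)$. *)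

theory Defs
  imports
    "HOL-Algebra.Generated_Groups"
    "HOL-Algebra.FiniteProduct"
    "HOL-Computational_Algebra.Primes"
    "HOL-Library.Countable_Set"
begin

section \<open>Structures for the language of groups with \<open>n\<close> extra constants\<close>

text \<open>
  The language of groups has symbols for the product, the neutral element and the inverse.
  The product and the neutral element are the fields of the underlying monoid record; the inverse
  is a separate field, because an arbitrary \<open>L(n)\<close>-structure need not be a group.
  Only the values \<open>lconst M i\<close> with \<open>i \<in> {1..n}\<close>, and the values of the operations on the carrier,
  are part of the \<open>L(n)\<close>-structure; no notion below depends on the other values.
\<close>

record 'a L_struct = "'a monoid" +
  linv :: "'a \<Rightarrow> 'a"
  lconst :: "nat \<Rightarrow> 'a"

definition L_closed :: "nat \<Rightarrow> 'a L_struct \<Rightarrow> 'a set \<Rightarrow> bool" where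
  "L_closed n M S \<longleftrightarrow>
     \<one>\<^bsub>M\<^esub> \<in> S \<and> (\<forall>x\<in>S. \<forall>y\<in>S. x \<otimes>\<^bsub>M\<^esub> y \<in> S) \<and>
     (\<forall>x\<in>S. linv M x \<in> S) \<and> (\<forall>i\<in>{1..n}. lconst M i \<in> S)"

definition L_structure :: "nat \<Rightarrow> 'a L_struct \<Rightarrow> bool" where
  "L_structure n M \<longleftrightarrow> L_closed n M (carrier M)"

definition L_embedding :: "nat \<Rightarrow> ('a \<Rightarrow> 'b) \<Rightarrow> 'a L_struct \<Rightarrow> 'b L_struct \<Rightarrow> bool" where
  "L_embedding n f A B \<longleftrightarrow>
     f ` carrier A \<subseteq> carrier B \<and> inj_on f (carrier A) \<and>
     f \<one>\<^bsub>A\<^esub> = \<one>\<^bsub>B\<^esub> \<and>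
     (\<forall>x\<in>carrier A. \<forall>y\<in>carrier A. f (x \<otimes>\<^bsub>A\<^esub> y) = f x \<otimes>\<^bsub>B\<^esub> f y) \<and>
     (\<forall>x\<in>carrier A. f (linv A x) = linv B (f x)) \<and>
     (\<forall>i\<in>{1..n}. f (lconst A i) = lconst B i)"

definition L_isomorphism :: "nat \<Rightarrow> ('a \<Rightarrow> 'b) \<Rightarrow> 'a L_struct \<Rightarrow> 'b L_struct \<Rightarrow> bool" where
  "L_isomorphism n f A B \<longleftrightarrow> L_embedding n f A B \<and> f ` carrier A = carrier B"

definition L_isomorphic :: "nat \<Rightarrow> 'a L_struct \<Rightarrow> 'b L_struct \<Rightarrow> bool" where
  "L_isomorphic n A B \<longleftrightarrow> (\<exists>f. L_isomorphism n f A B)"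

definition L_substructure :: "nat \<Rightarrow> 'a L_struct \<Rightarrow> 'a L_struct \<Rightarrow> bool" where
  "L_substructure n B A \<longleftrightarrow>
     L_structure n B \<and> carrier B \<subseteq> carrier A \<and> L_embedding n (\<lambda>x. x) B A"

definition L_generated :: "nat \<Rightarrow> 'a L_struct \<Rightarrow> 'a set \<Rightarrow> 'a set" where
  "L_generated n M S = \<Inter> {U. S \<subseteq> U \<and> U \<subseteq> carrier M \<and> L_closed n M U}"

definition fg_substructure :: "nat \<Rightarrow> 'a L_struct \<Rightarrow> 'a L_struct \<Rightarrow> bool" where
  "fg_substructure n B A \<longleftrightarrow>
     L_substructure n B A \<and>
     (\<exists>S. finite S \<and> S \<subseteq> carrier A \<and> carrier B = L_generated n A S)"


section \<open>The classes \<open>\<bbbG>(n)\<close> and \<open>\<bbbK>(n)\<close>\<close>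

definition center :: "('a, 'b) monoid_scheme \<Rightarrow> 'a set" where
  "center G = {x \<in> carrier G. \<forall>y\<in>carrier G. x \<otimes>\<^bsub>G\<^esub> y = y \<otimes>\<^bsub>G\<^esub> x}"

primrec lower_central :: "('a, 'b) monoid_scheme \<Rightarrow> nat \<Rightarrow> 'a set" where
  "lower_central G 0 = carrier G"
| "lower_central G (Suc k) =
     generate G (\<Union>x\<in>lower_central G k. \<Union>y\<in>carrier G.
       {x \<otimes>\<^bsub>G\<^esub> y \<otimes>\<^bsub>G\<^esub> inv\<^bsub>G\<^esub> x \<otimes>\<^bsub>G\<^esub> inv\<^bsub>G\<^esub> y})"

definition nilpotency_class_le :: "('a, 'b) monoid_scheme \<Rightarrow> nat \<Rightarrow> bool" where
  "nilpotency_class_le G k \<longleftrightarrow> lower_central G k = {\<one>\<^bsub>G\<^esub>}"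

text \<open>
  For an abelian group \<open>A\<close> of exponent \<open>p\<close>, written multiplicatively, the residue class of \<open>k\<close>
  acts on \<open>x\<close> as the power \<open>x [^] k\<close>; the linear combination of \<open>c 1, \<dots>, c n\<close> with coefficients
  \<open>a 1, \<dots>, a n\<close> is thus the product below, and \<open>p dvd a i\<close> says that the \<open>i\<close>-th coefficient is
  zero in \<open>\<bbbF>\<^sub>p\<close>.
\<close>

definition Fp_independent :: "nat \<Rightarrow> ('a, 'b) monoid_scheme \<Rightarrow> nat \<Rightarrow> (nat \<Rightarrow> 'a) \<Rightarrow> bool" where
  "Fp_independent p A n c \<longleftrightarrow>
     (\<forall>a :: nat \<Rightarrow> nat.
        finprod A (\<lambda>i. c i [^]\<^bsub>A\<^esub> a i) {1..n} = \<one>\<^bsub>A\<^esub> \<longrightarrow> (\<forall>i\<in>{1..n}. p dvd a i))"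

definition GG :: "nat \<Rightarrow> nat \<Rightarrow> 'a L_struct set" where
  "GG p n = {G. L_structure n G \<and> group G \<and> (\<forall>x\<in>carrier G. linv G x = inv\<^bsub>G\<^esub> x) \<and>
     nilpotency_class_le G 2 \<and> (\<forall>x\<in>carrier G. x [^]\<^bsub>G\<^esub> p = \<one>\<^bsub>G\<^esub>) \<and>
     derived G (carrier G) \<subseteq> generate G (lconst G ` {1..n}) \<and>
     generate G (lconst G ` {1..n}) \<subseteq> center G \<and>
     Fp_independent p (G\<lparr>carrier := center G\<rparr>) n (lconst G)}"

definition KK :: "nat \<Rightarrow> nat \<Rightarrow> 'a L_struct set" where
  "KK p n = {G \<in> GG p n. finite (carrier G)}"


section \<open>Fraisse theory\<close>

text \<open>
  A class of structures is given by the set of its members whose carrier is contained in a fixed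
  type \<open>'a\<close>. When \<open>'a\<close> is infinite this represents every isomorphism type of countable structures.
\<close>

definition hereditary :: "nat \<Rightarrow> 'a L_struct set \<Rightarrow> bool" where
  "hereditary n K \<longleftrightarrow> (\<forall>A\<in>K. \<forall>B. fg_substructure n B A \<longrightarrow> B \<in> K)"

definition joint_embedding :: "nat \<Rightarrow> 'a L_struct set \<Rightarrow> bool" where
  "joint_embedding n K \<longleftrightarrow>
     (\<forall>A\<in>K. \<forall>B\<in>K. \<exists>C\<in>K. \<exists>f g. L_embedding n f A C \<and> L_embedding n g B C)"

definition amalgamation :: "nat \<Rightarrow> 'a L_struct set \<Rightarrow> bool" where
  "amalgamation n K \<longleftrightarrow>
     (\<forall>A\<in>K. \<forall>B\<in>K. \<forall>C\<in>K. \<forall>f g. L_embedding n f A B \<longrightarrow> L_embedding n g A C \<longrightarrow>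
        (\<exists>D\<in>K. \<exists>h k. L_embedding n h B D \<and> L_embedding n k C D \<and>
           (\<forall>x\<in>carrier A. h (f x) = k (g x))))"

definition ultrahomogeneous :: "nat \<Rightarrow> 'a L_struct \<Rightarrow> bool" where
  "ultrahomogeneous n D \<longleftrightarrow>
     (\<forall>A B f. fg_substructure n A D \<longrightarrow> fg_substructure n B D \<longrightarrow> L_isomorphism n f A B \<longrightarrow>
        (\<exists>g. L_isomorphism n g D D \<and> (\<forall>x\<in>carrier A. g x = f x)))"

definition fraisse_limit :: "nat \<Rightarrow> 'a L_struct set \<Rightarrow> 'a L_struct \<Rightarrow> bool" where
  "fraisse_limit n K D \<longleftrightarrow>
     L_structure n D \<and> countable (carrier D) \<and> ultrahomogeneous n D \<and>
     (\<forall>B. fg_substructure n B D \<longrightarrow> (\<exists>A\<in>K. L_isomorphic n B A)) \<and>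
     (\<forall>A\<in>K. \<exists>B. fg_substructure n B D \<and> L_isomorphic n B A)"


section \<open>First-order logic over \<open>L(n)\<close>\<close>

datatype L_term = TVar nat | TOne | TMult L_term L_term | TInv L_term | TConst nat

datatype L_form = FEq L_term L_term | FNot L_form | FAnd L_form L_form | FEx nat L_form

primrec term_in :: "nat \<Rightarrow> L_term \<Rightarrow> bool" where
  "term_in n (TVar x) \<longleftrightarrow> True"
| "term_in n TOne \<longleftrightarrow> True"
| "term_in n (TMult s t) \<longleftrightarrow> term_in n s \<and> term_in n t"
| "term_in n (TInv t) \<longleftrightarrow> term_in n t"
| "term_in n (TConst i) \<longleftrightarrow> i \<in> {1..n}"

primrec form_in :: "nat \<Rightarrow> L_form \<Rightarrow> bool" where
  "form_in n (FEq s t) \<longleftrightarrow> term_in n s \<and> term_in n t"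
| "form_in n (FNot \<phi>) \<longleftrightarrow> form_in n \<phi>"
| "form_in n (FAnd \<phi> \<psi>) \<longleftrightarrow> form_in n \<phi> \<and> form_in n \<psi>"
| "form_in n (FEx x \<phi>) \<longleftrightarrow> form_in n \<phi>"

primrec term_vars :: "L_term \<Rightarrow> nat set" where
  "term_vars (TVar x) = {x}"
| "term_vars TOne = {}"
| "term_vars (TMult s t) = term_vars s \<union> term_vars t"
| "term_vars (TInv t) = term_vars t"
| "term_vars (TConst i) = {}"

primrec free_vars :: "L_form \<Rightarrow> nat set" where
  "free_vars (FEq s t) = term_vars s \<union> term_vars t"
| "free_vars (FNot \<phi>) = free_vars \<phi>"
| "free_vars (FAnd \<phi> \<psi>) = free_vars \<phi> \<union> free_vars \<psi>"
| "free_vars (FEx x \<phi>) = free_vars \<phi> - {x}"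

primrec quantifier_free :: "L_form \<Rightarrow> bool" where
  "quantifier_free (FEq s t) \<longleftrightarrow> True"
| "quantifier_free (FNot \<phi>) \<longleftrightarrow> quantifier_free \<phi>"
| "quantifier_free (FAnd \<phi> \<psi>) \<longleftrightarrow> quantifier_free \<phi> \<and> quantifier_free \<psi>"
| "quantifier_free (FEx x \<phi>) \<longleftrightarrow> False"

primrec term_val :: "'a L_struct \<Rightarrow> (nat \<Rightarrow> 'a) \<Rightarrow> L_term \<Rightarrow> 'a" where
  "term_val M e (TVar x) = e x"
| "term_val M e TOne = \<one>\<^bsub>M\<^esub>"
| "term_val M e (TMult s t) = term_val M e s \<otimes>\<^bsub>M\<^esub> term_val M e t"
| "term_val M e (TInv t) = linv M (term_val M e t)"
| "term_val M e (TConst i) = lconst M i"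

primrec sat :: "'a L_struct \<Rightarrow> (nat \<Rightarrow> 'a) \<Rightarrow> L_form \<Rightarrow> bool" where
  "sat M e (FEq s t) \<longleftrightarrow> term_val M e s = term_val M e t"
| "sat M e (FNot \<phi>) \<longleftrightarrow> \<not> sat M e \<phi>"
| "sat M e (FAnd \<phi> \<psi>) \<longleftrightarrow> sat M e \<phi> \<and> sat M e \<psi>"
| "sat M e (FEx x \<phi>) \<longleftrightarrow> (\<exists>a\<in>carrier M. sat M (e(x := a)) \<phi>)"

definition sentence :: "nat \<Rightarrow> L_form \<Rightarrow> bool" where
  "sentence n \<phi> \<longleftrightarrow> form_in n \<phi> \<and> free_vars \<phi> = {}"

definition holds :: "'a L_struct \<Rightarrow> L_form \<Rightarrow> bool" where
  "holds M \<phi> \<longleftrightarrow> (\<forall>e. range e \<subseteq> carrier M \<longrightarrow> sat M e \<phi>)"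

definition Th :: "nat \<Rightarrow> 'a L_struct \<Rightarrow> L_form set" where
  "Th n M = {\<phi>. sentence n \<phi> \<and> holds M \<phi>}"

definition model :: "nat \<Rightarrow> L_form set \<Rightarrow> 'a L_struct \<Rightarrow> bool" where
  "model n T M \<longleftrightarrow> L_structure n M \<and> (\<forall>\<phi>\<in>T. holds M \<phi>)"

text \<open>
  The argument of type \<open>'a itself\<close> is the type over which the models range. As \<open>L(n)\<close> is countable,
  any infinite type suffices, by the Loewenheim-Skolem theorem.
\<close>

definition aleph0_categorical :: "'a itself \<Rightarrow> nat \<Rightarrow> L_form set \<Rightarrow> bool" where
  "aleph0_categorical (u :: 'a itself) n T \<longleftrightarrow>
     (\<exists>M :: 'a L_struct. model n T M \<and> countable (carrier M) \<and> infinite (carrier M)) \<and>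
     (\<forall>(M :: 'a L_struct) (N :: 'a L_struct).
        model n T M \<and> countable (carrier M) \<and> infinite (carrier M) \<longrightarrow>
        model n T N \<and> countable (carrier N) \<and> infinite (carrier N) \<longrightarrow> L_isomorphic n M N)"

definition quantifier_elimination :: "'a itself \<Rightarrow> nat \<Rightarrow> L_form set \<Rightarrow> bool" where
  "quantifier_elimination (u :: 'a itself) n T \<longleftrightarrow>
     (\<forall>\<phi>. form_in n \<phi> \<longrightarrow>
        (\<exists>\<psi>. form_in n \<psi> \<and> quantifier_free \<psi> \<and> free_vars \<psi> \<subseteq> free_vars \<phi> \<and>
           (\<forall>M :: 'a L_struct. model n T M \<longrightarrow>
              (\<forall>e. range e \<subseteq> carrier M \<longrightarrow> (sat M e \<phi> \<longleftrightarrow> sat M e \<psi>)))))"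

end

theory Submission
  imports Defs "HOL-Number_Theory.Cong"
begin

text \<open>
  A member of \<open>\<bbbG>(n)\<close> is built from a vector space \<open>V\<close> over \<open>\<bbbF>\<^sub>p\<close> by twisting the addition of \<open>V \<times> \<bbbF>\<^sub>p\<^sup>n\<close> by a
  bilinear form \<open>V \<times> V \<rightarrow> \<bbbF>\<^sub>p\<^sup>n\<close>; commutators are the alternating part of the form,
  and the exponent is \<open>p\<close> because \<open>p\<close> is odd. If the form on a space with basis \<open>e\<^sub>0, e\<^sub>1, \<dots>\<close> is chosen generically, so
  that every functional on the span of \<open>e\<^sub>0, \<dots>, e\<^sub>k\<^sub>-\<^sub>1\<close> is the commutator with some later \<open>e\<^sub>m\<close> (as for the random graph),
  then every embedding of a finite subgroup \<open>H\<close> of a member \<open>A\<close> of \<open>\<bbbG>(n)\<close> into this group extends to \<open>\<langle>H, x\<rangle>\<close> for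
  each \<open>x \<in> A\<close>: the image of \<open>x\<close> only has to act by conjugation as \<open>x\<close> does on \<open>H\<close>. Hence the group is
  ultrahomogeneous with age \<open>\<bbbK>(n)\<close>, and the age of an ultrahomogeneous structure has the joint embedding and
  amalgamation properties. Quantifier elimination and categoricity hold because finitely many atomic formulas
  determine the isomorphism type of a tuple, and hence, by ultrahomogeneity, its orbit.
\<close>

subsection \<open>Atomic types and back-and-forth\<close>

text \<open>So little has to be matched because a substructure contains the constants, hence all
  commutators, and is therefore normal; as \<open>x\<close> has order dividing \<open>p\<close>, the
  group \<langle>H, x\<rangle> is either \<open>H\<close> itself or a semidirect product of
  \<open>H\<close> with a cyclic group of order \<open>p\<close>. A direct proof of amalgamation
  would need a pushout for every pair of embeddings; one group built by hand replaces all of them,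
  and the members of the class are recovered as its finitely generated pieces. The price is that
  this group lives in one concrete type and must be copied into the type of the class, and that an
  arbitrary Fraisse limit must be compared with it through uniqueness. Tuples are total assignments
  of which only a finite part counts, as in \<open>sat\<close>; so atomic types, satisfaction and
  one abstract back-and-forth argument fit together. That argument is run with equality of atomic
  types for uniqueness and homogeneity, and with equality of complete types for
  categoricity.\<close>

definition tm :: "nat \<Rightarrow> nat set \<Rightarrow> L_term set" where
  "tm n F = {t. term_in n t \<and> term_vars t \<subseteq> F}"

text \<open>Equality of atomic types: \<open>e i \<mapsto> e' i\<close>, for \<open>i \<in> F\<close>, induces an isomorphism of the generated substructures.\<close>

definition qfeq :: "nat \<Rightarrow> 'a L_struct \<Rightarrow> (nat \<Rightarrow> 'a) \<Rightarrow> 'b L_struct \<Rightarrow> (nat \<Rightarrow> 'b) \<Rightarrow> nat set \<Rightarrow> bool" where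
  "qfeq n M e N e' F \<longleftrightarrow> (\<forall>t\<in>tm n F. \<forall>u\<in>tm n F.
     term_val M e t = term_val M e u \<longleftrightarrow> term_val N e' t = term_val N e' u)"

lemma tm_simps [simp]:
  "TVar x \<in> tm n F \<longleftrightarrow> x \<in> F" "TOne \<in> tm n F" "TMult s t \<in> tm n F \<longleftrightarrow> s \<in> tm n F \<and> t \<in> tm n F"
  "TInv t \<in> tm n F \<longleftrightarrow> t \<in> tm n F" "TConst i \<in> tm n F \<longleftrightarrow> i \<in> {1..n}"
  by (auto simp: tm_def)

lemma tm_induct [consumes 1, case_names Var One Mult Inv Const]:
  assumes "t \<in> tm n F"
    and "\<And>x. x \<in> F \<Longrightarrow> P (TVar x)"
    and "P TOne"
    and "\<And>s t. s \<in> tm n F \<Longrightarrow> t \<in> tm n F \<Longrightarrow> P s \<Longrightarrow> P t \<Longrightarrow> P (TMult s t)"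
    and "\<And>t. t \<in> tm n F \<Longrightarrow> P t \<Longrightarrow> P (TInv t)"
    and "\<And>i. i \<in> {1..n} \<Longrightarrow> P (TConst i)"
  shows "P t"
  using assms(1) by (induction t) (simp_all add: assms(2-))

lemma tm_mono: "t \<in> tm n F \<Longrightarrow> F \<subseteq> F' \<Longrightarrow> t \<in> tm n F'"
  by (auto simp: tm_def)

lemma L_closedD:
  assumes "L_closed n M S"
  shows "\<one>\<^bsub>M\<^esub> \<in> S" "x \<in> S \<Longrightarrow> y \<in> S \<Longrightarrow> x \<otimes>\<^bsub>M\<^esub> y \<in> S" "x \<in> S \<Longrightarrow> linv M x \<in> S"
    "i \<in> {1..n} \<Longrightarrow> lconst M i \<in> S"
  using assms unfolding L_closed_def by auto

lemma L_embeddingD: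
  assumes "L_embedding n f A B"
  shows "x \<in> carrier A \<Longrightarrow> f x \<in> carrier B" "inj_on f (carrier A)" "f \<one>\<^bsub>A\<^esub> = \<one>\<^bsub>B\<^esub>"
    "x \<in> carrier A \<Longrightarrow> y \<in> carrier A \<Longrightarrow> f (x \<otimes>\<^bsub>A\<^esub> y) = f x \<otimes>\<^bsub>B\<^esub> f y"
    "x \<in> carrier A \<Longrightarrow> f (linv A x) = linv B (f x)"
    "i \<in> {1..n} \<Longrightarrow> f (lconst A i) = lconst B i"
  using assms unfolding L_embedding_def by auto

lemma term_val_closed:
  assumes "t \<in> tm n F" "L_closed n M S" "e ` F \<subseteq> S"
  shows "term_val M e t \<in> S"
  using assms(1) by (induction rule: tm_induct) (use assms(2,3) in \<open>auto simp: L_closed_def\<close>)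

lemma term_val_carrier:
  "t \<in> tm n F \<Longrightarrow> L_structure n M \<Longrightarrow> e ` F \<subseteq> carrier M \<Longrightarrow> term_val M e t \<in> carrier M"
  by (rule term_val_closed) (auto simp: L_structure_def)

lemma term_val_cong:
  "t \<in> tm n F \<Longrightarrow> (\<And>i. i \<in> F \<Longrightarrow> e i = d i) \<Longrightarrow> term_val M e t = term_val M d t"
  by (induction rule: tm_induct) auto

lemma term_val_restr [simp]: "term_val (M\<lparr>carrier := S\<rparr>) e t = term_val M e t"
  by (induction t) auto

lemma term_val_embedding:
  assumes "t \<in> tm n F" "L_structure n A" "L_embedding n f A B" "e ` F \<subseteq> carrier A"
    "\<And>i. i \<in> F \<Longrightarrow> f (e i) = d i"
  shows "f (term_val A e t) = term_val B d t"
  using assms(1)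
proof (induction rule: tm_induct)
  case (Mult s t)
  then show ?case
    using L_embeddingD(4)[OF assms(3)] term_val_carrier[OF _ assms(2,4)] by simp
next
  case (Inv t)
  then show ?case
    using L_embeddingD(5)[OF assms(3)] term_val_carrier[OF _ assms(2,4)] by simp
qed (use assms(5) L_embeddingD[OF assms(3)] in auto)

lemma qfeq_embedding:
  assumes "L_structure n A" "L_embedding n f A B" "e ` F \<subseteq> carrier A" "\<And>i. i \<in> F \<Longrightarrow> f (e i) = d i"
  shows "qfeq n A e B d F"
  unfolding qfeq_def
proof (intro ballI)
  fix t u assume tu: "t \<in> tm n F" "u \<in> tm n F"
  have "f (term_val A e t) = term_val B d t" "f (term_val A e u) = term_val B d u"
    using term_val_embedding[OF _ assms] tu by auto
  then show "term_val A e t = term_val A e u \<longleftrightarrow> term_val B d t = term_val B d u"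
    using tu L_embeddingD(2)[OF assms(2)] term_val_carrier[OF _ assms(1,3)]
    by (metis inj_on_eq_iff)
qed

lemma qfeq_sym: "qfeq n M e N d F \<Longrightarrow> qfeq n N d M e F"
  by (auto simp: qfeq_def)

lemma qfeq_trans: "qfeq n M e N d F \<Longrightarrow> qfeq n N d K g F \<Longrightarrow> qfeq n M e K g F"
  by (auto simp: qfeq_def)

lemma qfeq_mono: "qfeq n M e N d F \<Longrightarrow> F' \<subseteq> F \<Longrightarrow> qfeq n M e N d F'"
  unfolding qfeq_def using tm_mono by blast

lemma qfeq_cong:
  assumes "qfeq n M e N d F" "\<And>i. i \<in> F \<Longrightarrow> e i = e' i" "\<And>i. i \<in> F \<Longrightarrow> d i = d' i"
  shows "qfeq n M e' N d' F"
proof -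
  have "term_val M e t = term_val M e' t" "term_val N d t = term_val N d' t" if "t \<in> tm n F" for t
    using term_val_cong that assms(2,3) by metis+
  with assms(1) show ?thesis by (auto simp: qfeq_def)
qed

lemma qfeq_restr: "qfeq n (M\<lparr>carrier := S\<rparr>) e N d F \<longleftrightarrow> qfeq n M e N d F"
  by (simp add: qfeq_def)

text \<open>The values of the terms over \<open>F\<close> are closed under all operations, and every
  closed set containing the tuple contains them. Maps on a generated substructure can thus be
  defined term by term.\<close>

lemma L_generated_eq:
  assumes "L_structure n M" "e ` F \<subseteq> carrier M"
  shows "L_generated n M (e ` F) = term_val M e ` tm n F"
proof
  have "e ` F \<subseteq> term_val M e ` tm n F"
    by (force intro: image_eqI[where x = "TVar _"])
  moreover have "term_val M e ` tm n F \<subseteq> carrier M"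
    using term_val_carrier[OF _ assms] by auto
  moreover have "L_closed n M (term_val M e ` tm n F)"
    unfolding L_closed_def
  proof (intro conjI ballI)
    show "\<one>\<^bsub>M\<^esub> \<in> term_val M e ` tm n F" by (rule image_eqI[where x = TOne]) auto
    fix i assume "i \<in> {1..n}"
    then show "lconst M i \<in> term_val M e ` tm n F" by (intro image_eqI[where x = "TConst i"]) auto
  next
    fix x y assume "x \<in> term_val M e ` tm n F" "y \<in> term_val M e ` tm n F"
    then obtain s t where "s \<in> tm n F" "t \<in> tm n F" "x = term_val M e s" "y = term_val M e t" by auto
    then show "x \<otimes>\<^bsub>M\<^esub> y \<in> term_val M e ` tm n F" by (intro image_eqI[where x = "TMult s t"]) auto
  next
    fix x assume "x \<in> term_val M e ` tm n F"
    then obtain s where "s \<in> tm n F" "x = term_val M e s" by auto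
    then show "linv M x \<in> term_val M e ` tm n F" by (intro image_eqI[where x = "TInv s"]) auto
  qed
  ultimately show "L_generated n M (e ` F) \<subseteq> term_val M e ` tm n F"
    unfolding L_generated_def by blast
  show "term_val M e ` tm n F \<subseteq> L_generated n M (e ` F)"
    unfolding L_generated_def using term_val_closed by blast
qed

lemma L_closed_generated: "L_structure n M \<Longrightarrow> L_closed n M (L_generated n M S)"
  unfolding L_generated_def L_closed_def by blast

lemma L_generated_subset: "S \<subseteq> U \<Longrightarrow> U \<subseteq> carrier M \<Longrightarrow> L_closed n M U \<Longrightarrow> L_generated n M S \<subseteq> U"
  unfolding L_generated_def by blast

lemma L_generated_carrier: "L_structure n M \<Longrightarrow> S \<subseteq> carrier M \<Longrightarrow> L_generated n M S \<subseteq> carrier M"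
  by (rule L_generated_subset) (auto simp: L_structure_def)

lemma L_generated_superset: "S \<subseteq> L_generated n M S"
  unfolding L_generated_def by blast

lemma substructure_restr:
  assumes "S \<subseteq> carrier M" "L_closed n M S"
  shows "L_substructure n (M\<lparr>carrier := S\<rparr>) M"
  using assms unfolding L_substructure_def L_structure_def L_embedding_def L_closed_def by auto

lemma structure_restr: "L_closed n M S \<Longrightarrow> L_structure n (M\<lparr>carrier := S\<rparr>)"
  unfolding L_structure_def L_closed_def by auto

lemma fg_restr_generated:
  assumes "L_structure n M" "S \<subseteq> carrier M" "finite S"
  shows "fg_substructure n (M\<lparr>carrier := L_generated n M S\<rparr>) M"
  unfolding fg_substructure_def
  using assms substructure_restr[OF L_generated_carrier L_closed_generated] by auto

lemma L_embedding_restr_iff: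
  "L_embedding n f (M\<lparr>carrier := S\<rparr>) N \<longleftrightarrow>
     f ` S \<subseteq> carrier N \<and> inj_on f S \<and> f \<one>\<^bsub>M\<^esub> = \<one>\<^bsub>N\<^esub> \<and>
     (\<forall>x\<in>S. \<forall>y\<in>S. f (x \<otimes>\<^bsub>M\<^esub> y) = f x \<otimes>\<^bsub>N\<^esub> f y) \<and>
     (\<forall>x\<in>S. f (linv M x) = linv N (f x)) \<and> (\<forall>i\<in>{1..n}. f (lconst M i) = lconst N i)"
  by (simp add: L_embedding_def)

text \<open>The map sends the value of a term under \<open>e\<close> to its value under
  \<open>d\<close>; \<open>qfeq\<close> says exactly that this is well defined and injective. With
  \<open>qfeq_embedding\<close> as the converse, partial embeddings can be handled as pairs of
  tuples, without tracking domains.\<close>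

lemma qfeq_imp_embedding:
  assumes M: "L_structure n M" "e ` F \<subseteq> carrier M" and N: "L_structure n N" "d ` F \<subseteq> carrier N"
    and q: "qfeq n M e N d F"
  obtains f where "L_embedding n f (M\<lparr>carrier := L_generated n M (e ` F)\<rparr>) N"
    "\<And>t. t \<in> tm n F \<Longrightarrow> f (term_val M e t) = term_val N d t"
    "\<And>i. i \<in> F \<Longrightarrow> f (e i) = d i"
proof -
  define f where "f x = term_val N d (SOME t. t \<in> tm n F \<and> term_val M e t = x)" for x
  have f: "f (term_val M e t) = term_val N d t" if "t \<in> tm n F" for t
  proof -
    have "(SOME u. u \<in> tm n F \<and> term_val M e u = term_val M e t) \<in> tm n F \<and>
      term_val M e (SOME u. u \<in> tm n F \<and> term_val M e u = term_val M e t) = term_val M e t"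
      by (rule someI[where x = t]) (use that in auto)
    with q that show ?thesis unfolding f_def qfeq_def by blast
  qed
  have fi: "f (e i) = d i" if "i \<in> F" for i
    using f[of "TVar i"] that by simp
  have "L_embedding n f (M\<lparr>carrier := term_val M e ` tm n F\<rparr>) N"
    unfolding L_embedding_restr_iff
  proof (intro conjI ballI)
    show "f ` term_val M e ` tm n F \<subseteq> carrier N"
      using f term_val_carrier[OF _ N] by auto
    show "inj_on f (term_val M e ` tm n F)"
      using f q unfolding qfeq_def inj_on_def by auto
    show "f \<one>\<^bsub>M\<^esub> = \<one>\<^bsub>N\<^esub>"
      using f[of TOne] by simp
  next
    fix x y assume "x \<in> term_val M e ` tm n F" "y \<in> term_val M e ` tm n F"
    then obtain s t where "s \<in> tm n F" "t \<in> tm n F" "x = term_val M e s" "y = term_val M e t" by auto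
    then show "f (x \<otimes>\<^bsub>M\<^esub> y) = f x \<otimes>\<^bsub>N\<^esub> f y"
      using f[of "TMult s t"] by (simp add: f)
  next
    fix x assume "x \<in> term_val M e ` tm n F"
    then obtain s where "s \<in> tm n F" "x = term_val M e s" by auto
    then show "f (linv M x) = linv N (f x)"
      using f[of "TInv s"] by (simp add: f)
  next
    fix i assume "i \<in> {1..n}"
    then show "f (lconst M i) = lconst N i" using f[of "TConst i"] by simp
  qed
  then show ?thesis
    using that f fi L_generated_eq[OF M] by auto
qed

lemma L_embedding_comp:
  assumes "L_embedding n f A B" "L_embedding n g B C"
  shows "L_embedding n (g \<circ> f) A C"
  using assms unfolding L_embedding_def
  by (auto simp: inj_on_def image_subset_iff)

lemma L_embedding_into:
  "L_embedding n f A B \<Longrightarrow> f ` carrier A \<subseteq> S \<Longrightarrow> L_embedding n f A (B\<lparr>carrier := S\<rparr>)"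
  unfolding L_embedding_def by auto

lemma L_closed_image:
  assumes "L_structure n A" "L_embedding n f A B"
  shows "L_closed n B (f ` carrier A)"
  unfolding L_closed_def
proof (intro conjI ballI)
  note A = L_closedD[OF assms(1)[unfolded L_structure_def]]
  note f = L_embeddingD[OF assms(2)]
  show "\<one>\<^bsub>B\<^esub> \<in> f ` carrier A" using A f by (metis image_eqI)
  show "x \<otimes>\<^bsub>B\<^esub> y \<in> f ` carrier A" if xy: "x \<in> f ` carrier A" "y \<in> f ` carrier A" for x y
  proof -
    from xy obtain a b where ab: "a \<in> carrier A" "b \<in> carrier A" "x = f a" "y = f b" by auto
    then show ?thesis using f(4)[OF ab(1,2)] A(2)[OF ab(1,2)] by (metis image_eqI)
  qed
  show "linv B x \<in> f ` carrier A" if x: "x \<in> f ` carrier A" for x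
  proof -
    from x obtain a where a: "a \<in> carrier A" "x = f a" by auto
    then show ?thesis using f(5)[OF a(1)] A(3)[OF a(1)] by (metis image_eqI)
  qed
  show "lconst B i \<in> f ` carrier A" if i: "i \<in> {1..n}" for i
    using A(4)[OF i] f(6)[OF i] by (metis image_eqI)
qed

lemma L_isomorphism_inv:
  assumes "L_structure n A" "L_isomorphism n f A B"
  shows "L_isomorphism n (inv_into (carrier A) f) B A"
proof -
  note A = L_closedD[OF assms(1)[unfolded L_structure_def]]
  have e: "L_embedding n f A B" and im: "f ` carrier A = carrier B"
    using assms(2) by (auto simp: L_isomorphism_def)
  note f = L_embeddingD[OF e]
  let ?g = "inv_into (carrier A) f"
  have gf: "?g (f x) = x" if "x \<in> carrier A" for x using f(2) that by simp
  have gA: "?g ` carrier B = carrier A"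
    using im gf by (force simp flip: im)
  have "L_embedding n ?g B A"
    unfolding L_embedding_def
  proof (intro conjI ballI)
    show "?g ` carrier B \<subseteq> carrier A" using gA by simp
    show "inj_on ?g (carrier B)" using im by (simp add: inj_on_inv_into)
    show "?g \<one>\<^bsub>B\<^esub> = \<one>\<^bsub>A\<^esub>" using gf[OF A(1)] f(3) by simp
  next
    fix x y assume "x \<in> carrier B" "y \<in> carrier B"
    then obtain a b where ab: "a \<in> carrier A" "b \<in> carrier A" "x = f a" "y = f b" using im by blast
    then show "?g (x \<otimes>\<^bsub>B\<^esub> y) = ?g x \<otimes>\<^bsub>A\<^esub> ?g y" using gf A(2) f(4) by metis
  next
    fix x assume "x \<in> carrier B"
    then obtain a where a: "a \<in> carrier A" "x = f a" using im by blast
    then show "?g (linv B x) = linv A (?g x)" using gf A(3) f(5) by metis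
  next
    fix i assume "i \<in> {1..n}"
    then show "?g (lconst B i) = lconst A i" using gf A(4) f(6) by metis
  qed
  with gA show ?thesis by (simp add: L_isomorphism_def)
qed

section \<open>Isomorphisms of countable structures from enumerations\<close>

lemma qfeq_isomorphism:
  assumes M: "L_structure n M" "range e = carrier M" and N: "L_structure n N" "range d = carrier N"
    and q: "qfeq n M e N d UNIV"
  obtains f where "L_isomorphism n f M N" "\<And>i. f (e i) = d i"
proof -
  obtain f where f: "L_embedding n f (M\<lparr>carrier := L_generated n M (range e)\<rparr>) N" "\<And>i. f (e i) = d i"
    by (rule qfeq_imp_embedding[OF M(1) _ N(1) _ q]) (use M(2) N(2) in auto)
  have "L_generated n M (range e) = carrier M"
    using L_generated_carrier[OF M(1), of "range e"] L_generated_superset[of "range e" n M] M(2) by auto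
  then have "L_embedding n f M N" using f(1) by simp
  moreover have "f ` carrier M = carrier N"
    using M(2) N(2) f(2) by (metis (no_types, lifting) image_cong image_image)
  ultimately show ?thesis using that f(2) by (auto simp: L_isomorphism_def)
qed

text \<open>An equation between two terms involves only finitely many variables.\<close>

lemma qfeq_UNIV:
  assumes "\<And>k::nat. qfeq n M e N d {..<k}"
  shows "qfeq n M e N d UNIV"
  unfolding qfeq_def
proof (intro ballI)
  fix t u assume tu: "t \<in> tm n UNIV" "u \<in> tm n UNIV"
  have fin: "finite (term_vars t)" for t by (induction t) auto
  obtain k where "term_vars t \<union> term_vars u \<subseteq> {..<k}"
    using finite_nat_set_iff_bounded[of "term_vars t \<union> term_vars u"] fin by auto
  then have "t \<in> tm n {..<k}" "u \<in> tm n {..<k}" using tu by (auto simp: tm_def)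
  with assms[of k] show "term_val M e t = term_val M e u \<longleftrightarrow> term_val N d t = term_val N d u"
    by (auto simp: qfeq_def)
qed

text \<open>The relation \<open>R\<close> is abstract because both atomic types and complete types
  will be used. \<open>R e d k\<close> is meant to concern only the first \<open>k\<close> entries,
  which is what \<open>cong\<close> requires. A start of length \<open>k0\<close> is kept, so that
  the resulting map can extend a given one.\<close>

lemma back_and_forth:
  fixes A :: "'a set" and B :: "'b set"
    and R :: "(nat \<Rightarrow> 'a) \<Rightarrow> (nat \<Rightarrow> 'b) \<Rightarrow> nat \<Rightarrow> bool"
  assumes cA: "countable A" "A \<noteq> {}" and cB: "countable B" "B \<noteq> {}"
    and cong: "\<And>e d e' d' k. R e d k \<Longrightarrow> (\<And>i. i < k \<Longrightarrow> e i = e' i) \<Longrightarrow> (\<And>i. i < k \<Longrightarrow> d i = d' i) \<Longrightarrow>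
      range e' \<subseteq> A \<Longrightarrow> range d' \<subseteq> B \<Longrightarrow> R e' d' k"
    and forth: "\<And>e d k x. R e d k \<Longrightarrow> range e \<subseteq> A \<Longrightarrow> range d \<subseteq> B \<Longrightarrow> x \<in> A \<Longrightarrow>
      \<exists>y\<in>B. R (e(k := x)) (d(k := y)) (Suc k)"
    and backw: "\<And>e d k y. R e d k \<Longrightarrow> range e \<subseteq> A \<Longrightarrow> range d \<subseteq> B \<Longrightarrow> y \<in> B \<Longrightarrow>
      \<exists>x\<in>A. R (e(k := x)) (d(k := y)) (Suc k)"
    and start: "R e0 d0 k0" "range e0 \<subseteq> A" "range d0 \<subseteq> B"
  obtains e d where "range e = A" "range d = B" "\<And>k. k \<ge> k0 \<Longrightarrow> R e d k"
    "\<And>i. i < k0 \<Longrightarrow> e i = e0 i \<and> d i = d0 i"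
proof -
  define a where "a = from_nat_into A"
  define b where "b = from_nat_into B"
  have a: "range a = A" and b: "range b = B"
    using cA cB by (auto simp: a_def b_def range_from_nat_into)
  \<comment> \<open>Relates consecutive stages: only entry \<open>k\<close> changes and, counting
    from \<open>k0\<close>, even steps put the next element of \<open>A\<close> on the left, odd
    steps the next element of \<open>B\<close> on the right.\<close>
  define Q where "Q k s t \<longleftrightarrow> (\<forall>i. i \<noteq> k \<longrightarrow> fst t i = fst s i \<and> snd t i = snd s i) \<and>
    (if even (k - k0) then fst t k = a ((k - k0) div 2) else snd t k = b ((k - k0) div 2))"
    for k and s t :: "(nat \<Rightarrow> 'a) \<times> (nat \<Rightarrow> 'b)"
  define I where "I k s \<longleftrightarrow> R (fst s) (snd s) k \<and> range (fst s) \<subseteq> A \<and> range (snd s) \<subseteq> B" for k s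
  have step: "\<exists>t. I (Suc k) t \<and> Q k s t" if "I k s" for k s
  proof -
    have "\<exists>x\<in>A. \<exists>y\<in>B. R ((fst s)(k := x)) ((snd s)(k := y)) (Suc k) \<and>
      (if even (k - k0) then x = a ((k - k0) div 2) else y = b ((k - k0) div 2))"
      using forth[of "fst s" "snd s" k "a ((k - k0) div 2)"] backw[of "fst s" "snd s" k "b ((k - k0) div 2)"]
        that a b unfolding I_def by (cases "even (k - k0)") auto
    then obtain x y where "x \<in> A" "y \<in> B" "R ((fst s)(k := x)) ((snd s)(k := y)) (Suc k)"
      "if even (k - k0) then x = a ((k - k0) div 2) else y = b ((k - k0) div 2)" by blast
    then show ?thesis
      using that by (intro exI[of _ "((fst s)(k := x), (snd s)(k := y))"]) (auto simp: I_def Q_def)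
  qed
  define nx where "nx k s = (SOME t. I (Suc k) t \<and> Q k s t)" for k s
  have nx: "I (Suc k) (nx k s)" "Q k s (nx k s)" if "I k s" for k s
    using someI_ex[OF step[OF that]] by (auto simp: nx_def)
  define S where "S = rec_nat (e0, d0) (\<lambda>j s. nx (k0 + j) s)"
  have S0: "S 0 = (e0, d0)" and S1: "S (Suc j) = nx (k0 + j) (S j)" for j by (simp_all add: S_def)
  have I: "I (k0 + j) (S j)" for j
    by (induction j) (use start nx in \<open>auto simp: S0 S1 I_def\<close>)
  have Q: "Q (k0 + j) (S j) (S (Suc j))" for j using nx(2)[OF I[of j]] by (simp add: S1)
  have stab: "fst (S (j + m)) i = fst (S j) i \<and> snd (S (j + m)) i = snd (S j) i" if "i < k0 + j" for i j m
  proof (induction m)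
    case (Suc m)
    then show ?case using Q[of "j + m"] that unfolding Q_def by auto
  qed auto
  \<comment> \<open>Entry \<open>i\<close> is final from stage \<open>Suc i - k0\<close> on; for
    \<open>i < k0\<close> the truncated difference is 0, the stage of the given start.\<close>
  define e where "e i = fst (S (Suc i - k0)) i" for i
  define d where "d i = snd (S (Suc i - k0)) i" for i
  have ed: "e i = fst (S j) i \<and> d i = snd (S j) i" if "i < k0 + j" for i j
  proof -
    have "i < k0 + (Suc i - k0)" by auto
    moreover have "Suc i - k0 \<le> j" using that by auto
    ultimately show ?thesis using stab[of i "Suc i - k0" "j - (Suc i - k0)"] by (auto simp: e_def d_def)
  qed
  have rng: "range e \<subseteq> A" "range d \<subseteq> B"
    using I unfolding I_def e_def d_def by blast+
  have eQ: "if even j then e (k0 + j) = a (j div 2) else d (k0 + j) = b (j div 2)" for j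
    using Q[of j] ed[of "k0 + j" "Suc j"] unfolding Q_def by auto
  show ?thesis
  proof
    show "range e = A"
    proof
      show "A \<subseteq> range e"
      proof
        fix x assume "x \<in> A"
        then obtain m where "x = a m" using a by auto
        then have "e (k0 + 2 * m) = x" using eQ[of "2 * m"] by simp
        then show "x \<in> range e" by auto
      qed
    qed (rule rng)
    show "range d = B"
    proof
      show "B \<subseteq> range d"
      proof
        fix x assume "x \<in> B"
        then obtain m where "x = b m" using b by auto
        then have "d (k0 + (2 * m + 1)) = x" using eQ[of "2 * m + 1"] by simp
        then show "x \<in> range d" by auto
      qed
    qed (rule rng)
    show "R e d k" if "k \<ge> k0" for k
    proof -
      have "R (fst (S (k - k0))) (snd (S (k - k0))) k" using I[of "k - k0"] that by (simp add: I_def)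
      then show ?thesis by (rule cong) (use ed[of _ "k - k0"] that rng in auto)
    qed
    show "e i = e0 i \<and> d i = d0 i" if "i < k0" for i
      using ed[of i 0] that by (simp add: S0)
  qed
qed

subsection \<open>The classes in terms of elements\<close>

text \<open>A product in fixed order instead of \<open>finprod\<close>, which makes sense only in
  commutative monoids: \<open>cprod\<close> has to be available in noncommutative groups, and in
  \<open>GG_embedding\<close> even in a structure not yet known to be a group.\<close>

primrec cprod :: "('a, 'b) monoid_scheme \<Rightarrow> (nat \<Rightarrow> 'a) \<Rightarrow> nat \<Rightarrow> (nat \<Rightarrow> nat) \<Rightarrow> 'a" where
  "cprod G c 0 a = \<one>\<^bsub>G\<^esub>"
| "cprod G c (Suc k) a = cprod G c k a \<otimes>\<^bsub>G\<^esub> c (Suc k) [^]\<^bsub>G\<^esub> a (Suc k)"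

locale central_consts = group G for G (structure) +
  fixes p n :: nat and c :: "nat \<Rightarrow> 'a"
  assumes p_pos: "p > 0"
    and const_closed: "i \<in> {1..n} \<Longrightarrow> c i \<in> carrier G"
    and const_comm: "i \<in> {1..n} \<Longrightarrow> x \<in> carrier G \<Longrightarrow> c i \<otimes> x = x \<otimes> c i"
    and pow_p: "x \<in> carrier G \<Longrightarrow> x [^] p = \<one>"
begin

lemma pow_comm: "x \<in> carrier G \<Longrightarrow> y \<in> carrier G \<Longrightarrow> x \<otimes> y = y \<otimes> x \<Longrightarrow> x [^] (i::nat) \<otimes> y = y \<otimes> x [^] i"
proof (induction i)
  case (Suc i)
  then show ?case by (metis m_assoc nat_pow_Suc nat_pow_closed)
qed simp

lemma const_pow_comm: "i \<in> {1..n} \<Longrightarrow> x \<in> carrier G \<Longrightarrow> c i [^] (m::nat) \<otimes> x = x \<otimes> c i [^] m"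
  by (simp add: pow_comm const_comm const_closed)

lemma pow_mod: "x \<in> carrier G \<Longrightarrow> x [^] (i mod p) = x [^] (i::nat)"
proof -
  assume x: "x \<in> carrier G"
  have "x [^] i = x [^] (p * (i div p) + i mod p)" by simp
  also have "\<dots> = x [^] (i mod p)"
    using x by (simp only: nat_pow_mult[symmetric] nat_pow_pow[symmetric] pow_p) simp
  finally show ?thesis by simp
qed

text \<open>With inverses being powers, closure under inverses reduces to closure under products,
  and all exponents can stay natural numbers.\<close>

lemma inv_pow: "x \<in> carrier G \<Longrightarrow> inv x = x [^] (p - 1)"
proof (rule inv_equality)
  assume x: "x \<in> carrier G"
  have "x [^] (p - 1) \<otimes> x = x [^] Suc (p - 1)" by simp
  then show "x [^] (p - 1) \<otimes> x = \<one>" using x pow_p p_pos by simp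
qed auto

lemma cprod_closed [simp]: "k \<le> n \<Longrightarrow> cprod G c k a \<in> carrier G"
  by (induction k) (auto simp: const_closed)

lemma cprod_comm: "k \<le> n \<Longrightarrow> x \<in> carrier G \<Longrightarrow> cprod G c k a \<otimes> x = x \<otimes> cprod G c k a"
proof (induction k)
  case (Suc k)
  then have "c (Suc k) [^] a (Suc k) \<otimes> x = x \<otimes> c (Suc k) [^] a (Suc k)" "c (Suc k) \<in> carrier G"
    by (simp_all add: const_pow_comm const_closed)
  with Suc show ?case by (metis Suc_leD cprod.simps(2) cprod_closed m_assoc nat_pow_closed)
qed simp

lemma cprod_mult: "k \<le> n \<Longrightarrow> cprod G c k a \<otimes> cprod G c k b = cprod G c k (\<lambda>i. a i + b i)"
proof (induction k)
  case (Suc k)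
  let ?A = "cprod G c k a" and ?B = "cprod G c k b" and ?x = "c (Suc k) [^] a (Suc k)" and ?y = "c (Suc k) [^] b (Suc k)"
  have cl: "?A \<in> carrier G" "?B \<in> carrier G" "c (Suc k) \<in> carrier G" using Suc.prems const_closed by auto
  have x: "?x \<in> carrier G" "?y \<in> carrier G" using cl by auto
  have "?x \<otimes> ?B = ?B \<otimes> ?x" using const_pow_comm[OF _ cl(2)] Suc.prems by simp
  then have "?A \<otimes> ?x \<otimes> (?B \<otimes> ?y) = ?A \<otimes> ?B \<otimes> (?x \<otimes> ?y)"
    using cl x by (metis m_assoc m_closed)
  also have "\<dots> = cprod G c k (\<lambda>i. a i + b i) \<otimes> c (Suc k) [^] (a (Suc k) + b (Suc k))"
    using Suc cl by (simp add: nat_pow_mult)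
  finally show ?case by simp
qed auto

lemma cprod_zero: "k \<le> n \<Longrightarrow> cprod G c k (\<lambda>i. 0) = \<one>"
  by (induction k) auto

lemma cprod_cong: "(\<And>i. i \<in> {1..k} \<Longrightarrow> a i = b i) \<Longrightarrow> cprod G c k a = cprod G c k b"
  by (induction k) auto

lemma cprod_unit: "k \<le> n \<Longrightarrow> i \<in> {1..k} \<Longrightarrow> cprod G c k (\<lambda>j. if j = i then 1 else 0) = c i"
proof (induction k)
  case (Suc k)
  show ?case
  proof (cases "i = Suc k")
    case True
    have "cprod G c k (\<lambda>j. if j = i then 1 else 0) = cprod G c k (\<lambda>j. 0)"
      by (rule cprod_cong) (use True in auto)
    then show ?thesis using True Suc.prems cprod_zero const_closed by simp
  next
    case False
    then show ?thesis using Suc const_closed by simp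
  qed
qed auto

lemma cprod_pow: "cprod G c n a [^] (m::nat) = cprod G c n (\<lambda>i. a i * m)"
  by (induction m) (simp_all add: cprod_zero cprod_mult add.commute)

lemma cprod_mod: "k \<le> n \<Longrightarrow> cprod G c k (\<lambda>i. a i mod p) = cprod G c k a"
  by (induction k) (auto simp: pow_mod const_closed)

lemma cprod_subgroup: "subgroup (range (cprod G c n)) G"
proof (rule subgroupI)
  fix x y assume "x \<in> range (cprod G c n)" "y \<in> range (cprod G c n)"
  then show "x \<otimes> y \<in> range (cprod G c n)" using cprod_mult[of n] by auto
next
  fix x assume "x \<in> range (cprod G c n)"
  then show "inv x \<in> range (cprod G c n)" using cprod_pow inv_pow by auto
qed auto

lemma const_in_cprod: "i \<in> {1..n} \<Longrightarrow> c i \<in> range (cprod G c n)"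
  using cprod_unit[of n i] by (metis order_refl rangeI)

lemma generate_consts: "generate G (c ` {1..n}) = range (cprod G c n)"
proof
  show "generate G (c ` {1..n}) \<subseteq> range (cprod G c n)"
    by (rule generate_subgroup_incl[OF _ cprod_subgroup]) (use const_in_cprod in auto)
  have sub: "subgroup (generate G (c ` {1..n})) G"
    by (rule generate_is_subgroup) (use const_closed in auto)
  have pw: "x [^] (m::nat) \<in> generate G (c ` {1..n})" if "x \<in> generate G (c ` {1..n})" for x m
    by (induction m) (use sub that in \<open>auto intro: subgroup.m_closed subgroup.one_closed\<close>)
  have "cprod G c k a \<in> generate G (c ` {1..n})" if "k \<le> n" for k a
    using that
  proof (induction k)
    case (Suc k)
    then have "c (Suc k) \<in> generate G (c ` {1..n})" by (intro generate.incl) auto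
    with Suc show ?case by (simp only: cprod.simps) (intro subgroup.m_closed[OF sub] pw, auto)
  qed (simp add: generate.one)
  then show "range (cprod G c n) \<subseteq> generate G (c ` {1..n})" by auto
qed

lemma center_subgroup: "subgroup (center G) G"
proof (rule subgroupI)
  show "center G \<subseteq> carrier G" unfolding center_def by blast
  have "\<one> \<in> center G" by (simp add: center_def)
  then show "center G \<noteq> {}" by blast
next
  fix a assume "a \<in> center G"
  then have a: "a \<in> carrier G" "\<And>y. y \<in> carrier G \<Longrightarrow> a \<otimes> y = y \<otimes> a" unfolding center_def by blast+
  have "a [^] (p - 1) \<otimes> y = y \<otimes> a [^] (p - 1)" if "y \<in> carrier G" for y
    using pow_comm[OF a(1) that a(2)[OF that]] .
  then show "inv a \<in> center G" using a(1) by (simp add: center_def inv_pow)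
next
  fix a b assume "a \<in> center G" "b \<in> center G"
  then have ab: "a \<in> carrier G" "b \<in> carrier G" "\<And>y. y \<in> carrier G \<Longrightarrow> a \<otimes> y = y \<otimes> a"
    "\<And>y. y \<in> carrier G \<Longrightarrow> b \<otimes> y = y \<otimes> b" unfolding center_def by blast+
  have "a \<otimes> b \<otimes> y = y \<otimes> (a \<otimes> b)" if "y \<in> carrier G" for y
    using ab that by (metis m_assoc)
  then show "a \<otimes> b \<in> center G" using ab(1,2) by (simp add: center_def)
qed

lemma const_center: "i \<in> {1..n} \<Longrightarrow> c i \<in> center G"
  unfolding center_def using const_closed const_comm by blast

text \<open>\<open>Fp_independent\<close> is stated with \<open>finprod\<close> in the abelian group
  on the center; this identifies that product with \<open>cprod\<close> in \<open>G\<close>. The two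
  recursions attach the new factor on opposite sides, which is harmless because the constants are
  central.\<close>

lemma finprod_consts:
  "finprod (G\<lparr>carrier := center G\<rparr>) (\<lambda>i. c i [^]\<^bsub>G\<lparr>carrier := center G\<rparr>\<^esub> a i) {1..n} = cprod G c n a"
proof -
  let ?Z = "G\<lparr>carrier := center G\<rparr>"
  interpret Z: group ?Z by (rule subgroup.subgroup_is_group[OF center_subgroup]) (rule is_group)
  interpret Z: comm_group ?Z
  proof (rule Z.group_comm_groupI)
    fix x y assume "x \<in> carrier ?Z" "y \<in> carrier ?Z"
    then have "x \<in> center G" "y \<in> center G" by simp_all
    then have "x \<otimes> y = y \<otimes> x" unfolding center_def by blast
    then show "x \<otimes>\<^bsub>?Z\<^esub> y = y \<otimes>\<^bsub>?Z\<^esub> x" by simp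
  qed
  have "finprod ?Z (\<lambda>i. c i [^]\<^bsub>?Z\<^esub> a i) {1..k} = cprod G c k a" if "k \<le> n" for k
    using that
  proof (induction k)
    case (Suc k)
    have cl: "c i [^]\<^bsub>?Z\<^esub> a i \<in> carrier ?Z" if "i \<in> {1..Suc k}" for i
      using const_center[of i] that Suc.prems by (intro Z.nat_pow_closed) auto
    have eq: "{1..Suc k} = insert (Suc k) {1..k}" by auto
    have "finprod ?Z (\<lambda>i. c i [^]\<^bsub>?Z\<^esub> a i) {1..Suc k} =
        c (Suc k) [^]\<^bsub>?Z\<^esub> a (Suc k) \<otimes>\<^bsub>?Z\<^esub> finprod ?Z (\<lambda>i. c i [^]\<^bsub>?Z\<^esub> a i) {1..k}"
      unfolding eq by (rule Z.finprod_insert) (use cl in auto)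
    also have "\<dots> = c (Suc k) [^] a (Suc k) \<otimes> cprod G c k a"
      using Suc by (simp flip: nat_pow_consistent)
    also have "\<dots> = cprod G c k a \<otimes> c (Suc k) [^] a (Suc k)"
      using Suc.prems by (intro const_pow_comm) auto
    finally show ?case by simp
  qed auto
  then show ?thesis by simp
qed

end

text \<open>Neither generated subgroups nor the center nor \<open>inv\<close> occur: that a
  commutator lies in the span of the constants is written as
  \<open>x \<otimes> y = cprod \<dots> \<otimes> (y \<otimes> x)\<close>, with exponents that mean
  the same in a substructure.\<close>

definition GG_elem :: "nat \<Rightarrow> nat \<Rightarrow> 'a L_struct \<Rightarrow> bool" where
  "GG_elem p n G \<longleftrightarrow> L_structure n G \<and>
     (\<forall>x\<in>carrier G. \<forall>y\<in>carrier G. \<forall>z\<in>carrier G. x \<otimes>\<^bsub>G\<^esub> y \<otimes>\<^bsub>G\<^esub> z = x \<otimes>\<^bsub>G\<^esub> (y \<otimes>\<^bsub>G\<^esub> z)) \<and>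
     (\<forall>x\<in>carrier G. \<one>\<^bsub>G\<^esub> \<otimes>\<^bsub>G\<^esub> x = x) \<and>
     (\<forall>x\<in>carrier G. linv G x \<otimes>\<^bsub>G\<^esub> x = \<one>\<^bsub>G\<^esub>) \<and>
     (\<forall>x\<in>carrier G. x [^]\<^bsub>G\<^esub> p = \<one>\<^bsub>G\<^esub>) \<and>
     (\<forall>i\<in>{1..n}. \<forall>x\<in>carrier G. lconst G i \<otimes>\<^bsub>G\<^esub> x = x \<otimes>\<^bsub>G\<^esub> lconst G i) \<and>
     (\<forall>x\<in>carrier G. \<forall>y\<in>carrier G. \<exists>a. x \<otimes>\<^bsub>G\<^esub> y = cprod G (lconst G) n a \<otimes>\<^bsub>G\<^esub> (y \<otimes>\<^bsub>G\<^esub> x)) \<and>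
     (\<forall>a. cprod G (lconst G) n a = \<one>\<^bsub>G\<^esub> \<longrightarrow> (\<forall>i\<in>{1..n}. p dvd a i))"

lemma GG_elemD:
  assumes "GG_elem p n G"
  shows "L_structure n G"
    "x \<in> carrier G \<Longrightarrow> y \<in> carrier G \<Longrightarrow> z \<in> carrier G \<Longrightarrow> x \<otimes>\<^bsub>G\<^esub> y \<otimes>\<^bsub>G\<^esub> z = x \<otimes>\<^bsub>G\<^esub> (y \<otimes>\<^bsub>G\<^esub> z)"
    "x \<in> carrier G \<Longrightarrow> \<one>\<^bsub>G\<^esub> \<otimes>\<^bsub>G\<^esub> x = x"
    "x \<in> carrier G \<Longrightarrow> linv G x \<otimes>\<^bsub>G\<^esub> x = \<one>\<^bsub>G\<^esub>"
    "x \<in> carrier G \<Longrightarrow> x [^]\<^bsub>G\<^esub> p = \<one>\<^bsub>G\<^esub>"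
    "i \<in> {1..n} \<Longrightarrow> x \<in> carrier G \<Longrightarrow> lconst G i \<otimes>\<^bsub>G\<^esub> x = x \<otimes>\<^bsub>G\<^esub> lconst G i"
    "x \<in> carrier G \<Longrightarrow> y \<in> carrier G \<Longrightarrow> \<exists>a. x \<otimes>\<^bsub>G\<^esub> y = cprod G (lconst G) n a \<otimes>\<^bsub>G\<^esub> (y \<otimes>\<^bsub>G\<^esub> x)"
    "cprod G (lconst G) n a = \<one>\<^bsub>G\<^esub> \<Longrightarrow> i \<in> {1..n} \<Longrightarrow> p dvd a i"
  using assms unfolding GG_elem_def by blast+

lemma GG_elem_central_consts:
  assumes "GG_elem p n G" "p > 0"
  shows "central_consts G p n (lconst G)"
proof -
  note E = GG_elemD[OF assms(1)]
  have L: "L_closed n G (carrier G)" using E(1) by (simp add: L_structure_def)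
  interpret group G
  proof (rule groupI)
    fix x assume "x \<in> carrier G"
    then show "\<exists>y\<in>carrier G. y \<otimes>\<^bsub>G\<^esub> x = \<one>\<^bsub>G\<^esub>" using E(4) L_closedD(3)[OF L] by blast
  qed (fact E L_closedD[OF L])+
  show ?thesis
    by unfold_locales (fact assms(2) L_closedD(4)[OF L] E)+
qed

text \<open>The right-hand side consists of conditions that embeddings reflect, which is the point of \<open>GG_embedding\<close>.\<close>

lemma GG_iff:
  assumes "p > 0"
  shows "G \<in> GG p n \<longleftrightarrow> GG_elem p n G"
proof
  assume G: "G \<in> GG p n"
  then have gr: "group G" and L: "L_structure n G" by (auto simp: GG_def)
  interpret group G by (rule gr)
  have cc: "generate G (lconst G ` {1..n}) \<subseteq> center G" using G by (auto simp: GG_def)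
  have ci: "lconst G i \<in> center G" if "i \<in> {1..n}" for i
    using cc that generate.incl[of "lconst G i" "lconst G ` {1..n}" G] by auto
  have ex: "x [^]\<^bsub>G\<^esub> p = \<one>\<^bsub>G\<^esub>" if "x \<in> carrier G" for x using G that by (simp add: GG_def)
  have ci': "lconst G i \<in> carrier G" "x \<in> carrier G \<Longrightarrow> lconst G i \<otimes>\<^bsub>G\<^esub> x = x \<otimes>\<^bsub>G\<^esub> lconst G i" if "i \<in> {1..n}" for i x
    using ci[OF that] unfolding center_def by blast+
  interpret central_consts G p n "lconst G"
    by unfold_locales (fact assms ci' ex)+
  show "GG_elem p n G"
    unfolding GG_elem_def
  proof (intro conjI ballI allI impI)
    fix x y assume xy: "x \<in> carrier G" "y \<in> carrier G"
    then have "x \<otimes>\<^bsub>G\<^esub> y \<otimes>\<^bsub>G\<^esub> inv\<^bsub>G\<^esub> x \<otimes>\<^bsub>G\<^esub> inv\<^bsub>G\<^esub> y \<in> derived G (carrier G)"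
      unfolding derived_def by (intro generate.incl) auto
    then have "x \<otimes>\<^bsub>G\<^esub> y \<otimes>\<^bsub>G\<^esub> inv\<^bsub>G\<^esub> x \<otimes>\<^bsub>G\<^esub> inv\<^bsub>G\<^esub> y \<in> range (cprod G (lconst G) n)"
      using G generate_consts by (auto simp: GG_def)
    then obtain a where "x \<otimes>\<^bsub>G\<^esub> y \<otimes>\<^bsub>G\<^esub> inv\<^bsub>G\<^esub> x \<otimes>\<^bsub>G\<^esub> inv\<^bsub>G\<^esub> y = cprod G (lconst G) n a" by auto
    then have "x \<otimes>\<^bsub>G\<^esub> y = cprod G (lconst G) n a \<otimes>\<^bsub>G\<^esub> (y \<otimes>\<^bsub>G\<^esub> x)"
      using xy by (metis cprod_closed inv_closed inv_solve_right le_refl m_assoc m_closed)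
    then show "\<exists>a. x \<otimes>\<^bsub>G\<^esub> y = cprod G (lconst G) n a \<otimes>\<^bsub>G\<^esub> (y \<otimes>\<^bsub>G\<^esub> x)" by blast
  next
    fix a i assume "cprod G (lconst G) n a = \<one>\<^bsub>G\<^esub>" "i \<in> {1..n}"
    then show "p dvd a i" using G finprod_consts[of a] by (auto simp: GG_def Fp_independent_def)
  next
    fix i x assume "i \<in> {1..n}" "x \<in> carrier G"
    then show "lconst G i \<otimes>\<^bsub>G\<^esub> x = x \<otimes>\<^bsub>G\<^esub> lconst G i" by (rule const_comm)
  qed (use L G pow_p in \<open>auto simp: m_assoc GG_def\<close>)
next
  assume E: "GG_elem p n G"
  then have L: "L_closed n G (carrier G)" by (auto simp: GG_elem_def L_structure_def)
  interpret central_consts G p n "lconst G" by (rule GG_elem_central_consts[OF E assms])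
  have cc: "range (cprod G (lconst G) n) \<subseteq> center G"
    unfolding center_def using cprod_comm cprod_closed by blast
  have com: "x \<otimes>\<^bsub>G\<^esub> y \<otimes>\<^bsub>G\<^esub> inv\<^bsub>G\<^esub> x \<otimes>\<^bsub>G\<^esub> inv\<^bsub>G\<^esub> y \<in> range (cprod G (lconst G) n)"
    if xy: "x \<in> carrier G" "y \<in> carrier G" for x y
  proof -
    obtain a where "x \<otimes>\<^bsub>G\<^esub> y = cprod G (lconst G) n a \<otimes>\<^bsub>G\<^esub> (y \<otimes>\<^bsub>G\<^esub> x)"
      using GG_elemD(7)[OF E] xy by blast
    then have "x \<otimes>\<^bsub>G\<^esub> y \<otimes>\<^bsub>G\<^esub> inv\<^bsub>G\<^esub> x \<otimes>\<^bsub>G\<^esub> inv\<^bsub>G\<^esub> y = cprod G (lconst G) n a"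
      using xy by (simp add: inv_solve_right' m_assoc)
    then show ?thesis by auto
  qed
  have der: "derived G (carrier G) \<subseteq> range (cprod G (lconst G) n)"
    unfolding derived_def by (rule generate_subgroup_incl[OF _ cprod_subgroup]) (use com in auto)
  have nil: "nilpotency_class_le G 2"
  proof -
    \<comment> \<open>The first term of the lower central series is the derived subgroup, hence
      central, so the commutators generating the next term are trivial.\<close>
    have lc1: "lower_central G 1 \<subseteq> center G"
      using der cc by (simp add: derived_def)
    have one: "\<one>\<^bsub>G\<^esub> \<in> lower_central G 1" by (simp add: generate.one)
    have "x \<otimes>\<^bsub>G\<^esub> y \<otimes>\<^bsub>G\<^esub> inv\<^bsub>G\<^esub> x \<otimes>\<^bsub>G\<^esub> inv\<^bsub>G\<^esub> y = \<one>\<^bsub>G\<^esub>" if "x \<in> center G" "y \<in> carrier G" for x y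
      proof -
      have "x \<otimes>\<^bsub>G\<^esub> y = y \<otimes>\<^bsub>G\<^esub> x" "x \<in> carrier G" using that unfolding center_def by blast+
      then show ?thesis using that(2) by (simp add: m_assoc)
    qed
    then have "(\<Union>x\<in>lower_central G 1. \<Union>y\<in>carrier G. {x \<otimes>\<^bsub>G\<^esub> y \<otimes>\<^bsub>G\<^esub> inv\<^bsub>G\<^esub> x \<otimes>\<^bsub>G\<^esub> inv\<^bsub>G\<^esub> y}) \<subseteq> {\<one>\<^bsub>G\<^esub>}"
      using lc1 by blast
    then have "lower_central G (Suc 1) \<subseteq> generate G {\<one>\<^bsub>G\<^esub>}"
      unfolding lower_central.simps by (rule mono_generate)
    then have "lower_central G (Suc 1) = {\<one>\<^bsub>G\<^esub>}"
      using generate.one[of G] by (auto simp: generate_one)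
    then show ?thesis by (simp add: nilpotency_class_le_def numeral_2_eq_2)
  qed
  show "G \<in> GG p n"
    unfolding GG_def mem_Collect_eq generate_consts Fp_independent_def finprod_consts
  proof (intro conjI ballI)
    fix x assume "x \<in> carrier G"
    then show "linv G x = inv\<^bsub>G\<^esub> x"
      using GG_elemD(4)[OF E] L_closedD[OF L] by (intro inv_equality[symmetric]) auto
  next
    show "\<forall>a. cprod G (lconst G) n a = \<one>\<^bsub>G\<lparr>carrier := center G\<rparr>\<^esub> \<longrightarrow> (\<forall>i\<in>{1..n}. p dvd a i)"
      using GG_elemD(8)[OF E] by simp
  qed (fact GG_elemD(1)[OF E] nil pow_p der cc is_group)+
qed

section \<open>Structures that embed into a member of the class\<close>

lemma embedding_pow:
  assumes "L_structure n B" "L_embedding n f B A" "x \<in> carrier B"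
  shows "x [^]\<^bsub>B\<^esub> (m::nat) \<in> carrier B \<and> f (x [^]\<^bsub>B\<^esub> m) = f x [^]\<^bsub>A\<^esub> m"
  by (induction m)
    (use L_closedD[OF assms(1)[unfolded L_structure_def]] L_embeddingD[OF assms(2)] assms(3) in auto)

lemma embedding_cprod:
  assumes "L_structure n B" "L_embedding n f B A" "k \<le> n"
  shows "cprod B (lconst B) k a \<in> carrier B \<and> f (cprod B (lconst B) k a) = cprod A (lconst A) k a"
  using assms(3)
proof (induction k)
  case (Suc k)
  then show ?case
    using L_closedD[OF assms(1)[unfolded L_structure_def]] L_embeddingD[OF assms(2)] embedding_pow[OF assms(1,2)]
    by auto
qed (use L_closedD[OF assms(1)[unfolded L_structure_def]] L_embeddingD[OF assms(2)] in auto)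

text \<open>Universal equations are pulled back along the injective \<open>f\<close>, and the
  exponents of a commutator found in \<open>A\<close> also serve in \<open>B\<close>, because
  \<open>B\<close> contains the constants. This one fact gives heredity, survives copying to another
  type, and later places an arbitrary Fraisse limit in \<open>GG\<close>.\<close>

lemma GG_embedding:
  assumes p: "p > 0" and B: "L_structure n B" and f: "L_embedding n f B A" and A: "A \<in> GG p n"
  shows "B \<in> GG p n"
proof -
  note cl = L_closedD[OF B[unfolded L_structure_def]]
  note fD = L_embeddingD[OF f]
  note pw = embedding_pow[OF B f] and cp = embedding_cprod[OF B f order_refl]
  note E = GG_elemD[OF A[unfolded GG_iff[OF p]]]
  have inj: "f x = f y \<longleftrightarrow> x = y" if "x \<in> carrier B" "y \<in> carrier B" for x y
    using fD(2) that by (auto simp: inj_on_def)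
  have "GG_elem p n B"
    unfolding GG_elem_def
  proof (intro conjI ballI allI impI)
    fix x y z assume "x \<in> carrier B" "y \<in> carrier B" "z \<in> carrier B"
    then show "x \<otimes>\<^bsub>B\<^esub> y \<otimes>\<^bsub>B\<^esub> z = x \<otimes>\<^bsub>B\<^esub> (y \<otimes>\<^bsub>B\<^esub> z)"
      using E(2) fD(1) by (subst inj[symmetric]) (auto simp: cl fD(4))
  next
    fix x assume "x \<in> carrier B"
    then show "\<one>\<^bsub>B\<^esub> \<otimes>\<^bsub>B\<^esub> x = x" "linv B x \<otimes>\<^bsub>B\<^esub> x = \<one>\<^bsub>B\<^esub>" "x [^]\<^bsub>B\<^esub> p = \<one>\<^bsub>B\<^esub>"
      using E(3-5) fD(1) pw by (subst inj[symmetric]; auto simp: cl fD(3-5))+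
  next
    fix i x assume i: "i \<in> {1..n}" and x: "x \<in> carrier B"
    have "lconst A i \<otimes>\<^bsub>A\<^esub> f x = f x \<otimes>\<^bsub>A\<^esub> lconst A i" using E(6)[OF i fD(1)[OF x]] .
    then show "lconst B i \<otimes>\<^bsub>B\<^esub> x = x \<otimes>\<^bsub>B\<^esub> lconst B i"
      using i x fD(4)[OF x] fD(4)[OF _ x] fD(6)[OF i] cl by (metis inj)
  next
    fix x y assume xy: "x \<in> carrier B" "y \<in> carrier B"
    then obtain a where "f x \<otimes>\<^bsub>A\<^esub> f y = cprod A (lconst A) n a \<otimes>\<^bsub>A\<^esub> (f y \<otimes>\<^bsub>A\<^esub> f x)"
      using E(7) fD(1) by blast
    then have "x \<otimes>\<^bsub>B\<^esub> y = cprod B (lconst B) n a \<otimes>\<^bsub>B\<^esub> (y \<otimes>\<^bsub>B\<^esub> x)"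
      using xy fD(4) cp cl(2) by (metis inj)
    then show "\<exists>a. x \<otimes>\<^bsub>B\<^esub> y = cprod B (lconst B) n a \<otimes>\<^bsub>B\<^esub> (y \<otimes>\<^bsub>B\<^esub> x)" by blast
  next
    fix a i assume "cprod B (lconst B) n a = \<one>\<^bsub>B\<^esub>" "i \<in> {1..n}"
    then show "p dvd a i" using E(8) cp[of a] fD(3) by metis
  qed (rule B)
  then show ?thesis using GG_iff[OF p] by blast
qed

section \<open>Subgroups of a single member and their extensions by one element\<close>

locale gg =
  fixes p n :: nat and G :: "'a L_struct" (structure)
  assumes p: "prime p" and GG: "G \<in> GG p n"
begin

lemma elem: "GG_elem p n G" using GG GG_iff p prime_gt_0_nat by blast

lemma struct: "L_structure n G" using GG_elemD(1)[OF elem] .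

lemmas closed_carrier = struct[unfolded L_structure_def]

sublocale group G
  using GG by (simp add: GG_def)

sublocale central_consts G p n "lconst G"
  using GG_elem_central_consts[OF elem] p prime_gt_0_nat by blast

lemma linv_eq: "x \<in> carrier G \<Longrightarrow> linv G x = inv x"
  using GG by (simp add: GG_def)

lemma commutator_cprod:
  assumes "x \<in> carrier G" "y \<in> carrier G"
  obtains a where "x \<otimes> y = cprod G (lconst G) n a \<otimes> (y \<otimes> x)"
  using GG_elemD(7)[OF elem assms] by blast

lemma cprod_eq_iff:
  "cprod G (lconst G) n a = cprod G (lconst G) n b \<longleftrightarrow> (\<forall>i\<in>{1..n}. a i mod p = b i mod p)"
proof
  assume eq: "cprod G (lconst G) n a = cprod G (lconst G) n b"
  \<comment> \<open>Exponents are natural, so \<open>b i * (p - 1)\<close> plays the part of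
    \<open>- b i\<close>; independence is applied to the quotient of the two products.\<close>
  have "cprod G (lconst G) n (\<lambda>i. a i + b i * (p - 1)) = cprod G (lconst G) n a \<otimes> cprod G (lconst G) n b [^] (p - 1)"
    by (simp add: cprod_pow cprod_mult)
  also have "\<dots> = cprod G (lconst G) n b [^] Suc (p - 1)"
    using nat_pow_Suc2[OF cprod_closed[OF order_refl]] by (simp add: eq)
  also have "\<dots> = \<one>" using p_pos pow_p by simp
  finally have d: "p dvd a i + b i * (p - 1)" if "i \<in> {1..n}" for i
    using GG_elemD(8)[OF elem] that by blast
  have "a i mod p = b i mod p" if i: "i \<in> {1..n}" for i
  proof -
    have "(a i + b i * (p - 1)) mod p = 0" using d[OF i] by simp
    then have "b i mod p = (a i + b i * (p - 1) + b i) mod p"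
      by (metis add_0 mod_add_left_eq)
    also have "a i + b i * (p - 1) + b i = a i + b i * p"
      using p_pos by (cases p) auto
    finally show ?thesis by simp
  qed
  then show "\<forall>i\<in>{1..n}. a i mod p = b i mod p" by blast
next
  assume "\<forall>i\<in>{1..n}. a i mod p = b i mod p"
  then have "cprod G (lconst G) n (\<lambda>i. a i mod p) = cprod G (lconst G) n (\<lambda>i. b i mod p)"
    by (intro cprod_cong) auto
  then show "cprod G (lconst G) n a = cprod G (lconst G) n b" by (simp add: cprod_mod)
qed

lemma closed_pow: "L_closed n G H \<Longrightarrow> h \<in> H \<Longrightarrow> h [^] (i::nat) \<in> H"
  by (induction i) (auto simp: L_closedD)

lemma closed_cprod: "L_closed n G H \<Longrightarrow> k \<le> n \<Longrightarrow> cprod G (lconst G) k a \<in> H"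
  by (induction k) (auto simp: L_closedD closed_pow)

lemma closed_inv: "L_closed n G H \<Longrightarrow> H \<subseteq> carrier G \<Longrightarrow> h \<in> H \<Longrightarrow> inv h \<in> H"
  using L_closedD(3) linv_eq by (metis subsetD)

text \<open>Conjugation changes \<open>h\<close> by a commutator, which is a product of constants
  and so lies in \<open>H\<close>: every substructure is normal.\<close>

lemma closed_conj:
  assumes H: "L_closed n G H" "H \<subseteq> carrier G" and h: "h \<in> H" and x: "x \<in> carrier G"
  shows "x \<otimes> h \<otimes> inv x \<in> H"
proof -
  obtain a where "x \<otimes> h = cprod G (lconst G) n a \<otimes> (h \<otimes> x)"
    using commutator_cprod[OF x] H h by (metis subsetD)
  then have "x \<otimes> h \<otimes> inv x = cprod G (lconst G) n a \<otimes> h"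
    using H h x by (simp add: m_assoc subset_iff)
  then show ?thesis using L_closedD(2)[OF H(1) closed_cprod[OF H(1) order_refl] h] by simp
qed

lemma closed_pow_move:
  assumes H: "L_closed n G H" "H \<subseteq> carrier G" and h: "h \<in> H" and x: "x \<in> carrier G"
  obtains h' where "h' \<in> H" "x [^] (i::nat) \<otimes> h = h' \<otimes> x [^] i"
proof -
  have hc: "h \<in> carrier G" using H h by auto
  have "x [^] i \<otimes> h = (x [^] i \<otimes> h \<otimes> inv (x [^] i)) \<otimes> x [^] i"
    using x hc by (simp add: m_assoc)
  moreover have "x [^] i \<otimes> h \<otimes> inv (x [^] i) \<in> H"
    using closed_conj[OF H h] x by simp
  ultimately show ?thesis using that by blast
qed

text \<open>This is \<langle>H, x\<rangle> for closed \<open>H\<close>: as \<open>H\<close> is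
  normal, powers of \<open>x\<close> can be moved to the right. The exponent is unbounded so that
  products need no reduction; \<open>ext_mod\<close> cuts it down to \<open>i < p\<close>.\<close>

definition ext :: "'a set \<Rightarrow> 'a \<Rightarrow> 'a set" where
  "ext H x = {h \<otimes> x [^] i |h i::nat. h \<in> H}"

lemma ext_closed:
  assumes H: "L_closed n G H" "H \<subseteq> carrier G" and x: "x \<in> carrier G"
  shows "L_closed n G (ext H x)" "ext H x \<subseteq> carrier G" "H \<subseteq> ext H x" "x \<in> ext H x"
proof -
  show sub: "H \<subseteq> ext H x"
  proof
    fix h assume "h \<in> H"
    then show "h \<in> ext H x" unfolding ext_def using H(2) by (intro CollectI exI[of _ h] exI[of _ 0]) auto
  qed
  show c: "ext H x \<subseteq> carrier G" using H x by (auto simp: ext_def)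
  show "x \<in> ext H x" unfolding ext_def
    using L_closedD(1)[OF H(1)] x by (intro CollectI exI[of _ \<one>] exI[of _ 1]) auto
  have m: "u \<otimes> v \<in> ext H x" if "u \<in> ext H x" "v \<in> ext H x" for u v
  proof -
    obtain g i h j where gh: "g \<in> H" "h \<in> H" and u: "u = g \<otimes> x [^] (i::nat)" "v = h \<otimes> x [^] (j::nat)"
      using \<open>u \<in> ext H x\<close> \<open>v \<in> ext H x\<close> by (auto simp: ext_def)
    obtain h' where h': "h' \<in> H" "x [^] i \<otimes> h = h' \<otimes> x [^] i" using closed_pow_move[OF H gh(2) x] .
    have c: "g \<in> carrier G" "h \<in> carrier G" "h' \<in> carrier G" using gh h' H by auto
    have "u \<otimes> v = g \<otimes> (x [^] i \<otimes> h) \<otimes> x [^] j" using c x u by (simp add: m_assoc)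
    also have "\<dots> = (g \<otimes> h') \<otimes> x [^] (i + j)" using c x h' by (simp add: m_assoc nat_pow_mult)
    finally show ?thesis using L_closedD(2)[OF H(1) gh(1) h'(1)] unfolding ext_def by blast
  qed
  have pw: "u [^] (i::nat) \<in> ext H x" if "u \<in> ext H x" for u i
    by (induction i) (use m that sub L_closedD(1)[OF H(1)] in auto)
  have "linv G u \<in> ext H x" if "u \<in> ext H x" for u
    using linv_eq[of u] inv_pow[of u] pw[OF that] that c by auto
  then show "L_closed n G (ext H x)"
    unfolding L_closed_def using m L_closedD(1,4)[OF H(1)] sub by auto
qed

lemma ext_mod: "H \<subseteq> carrier G \<Longrightarrow> x \<in> carrier G \<Longrightarrow> ext H x = (\<lambda>(h, i). h \<otimes> x [^] i) ` (H \<times> {..<p})"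
proof safe
  fix u assume "u \<in> ext H x" "x \<in> carrier G"
  then obtain h i where "h \<in> H" "u = h \<otimes> x [^] (i mod p)" by (auto simp: ext_def pow_mod)
  then show "u \<in> (\<lambda>(h, i). h \<otimes> x [^] i) ` (H \<times> {..<p})"
    using p_pos by (intro image_eqI[where x = "(h, i mod p)"]) auto
qed (auto simp: ext_def)

end

section \<open>Normal forms of terms and finiteness of generated substructures\<close>

primrec tpow :: "L_term \<Rightarrow> nat \<Rightarrow> L_term" where
  "tpow t 0 = TOne" | "tpow t (Suc i) = TMult (tpow t i) t"

lemma term_val_tpow [simp]: "term_val G e (tpow t i) = term_val G e t [^]\<^bsub>G\<^esub> i"
  by (induction i) auto

lemma tpow_tm: "t \<in> tm n F \<Longrightarrow> tpow t i \<in> tm n F"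
  by (induction i) auto

primrec const_terms :: "nat \<Rightarrow> nat \<Rightarrow> L_term set" where
  "const_terms p 0 = {TOne}"
| "const_terms p (Suc k) = (\<lambda>(t, i). TMult t (tpow (TConst (Suc k)) i)) ` (const_terms p k \<times> {..<p})"

text \<open>The extension \<open>ext\<close> iterated over a list of variables, at the level of
  terms and with exponents below \<open>p\<close>. The values exhaust the generated substructure in
  every member of the class, while the set itself depends only on \<open>p\<close>, \<open>n\<close>
  and the list; this uniformity leaves only finitely many atomic formulas to consider.\<close>

primrec normal_terms :: "nat \<Rightarrow> nat \<Rightarrow> nat list \<Rightarrow> L_term set" where
  "normal_terms p n [] = const_terms p n"
| "normal_terms p n (x # xs) = (\<lambda>(t, i). TMult t (tpow (TVar x) i)) ` (normal_terms p n xs \<times> {..<p})"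

lemma finite_normal_terms: "finite (normal_terms p n xs)"
proof -
  have "finite (const_terms p k)" for k by (induction k) auto
  then show ?thesis by (induction xs) auto
qed

lemma normal_terms_tm: "normal_terms p n xs \<subseteq> tm n (set xs)"
proof -
  have "const_terms p k \<subseteq> tm n {}" if "k \<le> n" for k
    using that by (induction k) (auto intro!: tpow_tm)
  then have c: "const_terms p n \<subseteq> tm n {}" by simp
  show ?thesis
  proof (induction xs)
    case (Cons x xs)
    have "tm n (set xs) \<subseteq> tm n (set (x # xs))" using tm_mono by (metis set_subset_Cons subsetI)
    with Cons show ?case by (force intro!: tpow_tm)
  qed (use c in auto)
qed

context gg begin

lemma const_terms_val: "k \<le> n \<Longrightarrow> term_val G e ` const_terms p k = range (cprod G (lconst G) k)"
proof (induction k)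
  case (Suc k)
  have "term_val G e ` const_terms p (Suc k) =
      (\<lambda>(x, i). x \<otimes> lconst G (Suc k) [^] i) ` (term_val G e ` const_terms p k \<times> {..<p})"
    by (force simp: image_iff)
  also have "\<dots> = (\<lambda>(x, i). x \<otimes> lconst G (Suc k) [^] i) ` (range (cprod G (lconst G) k) \<times> {..<p})"
    using Suc by simp
  also have "\<dots> = range (cprod G (lconst G) (Suc k))"
  proof safe
    fix a i
    have "cprod G (lconst G) k a \<otimes> lconst G (Suc k) [^] i = cprod G (lconst G) (Suc k) (a(Suc k := i))"
      using cprod_cong[of k a "a(Suc k := i)"] by simp
    then show "cprod G (lconst G) k a \<otimes> lconst G (Suc k) [^] i \<in> range (cprod G (lconst G) (Suc k))" by blast
  next
    fix a
    show "cprod G (lconst G) (Suc k) a \<in> (\<lambda>(x, i). x \<otimes> lconst G (Suc k) [^] i) ` (range (cprod G (lconst G) k) \<times> {..<p})"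
      using p_pos Suc.prems by (intro image_eqI[where x = "(cprod G (lconst G) k a, a (Suc k) mod p)"])
        (auto simp: pow_mod const_closed)
  qed
  finally show ?case .
qed auto

lemma range_cprod_closed: "L_closed n G (range (cprod G (lconst G) n))"
  unfolding L_closed_def
  using subgroup.m_closed[OF cprod_subgroup] subgroup.one_closed[OF cprod_subgroup]
    subgroup.m_inv_closed[OF cprod_subgroup] linv_eq const_in_cprod by auto

lemma normal_terms_closed:
  assumes "e ` set xs \<subseteq> carrier G"
  shows "L_closed n G (term_val G e ` normal_terms p n xs) \<and> term_val G e ` normal_terms p n xs \<subseteq> carrier G \<and>
    e ` set xs \<subseteq> term_val G e ` normal_terms p n xs"
  using assms
proof (induction xs)
  case Nil
  then show ?case using const_terms_val[OF order_refl] range_cprod_closed by auto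
next
  case (Cons x xs)
  let ?H = "term_val G e ` normal_terms p n xs"
  have H: "L_closed n G ?H" "?H \<subseteq> carrier G" "e ` set xs \<subseteq> ?H" using Cons by auto
  have x: "e x \<in> carrier G" using Cons by simp
  have "term_val G e ` normal_terms p n (x # xs) = (\<lambda>(h, i). h \<otimes> e x [^] i) ` (?H \<times> {..<p})"
    by (force simp: image_iff)
  also have "\<dots> = ext ?H (e x)" using ext_mod[OF H(2) x] by simp
  finally show ?case using ext_closed[OF H(1,2) x] H(3) by auto
qed

lemma generated_finite:
  assumes "finite S" "S \<subseteq> carrier G"
  shows "finite (L_generated n G S)"
proof -
  from assms(1) obtain xs where xs: "set xs = S" by (metis finite_list)
  let ?e = "\<lambda>i. if i < length xs then xs ! i else \<one>"
  have im: "?e ` set [0..<length xs] = S" using xs by (force simp: in_set_conv_nth)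
  have "L_generated n G S \<subseteq> term_val G ?e ` normal_terms p n [0..<length xs]"
    by (rule L_generated_subset) (use normal_terms_closed[of ?e "[0..<length xs]"] assms im in simp_all)
  then show ?thesis using finite_normal_terms finite_surj by blast
qed

end

subsection \<open>An explicit generic group\<close>

definition supp :: "(nat \<Rightarrow> int) \<Rightarrow> nat set" where
  "supp u = {i. u i \<noteq> 0}"

text \<open>Every finite table of coefficients is coded by arbitrarily large \<open>m\<close>: the second component of the decoded pair is a dummy.\<close>

definition table :: "nat \<Rightarrow> nat \<Rightarrow> nat \<Rightarrow> nat \<Rightarrow> int" where
  "table n m j l = (if m \<notin> {1..n} \<and> j \<notin> {1..n} \<and> l \<in> {1..n}
     then (from_nat (fst (prod_decode m)) :: int list list) ! j ! l else 0)"

lemma table_exists: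
  obtains m where "m \<ge> k" "m > n"
    "\<And>j l. j < k \<Longrightarrow> j \<notin> {1..n} \<Longrightarrow> l \<in> {1..n} \<Longrightarrow> table n m j l = \<alpha> j l"
proof
  \<comment> \<open>The columns in use are 1 to \<open>n\<close>, so a row needs
    \<open>Suc n\<close> entries; entry 0 is padding.\<close>
  define L where "L = map (\<lambda>j. map (\<alpha> j) [0..<Suc n]) [0..<k]"
  define m where "m = prod_encode (to_nat L, k + n + 1)"
  have "k + n + 1 \<le> m" unfolding m_def by (rule le_prod_encode_2)
  then show "m \<ge> k" "m > n" by auto
  fix j l assume "j < k" "j \<notin> {1..n}" "l \<in> {1..n}"
  then have "L ! j ! l = \<alpha> j l" by (simp add: L_def del: upt_Suc)
  then show "table n m j l = \<alpha> j l"
    using \<open>m > n\<close> \<open>j \<notin> {1..n}\<close> \<open>l \<in> {1..n}\<close> by (simp add: table_def m_def)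
qed

text \<open>The form takes integer values and reduction modulo \<open>p\<close> is left to
  \<open>gmult\<close>, so that additivity in each argument is an exact identity. Summing over
  \<open>supp u\<close> keeps the sum finite without a bound on the indices fixed in
  advance.\<close>

definition bform :: "nat \<Rightarrow> (nat \<Rightarrow> int) \<Rightarrow> (nat \<Rightarrow> int) \<Rightarrow> nat \<Rightarrow> int" where
  "bform n u v l = (\<Sum>i\<in>supp u. \<Sum>j<i. u i * v j * table n i j l)"

definition gmult :: "nat \<Rightarrow> nat \<Rightarrow> (nat \<Rightarrow> int) \<Rightarrow> (nat \<Rightarrow> int) \<Rightarrow> nat \<Rightarrow> int" where
  "gmult p n u v l = (u l + v l + bform n u v l) mod int p"

text \<open>The coordinates \<open>1, \<dots>, n\<close> of \<open>u\<close> span the constants, and the other coordinates form \<open>V\<close>. The form pairs \<open>e\<^sub>i\<close> with \<open>e\<^sub>j\<close>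
  only for \<open>j < i\<close>, so it is not alternating and no division by \<open>2\<close> is needed.\<close>

definition generic :: "nat \<Rightarrow> nat \<Rightarrow> (nat \<Rightarrow> int) L_struct" where
  "generic p n = \<lparr>carrier = {u. finite (supp u) \<and> (\<forall>i. u i \<in> {0..<int p})},
     monoid.mult = gmult p n, one = (\<lambda>_. 0),
     linv = (\<lambda>u l. (bform n u u l - u l) mod int p),
     lconst = (\<lambda>i l. if l = i then 1 else 0)\<rparr>"

lemma bform_superset: "finite S \<Longrightarrow> supp u \<subseteq> S \<Longrightarrow> bform n u v l = (\<Sum>i\<in>S. \<Sum>j<i. u i * v j * table n i j l)"
  unfolding bform_def by (rule sum.mono_neutral_left) (auto simp: supp_def)

lemma bform_outside: "l \<notin> {1..n} \<Longrightarrow> bform n u v l = 0"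
  by (auto simp: bform_def table_def intro!: sum.neutral)

lemma bform_add_right: "bform n u (\<lambda>i. v i + w i) l = bform n u v l + bform n u w l"
  by (simp add: bform_def algebra_simps sum.distrib)

lemma bform_add_left:
  assumes "finite (supp u)" "finite (supp v)"
  shows "bform n (\<lambda>i. u i + v i) w l = bform n u w l + bform n v w l"
proof -
  let ?S = "supp u \<union> supp v"
  have "finite ?S" "supp (\<lambda>i. u i + v i) \<subseteq> ?S" "supp u \<subseteq> ?S" "supp v \<subseteq> ?S" using assms by (auto simp: supp_def)
  then show ?thesis by (simp add: bform_superset[of ?S] algebra_simps sum.distrib)
qed

lemma bform_scale_left: "bform n (\<lambda>i. k * u i) v l = k * bform n u v l"
proof (cases "k = 0")
  case False
  then have "supp (\<lambda>i. k * u i) = supp u" by (simp add: supp_def)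
  then show ?thesis by (simp add: bform_def sum_distrib_left mult.assoc)
qed (simp add: bform_def supp_def)

text \<open>The table vanishes as soon as an index lies in \<open>{1..n}\<close>, so the form does
  not see the coordinates of the constants. These are the only coordinates where
  \<open>gmult\<close> differs from addition modulo \<open>p\<close>; hence the form is also
  additive with respect to \<open>gmult\<close>.\<close>

lemma bform_cong:
  assumes "finite (supp u)" "finite (supp u')"
    and "\<And>i. i \<notin> {1..n} \<Longrightarrow> [u i = u' i] (mod m)" "\<And>i. i \<notin> {1..n} \<Longrightarrow> [v i = v' i] (mod m)"
  shows "[bform n u v l = bform n u' v' l] (mod m)"
proof -
  let ?S = "supp u \<union> supp u'"
  have S: "finite ?S" "supp u \<subseteq> ?S" "supp u' \<subseteq> ?S" using assms by auto
  have "[u i * v j * table n i j l = u' i * v' j * table n i j l] (mod m)" for i j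
    by (cases "i \<in> {1..n} \<or> j \<in> {1..n}")
      (auto simp: table_def intro!: cong_mult assms(3,4))
  then show ?thesis unfolding bform_superset[OF S(1,2)] bform_superset[OF S(1,3)]
    by (intro cong_sum)
qed

lemma supp_mod: "supp (\<lambda>l. u l mod m) \<subseteq> supp u"
  by (auto simp: supp_def)

lemma finite_supp_add: "finite (supp u) \<Longrightarrow> finite (supp v) \<Longrightarrow> finite (supp (\<lambda>l. u l + v l))"
  by (rule finite_subset[of _ "supp u \<union> supp v"]) (auto simp: supp_def)

lemma finite_supp_bform: "finite (supp (bform n u v))"
  by (rule finite_subset[of _ "{1..n}"]) (unfold supp_def, use bform_outside in blast, simp)

lemma finite_supp_diff: "finite (supp u) \<Longrightarrow> finite (supp v) \<Longrightarrow> finite (supp (\<lambda>l. u l - v l))"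
  by (rule finite_subset[of _ "supp u \<union> supp v"]) (auto simp: supp_def)

lemma generic_simps [simp]:
  "x \<otimes>\<^bsub>generic p n\<^esub> y = gmult p n x y" "\<one>\<^bsub>generic p n\<^esub> = (\<lambda>_. 0)"
  "linv (generic p n) x = (\<lambda>l. (bform n x x l - x l) mod int p)"
  "lconst (generic p n) i = (\<lambda>l. if l = i then 1 else 0)"
  by (simp_all add: generic_def)

lemma generic_carrier: "u \<in> carrier (generic p n) \<longleftrightarrow> finite (supp u) \<and> (\<forall>i. u i \<in> {0..<int p})"
  by (simp add: generic_def)

lemma generic_carrier_mod: "u \<in> carrier (generic p n) \<Longrightarrow> u i mod int p = u i"
  by (simp add: generic_carrier)

lemma gmult_cong: "[gmult p n u v l = u l + v l + bform n u v l] (mod int p)"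
  by (simp add: gmult_def cong_def)

lemma gmult_outside: "i \<notin> {1..n} \<Longrightarrow> [gmult p n u v i = u i + v i] (mod int p)"
  using gmult_cong[of p n u v i] by (simp add: bform_outside)

section \<open>The group axioms for the generic structure\<close>

context
  fixes p n :: nat
  assumes p: "prime p" and p2: "p > 2"
begin

lemma gmult_closed: "u \<in> carrier (generic p n) \<Longrightarrow> v \<in> carrier (generic p n) \<Longrightarrow> gmult p n u v \<in> carrier (generic p n)"
  unfolding generic_carrier gmult_def using p2
  by (auto intro!: finite_subset[OF supp_mod] finite_supp_add finite_supp_bform)

lemma generic_eqI:
  assumes "u \<in> carrier (generic p n)" "v \<in> carrier (generic p n)" "\<And>l. [u l = v l] (mod int p)"
  shows "u = v"
  using assms generic_carrier_mod by (auto simp: cong_def fun_eq_iff)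

lemma fin_supp: "u \<in> carrier (generic p n) \<Longrightarrow> finite (supp u)"
  by (simp add: generic_carrier)

lemma bform_gmult_left:
  assumes "u \<in> carrier (generic p n)" "v \<in> carrier (generic p n)"
  shows "[bform n (gmult p n u v) w l = bform n u w l + bform n v w l] (mod int p)"
  unfolding bform_add_left[OF assms[THEN fin_supp], symmetric]
  by (rule bform_cong) (use assms gmult_closed[THEN fin_supp] gmult_outside finite_supp_add fin_supp in auto)

lemma bform_gmult_right:
  assumes "w \<in> carrier (generic p n)"
  shows "[bform n w (gmult p n u v) l = bform n w u l + bform n w v l] (mod int p)"
  unfolding bform_add_right[symmetric]
  by (rule bform_cong) (use assms gmult_outside fin_supp in auto)

text \<open>Writing \<open>B\<close> for the form, both sides expand to
  \<open>u + v + w + B(u,v) + B(u,w) + B(v,w)\<close>: a bilinear map is a cocycle.\<close>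

lemma gmult_assoc:
  assumes "u \<in> carrier (generic p n)" "v \<in> carrier (generic p n)" "w \<in> carrier (generic p n)"
  shows "gmult p n (gmult p n u v) w = gmult p n u (gmult p n v w)"
proof (rule generic_eqI)
  fix l
  have "[gmult p n (gmult p n u v) w l = (u l + v l + bform n u v l) + w l + (bform n u w l + bform n v w l)] (mod int p)"
    by (rule cong_trans[OF gmult_cong]) (intro cong_add gmult_cong bform_gmult_left assms cong_refl)
  moreover have "[gmult p n u (gmult p n v w) l = u l + (v l + w l + bform n v w l) + (bform n u v l + bform n u w l)] (mod int p)"
    by (rule cong_trans[OF gmult_cong]) (intro cong_add gmult_cong bform_gmult_right assms cong_refl)
  ultimately show "[gmult p n (gmult p n u v) w l = gmult p n u (gmult p n v w) l] (mod int p)"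
    by (simp add: cong_def algebra_simps)
qed (use assms gmult_closed in auto)

lemma unit_carrier: "(\<lambda>l. if l = i then 1 else 0) \<in> carrier (generic p n)"
proof -
  have "supp (\<lambda>l. if l = i then 1 else 0) \<subseteq> {i}" by (auto simp: supp_def)
  then show ?thesis using p2 finite_subset by (auto simp: generic_carrier)
qed

lemma linv_carrier:
  "u \<in> carrier (generic p n) \<Longrightarrow> (\<lambda>l. (bform n u u l - u l) mod int p) \<in> carrier (generic p n)"
  unfolding generic_carrier using p2
  by (auto intro!: finite_subset[OF supp_mod] finite_supp_diff finite_supp_bform)

lemma generic_structure: "L_structure n (generic p n)"
  unfolding L_structure_def L_closed_def
  using gmult_closed unit_carrier linv_carrier p2 by (auto simp: generic_carrier supp_def)

lemma bform_zero_left [simp]: "bform n (\<lambda>_. 0) v l = 0"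
  by (simp add: bform_def)

text \<open>The inverse of \<open>u\<close> is not \<open>- u\<close>, since the form contributes
  \<open>B(- u, u) = - B(u, u)\<close>; the added term \<open>bform n u u\<close> cancels
  this.\<close>

lemma generic_linv:
  assumes "u \<in> carrier (generic p n)"
  shows "gmult p n (\<lambda>l. (bform n u u l - u l) mod int p) u = (\<lambda>_. 0)" (is "gmult p n ?v u = _")
proof (rule generic_eqI)
  fix l
  have neg: "bform n (\<lambda>i. - u i) u l = - bform n u u l" using bform_scale_left[of n "-1" u u l] by simp
  have s: "supp (\<lambda>i. - u i) = supp u" by (simp add: supp_def)
  have "[bform n ?v u l = bform n (\<lambda>i. - u i) u l] (mod int p)"
    by (rule bform_cong) (use assms fin_supp linv_carrier s in \<open>auto simp: bform_outside cong_def\<close>)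
  then have "[gmult p n ?v u l = (bform n u u l - u l) + u l + - bform n u u l] (mod int p)"
    unfolding neg by (intro cong_trans[OF gmult_cong] cong_add cong_refl) (auto simp: cong_def)
  then show "[gmult p n ?v u l = 0] (mod int p)" by simp
qed (use assms gmult_closed linv_carrier p2 in \<open>auto simp: generic_carrier supp_def\<close>)

text \<open>Passing from the \<open>i\<close>-th to the next power adds \<open>i\<close> times the
  value of the form at \<open>(u, u)\<close>, and the numbers below \<open>k\<close> add up to
  \<open>k choose 2\<close>. At \<open>k = p\<close> this coefficient is divisible by
  \<open>p\<close>, as \<open>p\<close> is odd.\<close>

lemma generic_pow:
  assumes u: "u \<in> carrier (generic p n)"
  shows "u [^]\<^bsub>generic p n\<^esub> (k::nat) \<in> carrier (generic p n) \<and>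
    (\<forall>l. [(u [^]\<^bsub>generic p n\<^esub> k) l = int k * u l + int (k choose 2) * bform n u u l] (mod int p))"
proof (induction k)
  case 0
  then show ?case using generic_structure by (simp add: L_structure_def L_closed_def numeral_2_eq_2)
next
  case (Suc k)
  let ?w = "u [^]\<^bsub>generic p n\<^esub> k"
  have w: "?w \<in> carrier (generic p n)" "\<And>l. [?w l = int k * u l + int (k choose 2) * bform n u u l] (mod int p)"
    using Suc by auto
  have fk: "finite (supp (\<lambda>i. int k * u i))"
    using fin_supp[OF u] by (rule finite_subset[rotated]) (auto simp: supp_def)
  have c2: "int (Suc k choose 2) = int k + int (k choose 2)" by (simp add: numeral_2_eq_2)
  have "[gmult p n ?w u l = int (Suc k) * u l + int (Suc k choose 2) * bform n u u l] (mod int p)" for l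
  proof -
    have "[bform n ?w u l = bform n (\<lambda>i. int k * u i) u l] (mod int p)"
    proof (rule bform_cong)
      fix i assume "i \<notin> {1..n}"
      then show "[?w i = int k * u i] (mod int p)" using w(2)[of i] by (simp add: bform_outside)
    qed (use fk fin_supp[OF w(1)] in auto)
    then have "[gmult p n ?w u l = (int k * u l + int (k choose 2) * bform n u u l) + u l + int k * bform n u u l] (mod int p)"
      unfolding bform_scale_left by (intro cong_trans[OF gmult_cong] cong_add cong_refl w(2))
    then show ?thesis unfolding c2 by (simp add: algebra_simps)
  qed
  then show ?case using gmult_closed[OF w(1) u] by simp
qed

lemma generic_exponent:
  assumes "u \<in> carrier (generic p n)"
  shows "u [^]\<^bsub>generic p n\<^esub> p = (\<lambda>_. 0)"
proof (rule generic_eqI)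
  fix l
  have "p dvd (p choose 2)" using p p2 by (intro dvd_choose_prime) auto
  then have "[int p * u l + int (p choose 2) * bform n u u l = 0] (mod int p)"
    by (simp add: cong_0_iff)
  then show "[(u [^]\<^bsub>generic p n\<^esub> p) l = 0] (mod int p)"
    using generic_pow[OF assms, of p] cong_trans by blast
qed (use generic_pow[OF assms] p2 in \<open>auto simp: generic_carrier supp_def\<close>)

text \<open>Products of constants lie in the radical of the form on both sides, which makes them
  central and turns multiplication by them into addition modulo \<open>p\<close>.\<close>

lemma bform_supported:
  assumes "\<And>i. i \<notin> {1..n} \<Longrightarrow> u i = 0"
  shows "bform n u v l = 0" "bform n v u l = 0"
proof -
  have "u i * w * table n i j l = 0" "w * u j * table n i j l = 0" for i j w
    using assms[of i] assms[of j] by (auto simp: table_def)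
  then show "bform n u v l = 0" "bform n v u l = 0" unfolding bform_def by (simp_all only: sum.neutral_const)
qed

lemma generic_cprod:
  "k \<le> n \<Longrightarrow> cprod (generic p n) (lconst (generic p n)) k a = (\<lambda>l. if l \<in> {1..k} then int (a l) mod int p else 0)"
proof (induction k)
  case (Suc k)
  let ?c = "\<lambda>l. if l = Suc k then 1 else (0::int)"
  let ?w = "?c [^]\<^bsub>generic p n\<^esub> (a (Suc k))"
  let ?u = "\<lambda>l. if l \<in> {1..k} then int (a l) mod int p else 0"
  have c0: "bform n ?c ?c l = 0" for l by (rule bform_supported) (use Suc.prems in auto)
  have w: "?w l = (if l = Suc k then int (a l) mod int p else 0)" for l
  proof -
    have "?w \<in> carrier (generic p n)" "[?w l = int (a (Suc k)) * ?c l] (mod int p)"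
      using generic_pow[OF unit_carrier, of "Suc k" "a (Suc k)"] c0 by auto
    then show ?thesis using generic_carrier_mod[of ?w p n l] by (auto simp: cong_def)
  qed
  have "gmult p n ?u ?w = (\<lambda>l. if l \<in> {1..Suc k} then int (a l) mod int p else 0)"
  proof
    fix l
    have "bform n ?u ?w l = 0" by (rule bform_supported) (use Suc.prems in auto)
    then show "gmult p n ?u ?w l = (if l \<in> {1..Suc k} then int (a l) mod int p else 0)"
      unfolding gmult_def using w[of l] by auto
  qed
  then show ?case using Suc by simp
qed auto

lemma generic_GG: "generic p n \<in> GG p n"
proof -
  let ?G = "generic p n"
  have "GG_elem p n ?G"
    unfolding GG_elem_def
  proof (intro conjI ballI allI impI)
    fix x assume x: "x \<in> carrier ?G"
    show "\<one>\<^bsub>?G\<^esub> \<otimes>\<^bsub>?G\<^esub> x = x" using generic_carrier_mod[OF x] by (auto simp: gmult_def)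
    show "linv ?G x \<otimes>\<^bsub>?G\<^esub> x = \<one>\<^bsub>?G\<^esub>" using generic_linv[OF x] by simp
    show "x [^]\<^bsub>?G\<^esub> p = \<one>\<^bsub>?G\<^esub>" using generic_exponent[OF x] by simp
  next
    fix i x assume i: "i \<in> {1..n}" and x: "x \<in> carrier ?G"
    let ?c = "\<lambda>l. if l = i then 1 else (0::int)"
    have z: "?c l = 0" if "l \<notin> {1..n}" for l using i that by auto
    have "bform n ?c x l = 0" "bform n x ?c l = 0" for l
      by (rule bform_supported[OF z], assumption)+
    then show "lconst ?G i \<otimes>\<^bsub>?G\<^esub> x = x \<otimes>\<^bsub>?G\<^esub> lconst ?G i"
      by (auto simp: gmult_def add.commute)
  next
    fix x y assume x: "x \<in> carrier ?G" and y: "y \<in> carrier ?G"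
    \<comment> \<open>The commutator is the difference of the form and its transpose; reduction
      modulo \<open>p\<close> turns it into natural exponents for \<open>cprod\<close>.\<close>
    define a where "a l = nat ((bform n x y l - bform n y x l) mod int p)" for l
    let ?u = "\<lambda>l. if l \<in> {1..n} then int (a l) mod int p else 0"
    have u: "[?u l = bform n x y l - bform n y x l] (mod int p)" for l
      using p2 by (simp add: a_def bform_outside cong_def)
    have uc: "?u \<in> carrier ?G"
      using p2 by (auto simp: generic_carrier supp_def)
    have "gmult p n x y = gmult p n ?u (gmult p n y x)"
    proof (rule generic_eqI)
      fix l
      have "bform n ?u (gmult p n y x) l = 0" by (rule bform_supported) auto
      then have "[gmult p n ?u (gmult p n y x) l = (bform n x y l - bform n y x l) + (y l + x l + bform n y x l) + 0] (mod int p)"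
        by (intro cong_trans[OF gmult_cong] cong_add u gmult_cong) auto
      then show "[gmult p n x y l = gmult p n ?u (gmult p n y x) l] (mod int p)"
        using gmult_cong[of p n x y l] by (simp add: cong_def algebra_simps)
    qed (use x y uc gmult_closed in auto)
    then have "x \<otimes>\<^bsub>?G\<^esub> y = cprod ?G (lconst ?G) n a \<otimes>\<^bsub>?G\<^esub> (y \<otimes>\<^bsub>?G\<^esub> x)"
      unfolding generic_cprod[OF order_refl] by simp
    then show "\<exists>a. x \<otimes>\<^bsub>?G\<^esub> y = cprod ?G (lconst ?G) n a \<otimes>\<^bsub>?G\<^esub> (y \<otimes>\<^bsub>?G\<^esub> x)" by blast
  next
    fix a i assume "cprod ?G (lconst ?G) n a = \<one>\<^bsub>?G\<^esub>" "i \<in> {1..n}"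
    then have "int (a i) mod int p = 0"
      unfolding generic_cprod[OF order_refl] by (auto dest: fun_cong[of _ _ i])
    then show "p dvd a i" by presburger
  qed (use generic_structure gmult_assoc in auto)
  then show ?thesis using GG_iff p prime_gt_0_nat by blast
qed

lemma countable_generic: "countable (carrier (generic p n))"
proof -
  have "carrier (generic p n) \<subseteq> range (\<lambda>(xs :: int list) i. if i < length xs then xs ! i else 0)"
  proof
    fix u assume "u \<in> carrier (generic p n)"
    then have "finite (supp u)" by (rule fin_supp)
    then obtain k where k: "\<forall>i\<in>supp u. i < k"
      unfolding finite_nat_set_iff_bounded by blast
    have "u i = (if i < length (map u [0..<k]) then map u [0..<k] ! i else 0)" for i
      using k by (auto simp: supp_def)
    then show "u \<in> range (\<lambda>(xs :: int list) i. if i < length xs then xs ! i else 0)"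
      by (intro image_eqI[where x = "map u [0..<k]"]) auto
  qed
  then show ?thesis by (rule countable_subset) auto
qed

lemma infinite_generic: "infinite (carrier (generic p n))"
proof -
  have "inj (\<lambda>i l :: nat. if l = i then 1 else (0::int))"
    by (rule injI) (metis zero_neq_one)
  then have "infinite (range (\<lambda>i l :: nat. if l = i then 1 else (0::int)))"
    by (simp add: finite_image_iff)
  moreover have "range (\<lambda>i l :: nat. if l = i then 1 else (0::int)) \<subseteq> carrier (generic p n)"
    using unit_carrier by auto
  ultimately show ?thesis using finite_subset by blast
qed

end

text \<open>Extension of a linear functional from a subspace of \<open>\<bbbF>\<^sub>p\<^sup>k\<close>, given by the coordinates \<open>co\<close>, to the whole space.\<close>

lemma (in monoid) functional_extension:
  fixes co :: "nat \<Rightarrow> 'a \<Rightarrow> int" and lam :: "'a \<Rightarrow> int"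
  assumes p: "prime p" and H: "H \<subseteq> carrier G" "\<one> \<in> H" "\<And>g h. g \<in> H \<Longrightarrow> h \<in> H \<Longrightarrow> g \<otimes> h \<in> H"
    and co: "\<And>j g h. g \<in> H \<Longrightarrow> h \<in> H \<Longrightarrow> [co j (g \<otimes> h) = co j g + co j h] (mod int p)"
    and lam: "\<And>g h. g \<in> H \<Longrightarrow> h \<in> H \<Longrightarrow> [lam (g \<otimes> h) = lam g + lam h] (mod int p)"
    and ker: "\<And>g. g \<in> H \<Longrightarrow> (\<And>j. j < k \<Longrightarrow> [co j g = 0] (mod int p)) \<Longrightarrow> [lam g = 0] (mod int p)"
  shows "\<exists>\<alpha>. \<forall>g\<in>H. [lam g = (\<Sum>j<k. \<alpha> j * co j g)] (mod int p)"
  using H co lam ker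
proof (induction k arbitrary: H)
  case 0
  then show ?case by simp
next
  case (Suc k)
  \<comment> \<open>On the kernel of the last coordinate the first \<open>k\<close> coordinates
    suffice, so the induction hypothesis applies there; its result is then corrected by a multiple
    of \<open>co k\<close>.\<close>
  define H' where "H' = {g \<in> H. [co k g = 0] (mod int p)}"
  have co1: "[co j \<one> = 0] (mod int p)" for j
    using Suc.prems(4)[of \<one> \<one> j] Suc.prems(2) by (simp add: cong_iff_dvd_diff)
  have "\<exists>\<alpha>. \<forall>g\<in>H'. [lam g = (\<Sum>j<k. \<alpha> j * co j g)] (mod int p)"
  proof (rule Suc.IH)
    show "H' \<subseteq> carrier G" "\<one> \<in> H'" using Suc.prems(1,2) co1 by (auto simp: H'_def)
    show "g \<otimes> h \<in> H'" if "g \<in> H'" "h \<in> H'" for g h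
      using that Suc.prems(3) cong_trans[OF Suc.prems(4)[of g h k]] cong_add[of "co k g" 0 "int p" "co k h" 0]
      by (auto simp: H'_def)
    show "[lam g = 0] (mod int p)" if "g \<in> H'" "\<And>j. j < k \<Longrightarrow> [co j g = 0] (mod int p)" for g
      using that Suc.prems(6)[of g] by (auto simp: H'_def less_Suc_eq)
  qed (use Suc.prems(4,5) in \<open>auto simp: H'_def\<close>)
  then obtain \<alpha> where \<alpha>: "\<And>g. g \<in> H' \<Longrightarrow> [lam g = (\<Sum>j<k. \<alpha> j * co j g)] (mod int p)" by blast
  \<comment> \<open>The error \<open>mu\<close> is additive on \<open>H\<close> and vanishes on the
    kernel \<open>H'\<close> of \<open>co k\<close>, so it has to be a multiple of
    \<open>co k\<close>.\<close>
  define mu where "mu g = lam g - (\<Sum>j<k. \<alpha> j * co j g)" for g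
  have mu: "[mu (g \<otimes> h) = mu g + mu h] (mod int p)" if "g \<in> H" "h \<in> H" for g h
  proof -
    have "[(\<Sum>j<k. \<alpha> j * co j (g \<otimes> h)) = (\<Sum>j<k. \<alpha> j * (co j g + co j h))] (mod int p)"
      by (intro cong_sum cong_scalar_left Suc.prems(4) that)
    then have "[mu (g \<otimes> h) = (lam g + lam h) - (\<Sum>j<k. \<alpha> j * (co j g + co j h))] (mod int p)"
      unfolding mu_def by (intro cong_diff Suc.prems(5) that)
    then show ?thesis by (simp add: mu_def algebra_simps sum.distrib)
  qed
  have mu0: "[mu g = 0] (mod int p)" if "g \<in> H'" for g
    using \<alpha>[OF that] by (simp add: mu_def cong_diff_iff_cong_0)
  have "\<exists>b. \<forall>g\<in>H. [mu g = b * co k g] (mod int p)"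
  proof (cases "\<forall>g\<in>H. [co k g = 0] (mod int p)")
    case True
    then show ?thesis using mu0 by (intro exI[of _ 0]) (auto simp: H'_def)
  next
    case False
    then obtain u where u: "u \<in> H" "\<not> [co k u = 0] (mod int p)" by blast
    have "coprime (co k u) (int p)"
      using u(2) p by (simp add: cong_0_iff coprime_commute prime_imp_coprime)
    then obtain t where t: "[co k u * t = 1] (mod int p)" using cong_solve_coprime_int by blast
    have "[mu g = (t * mu u) * co k g] (mod int p)" if g: "g \<in> H" for g
    proof -
      \<comment> \<open>\<open>t\<close> inverts \<open>co k u\<close> modulo \<open>p\<close>, so
        multiplying \<open>g\<close> by this power of \<open>u\<close> makes \<open>co k\<close>
        vanish; \<open>s\<close> is the nonnegative form of the exponent
        \<open>- (co k g * t)\<close>. Evaluating \<open>mu\<close> at the product gives the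
        claim.\<close>
      define s where "s = nat ((- (co k g * t)) mod int p)"
      have s: "[int s = - (co k g * t)] (mod int p)"
        using p prime_gt_0_nat by (simp add: s_def cong_def)
      have uH: "u [^] (i::nat) \<in> H" for i
        by (induction i) (use Suc.prems(2,3) u in auto)
      have pw: "[\<phi> (u [^] (i::nat)) = int i * \<phi> u] (mod int p)"
        if \<phi>: "\<And>g h. g \<in> H \<Longrightarrow> h \<in> H \<Longrightarrow> [\<phi> (g \<otimes> h) = \<phi> g + \<phi> h] (mod int p)" for \<phi> i
      proof (induction i)
        case 0
        show ?case using \<phi>[of \<one> \<one>] Suc.prems(2) by (simp add: cong_iff_dvd_diff)
      next
        case (Suc i)
        have "[\<phi> (u [^] i \<otimes> u) = int i * \<phi> u + \<phi> u] (mod int p)"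
          by (rule cong_trans[OF \<phi>[OF uH u(1)]]) (intro cong_add Suc cong_refl)
        then show ?case by (simp add: algebra_simps)
      qed
      have shift: "[\<phi> (g \<otimes> u [^] s) = \<phi> g + - (co k g * t) * \<phi> u] (mod int p)"
        if \<phi>: "\<And>g h. g \<in> H \<Longrightarrow> h \<in> H \<Longrightarrow> [\<phi> (g \<otimes> h) = \<phi> g + \<phi> h] (mod int p)" for \<phi>
      proof -
        have "[\<phi> (u [^] s) = - (co k g * t) * \<phi> u] (mod int p)"
          using cong_trans[OF pw[of \<phi> s, OF \<phi>] cong_mult[OF s cong_refl]] by blast
        then show ?thesis by (intro cong_trans[OF \<phi>[OF g uH]] cong_add cong_refl)
      qed
      have "[co k g + - (co k g * t) * co k u = co k g + - co k g * 1] (mod int p)"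
        using cong_add[OF cong_refl cong_mult[OF cong_refl t], of "co k g" "- co k g"] by (simp add: mult.commute mult.left_commute)
      then have "g \<otimes> u [^] s \<in> H'"
        using cong_trans[OF shift[of "co k", OF Suc.prems(4)]] Suc.prems(3)[OF g uH] by (simp add: H'_def)
      from mu0[OF this] shift[of mu, OF mu] have "[mu g + - (co k g * t) * mu u = 0] (mod int p)"
        using cong_trans cong_sym by blast
      then show ?thesis by (simp add: cong_iff_dvd_diff algebra_simps)
    qed
    then show ?thesis by blast
  qed
  then obtain b where b: "\<And>g. g \<in> H \<Longrightarrow> [mu g = b * co k g] (mod int p)" by blast
  have "[lam g = (\<Sum>j<Suc k. (\<alpha>(k := b)) j * co j g)] (mod int p)" if "g \<in> H" for g
  proof -
    have "(\<Sum>j<Suc k. (\<alpha>(k := b)) j * co j g) = (\<Sum>j<k. \<alpha> j * co j g) + b * co k g"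
      by simp
    moreover have "[lam g - (\<Sum>j<k. \<alpha> j * co j g) = b * co k g] (mod int p)" using b[OF that] by (simp add: mu_def)
    ultimately show ?thesis by (simp add: cong_iff_dvd_diff algebra_simps)
  qed
  then show ?case by blast
qed

subsection \<open>One-point extensions\<close>

context gg begin

text \<open>If \<open>p\<close> does not divide \<open>m\<close>, some power of
  \<open>x [^] m\<close> is \<open>x\<close> itself; so \<open>x [^] m\<close> lies in
  \<open>H\<close> only when \<open>p\<close> divides \<open>m\<close>.\<close>

lemma ext_unique:
  assumes H: "L_closed n G H" "H \<subseteq> carrier G" and x: "x \<in> carrier G" "x \<notin> H"
    and gh: "g \<in> H" "h \<in> H" and eq: "g \<otimes> x [^] (i::nat) = h \<otimes> x [^] (j::nat)"
  shows "g = h \<and> i mod p = j mod p"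
proof -
  have c: "g \<in> carrier G" "h \<in> carrier G" using gh H by auto
  \<comment> \<open>\<open>m\<close> stands for \<open>i - j\<close>, because
    \<open>x [^] ((p - 1) * j)\<close> is the inverse of \<open>x [^] j\<close>.\<close>
  define m where "m = i + (p - 1) * j"
  have "j + (p - 1) * j = p * j" using p_pos by (cases p) auto
  then have "x [^] j \<otimes> x [^] ((p - 1) * j) = \<one>"
    using x pow_p nat_pow_pow[OF x(1), of p j] by (simp add: nat_pow_mult)
  moreover have "g \<otimes> x [^] m = g \<otimes> x [^] i \<otimes> x [^] ((p - 1) * j)"
    using x c by (simp add: m_def m_assoc flip: nat_pow_mult)
  ultimately have "g \<otimes> x [^] m = h" using x c by (simp add: eq m_assoc)
  then have "x [^] m = inv g \<otimes> h" using x c by (metis inv_solve_left nat_pow_closed)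
  then have mH: "x [^] m \<in> H" using closed_inv[OF H] gh L_closedD(2)[OF H(1)] by simp
  have "p dvd m"
  proof (rule ccontr)
    assume nd: "\<not> p dvd m"
    then have "coprime m p" using prime_imp_coprime[OF p nd] coprime_commute by blast
    then obtain t where t: "[m * t = Suc 0] (mod p)" using cong_solve_coprime_nat by blast
    have "(x [^] m) [^] t = x [^] ((m * t) mod p)" using x by (simp add: nat_pow_pow pow_mod)
    also have "\<dots> = x" using t x pow_mod[of x "Suc 0"] by (simp add: cong_def)
    finally show False using closed_pow[OF H(1) mH, of t] x(2) by simp
  qed
  then have "m mod p = 0" by simp
  then have "j mod p = (m + j) mod p" by (metis add_0 mod_add_left_eq)
  also have "m + j = i + p * j" using p_pos by (cases p) (auto simp: m_def)
  finally have ij: "i mod p = j mod p" by simp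
  then have "x [^] i = x [^] j" using pow_mod x(1) by metis
  then show ?thesis using ij eq c x by simp
qed

end

text \<open>By \<open>ext_unique\<close> an element of the extension is
  \<open>g \<otimes> x [^] i\<close> with \<open>g\<close> unique and \<open>i\<close> unique modulo
  \<open>p\<close>, so sending it to \<open>f g \<otimes> y [^] i\<close> is well defined. The
  hypothesis \<open>act\<close> makes this a homomorphism; as \<open>y\<close> lies outside the
  image of \<open>H\<close>, the same uniqueness in \<open>D\<close> makes it injective.\<close>

lemma ext_embedding:
  assumes A: "gg p n A" and D: "gg p n D"
    and H: "L_closed n A H" "H \<subseteq> carrier A" and f: "L_embedding n f (A\<lparr>carrier := H\<rparr>) D"
    and x: "x \<in> carrier A" "x \<notin> H" and y: "y \<in> carrier D" "y \<notin> f ` H"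
    and act: "\<And>g. g \<in> H \<Longrightarrow> y \<otimes>\<^bsub>D\<^esub> f g = f (x \<otimes>\<^bsub>A\<^esub> g \<otimes>\<^bsub>A\<^esub> inv\<^bsub>A\<^esub> x) \<otimes>\<^bsub>D\<^esub> y"
  shows "\<exists>f'. L_embedding n f' (A\<lparr>carrier := gg.ext A H x\<rparr>) D \<and> (\<forall>g\<in>H. f' g = f g) \<and> f' x = y"
proof -
  interpret A: gg p n A by (rule A)
  interpret D: gg p n D by (rule D)
  have fH: "L_closed n D (f ` H)" "f ` H \<subseteq> carrier D"
    using L_closed_image[OF structure_restr[OF H(1)] f] L_embeddingD(1)[OF f] by auto
  have fD: "f \<one>\<^bsub>A\<^esub> = \<one>\<^bsub>D\<^esub>" "inj_on f H"
    "\<And>g h. g \<in> H \<Longrightarrow> h \<in> H \<Longrightarrow> f (g \<otimes>\<^bsub>A\<^esub> h) = f g \<otimes>\<^bsub>D\<^esub> f h"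
    "\<And>i. i \<in> {1..n} \<Longrightarrow> f (lconst A i) = lconst D i" "\<And>g. g \<in> H \<Longrightarrow> f g \<in> carrier D"
    using f fH unfolding L_embedding_restr_iff by blast+
  define F where "F q = (case (SOME (g, i). g \<in> H \<and> q = g \<otimes>\<^bsub>A\<^esub> x [^]\<^bsub>A\<^esub> (i::nat)) of (g, i) \<Rightarrow> f g \<otimes>\<^bsub>D\<^esub> y [^]\<^bsub>D\<^esub> i)" for q
  have F: "F (g \<otimes>\<^bsub>A\<^esub> x [^]\<^bsub>A\<^esub> i) = f g \<otimes>\<^bsub>D\<^esub> y [^]\<^bsub>D\<^esub> i" if g: "g \<in> H" for g and i :: nat
  proof -
    define z where "z = (SOME (h, j::nat). h \<in> H \<and> g \<otimes>\<^bsub>A\<^esub> x [^]\<^bsub>A\<^esub> i = h \<otimes>\<^bsub>A\<^esub> x [^]\<^bsub>A\<^esub> j)"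
    obtain h j where hj: "z = (h, j)" by (cases z)
    have "case z of (h, j::nat) \<Rightarrow> h \<in> H \<and> g \<otimes>\<^bsub>A\<^esub> x [^]\<^bsub>A\<^esub> i = h \<otimes>\<^bsub>A\<^esub> x [^]\<^bsub>A\<^esub> j"
      unfolding z_def by (rule someI[where x = "(g, i)"]) (simp add: g)
    then have h: "h \<in> H" "g \<otimes>\<^bsub>A\<^esub> x [^]\<^bsub>A\<^esub> i = h \<otimes>\<^bsub>A\<^esub> x [^]\<^bsub>A\<^esub> j" by (simp_all add: hj)
    have "g = h" "i mod p = j mod p" using A.ext_unique[OF H x g h] by auto
    moreover have "y [^]\<^bsub>D\<^esub> i = y [^]\<^bsub>D\<^esub> j" using D.pow_mod[OF y(1)] calculation(2) by metis
    moreover have "F (g \<otimes>\<^bsub>A\<^esub> x [^]\<^bsub>A\<^esub> i) = f h \<otimes>\<^bsub>D\<^esub> y [^]\<^bsub>D\<^esub> j"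
      unfolding F_def z_def[symmetric] by (simp add: hj)
    ultimately show ?thesis by simp
  qed
  have Fg: "F g = f g" if "g \<in> H" for g
    using F[OF that, of 0] that H(2) fD(5) by auto
  have Fx: "F x = y"
    using F[OF L_closedD(1)[OF H(1)], of 1] x y fD(1) by simp
  note cl = A.ext_closed[OF H x(1)]
  \<comment> \<open>One \<open>h'\<close> has to serve on both sides. It comes from iterating
    \<open>act\<close>; \<open>h\<close> varies in the induction because each step replaces it by
    its conjugate.\<close>
  have move: "\<exists>h'\<in>H. x [^]\<^bsub>A\<^esub> i \<otimes>\<^bsub>A\<^esub> h = h' \<otimes>\<^bsub>A\<^esub> x [^]\<^bsub>A\<^esub> i \<and>
      y [^]\<^bsub>D\<^esub> i \<otimes>\<^bsub>D\<^esub> f h = f h' \<otimes>\<^bsub>D\<^esub> y [^]\<^bsub>D\<^esub> i" if "h \<in> H" for h and i :: nat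
    using that
  proof (induction i arbitrary: h)
    case 0
    then show ?case using H fD(5) by (intro bexI[of _ h]) auto
  next
    case (Suc i)
    define h1 where "h1 = x \<otimes>\<^bsub>A\<^esub> h \<otimes>\<^bsub>A\<^esub> inv\<^bsub>A\<^esub> x"
    have h1: "h1 \<in> H" unfolding h1_def by (rule A.closed_conj[OF H Suc.prems x(1)])
    obtain h' where h': "h' \<in> H" "x [^]\<^bsub>A\<^esub> i \<otimes>\<^bsub>A\<^esub> h1 = h' \<otimes>\<^bsub>A\<^esub> x [^]\<^bsub>A\<^esub> i"
      "y [^]\<^bsub>D\<^esub> i \<otimes>\<^bsub>D\<^esub> f h1 = f h' \<otimes>\<^bsub>D\<^esub> y [^]\<^bsub>D\<^esub> i" using Suc.IH[OF h1] by blast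
    have c: "h \<in> carrier A" "h1 \<in> carrier A" "h' \<in> carrier A" using Suc.prems h1 h' H by auto
    have xh: "x \<otimes>\<^bsub>A\<^esub> h = h1 \<otimes>\<^bsub>A\<^esub> x" using c x by (simp add: h1_def A.m_assoc)
    have yh: "y \<otimes>\<^bsub>D\<^esub> f h = f h1 \<otimes>\<^bsub>D\<^esub> y" using act[OF Suc.prems] by (simp add: h1_def)
    have "x [^]\<^bsub>A\<^esub> Suc i \<otimes>\<^bsub>A\<^esub> h = (x [^]\<^bsub>A\<^esub> i \<otimes>\<^bsub>A\<^esub> h1) \<otimes>\<^bsub>A\<^esub> x"
      using c x xh by (simp add: A.m_assoc)
    then have 1: "x [^]\<^bsub>A\<^esub> Suc i \<otimes>\<^bsub>A\<^esub> h = h' \<otimes>\<^bsub>A\<^esub> x [^]\<^bsub>A\<^esub> Suc i"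
      using c x by (simp add: h'(2) A.m_assoc)
    note d = fD(5)[OF Suc.prems] fD(5)[OF h1] fD(5)[OF h'(1)]
    have "y [^]\<^bsub>D\<^esub> Suc i \<otimes>\<^bsub>D\<^esub> f h = (y [^]\<^bsub>D\<^esub> i \<otimes>\<^bsub>D\<^esub> f h1) \<otimes>\<^bsub>D\<^esub> y"
      using d y yh by (simp add: D.m_assoc)
    then have 2: "y [^]\<^bsub>D\<^esub> Suc i \<otimes>\<^bsub>D\<^esub> f h = f h' \<otimes>\<^bsub>D\<^esub> y [^]\<^bsub>D\<^esub> Suc i"
      using d y by (simp add: h'(3) D.m_assoc)
    show ?case using 1 2 h'(1) by blast
  qed
  have Fm: "F (u \<otimes>\<^bsub>A\<^esub> v) = F u \<otimes>\<^bsub>D\<^esub> F v" if "u \<in> A.ext H x" "v \<in> A.ext H x" for u v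
  proof -
    obtain g i h j where gh: "g \<in> H" "h \<in> H" and u: "u = g \<otimes>\<^bsub>A\<^esub> x [^]\<^bsub>A\<^esub> (i::nat)" "v = h \<otimes>\<^bsub>A\<^esub> x [^]\<^bsub>A\<^esub> (j::nat)"
      using \<open>u \<in> A.ext H x\<close> \<open>v \<in> A.ext H x\<close> by (auto simp: A.ext_def)
    obtain h' where h': "h' \<in> H" "x [^]\<^bsub>A\<^esub> i \<otimes>\<^bsub>A\<^esub> h = h' \<otimes>\<^bsub>A\<^esub> x [^]\<^bsub>A\<^esub> i"
      "y [^]\<^bsub>D\<^esub> i \<otimes>\<^bsub>D\<^esub> f h = f h' \<otimes>\<^bsub>D\<^esub> y [^]\<^bsub>D\<^esub> i" using move[OF gh(2)] by blast
    have c: "g \<in> carrier A" "h \<in> carrier A" "h' \<in> carrier A" using gh h' H by auto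
    note d = fD(5)[OF gh(1)] fD(5)[OF gh(2)] fD(5)[OF h'(1)]
    have "u \<otimes>\<^bsub>A\<^esub> v = g \<otimes>\<^bsub>A\<^esub> (x [^]\<^bsub>A\<^esub> i \<otimes>\<^bsub>A\<^esub> h) \<otimes>\<^bsub>A\<^esub> x [^]\<^bsub>A\<^esub> j" using c x u by (simp add: A.m_assoc)
    also have "\<dots> = (g \<otimes>\<^bsub>A\<^esub> h') \<otimes>\<^bsub>A\<^esub> x [^]\<^bsub>A\<^esub> (i + j)" using c x h'(2) by (simp add: A.m_assoc A.nat_pow_mult)
    finally have "F (u \<otimes>\<^bsub>A\<^esub> v) = f g \<otimes>\<^bsub>D\<^esub> f h' \<otimes>\<^bsub>D\<^esub> y [^]\<^bsub>D\<^esub> (i + j)"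
      using F[OF L_closedD(2)[OF H(1) gh(1) h'(1)]] fD(3)[OF gh(1) h'(1)] by simp
    also have "\<dots> = f g \<otimes>\<^bsub>D\<^esub> (y [^]\<^bsub>D\<^esub> i \<otimes>\<^bsub>D\<^esub> f h) \<otimes>\<^bsub>D\<^esub> y [^]\<^bsub>D\<^esub> j"
      using d y h'(3) by (simp add: D.m_assoc D.nat_pow_mult)
    also have "\<dots> = F u \<otimes>\<^bsub>D\<^esub> F v" using d y u F[OF gh(1)] F[OF gh(2)] by (simp add: D.m_assoc)
    finally show ?thesis .
  qed
  have Fc: "F u \<in> carrier D" if "u \<in> A.ext H x" for u
    using that F fD(5) y by (auto simp: A.ext_def)
  have F1: "F \<one>\<^bsub>A\<^esub> = \<one>\<^bsub>D\<^esub>" using Fg[OF L_closedD(1)[OF H(1)]] fD(1) by simp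
  have "L_embedding n F (A\<lparr>carrier := A.ext H x\<rparr>) D"
    unfolding L_embedding_restr_iff
  proof (intro conjI ballI)
    show "F ` A.ext H x \<subseteq> carrier D" using Fc by auto
    show "inj_on F (A.ext H x)"
    proof (rule inj_onI)
      fix u v assume uv: "u \<in> A.ext H x" "v \<in> A.ext H x" "F u = F v"
      obtain g i h j where gh: "g \<in> H" "h \<in> H" and u: "u = g \<otimes>\<^bsub>A\<^esub> x [^]\<^bsub>A\<^esub> (i::nat)" "v = h \<otimes>\<^bsub>A\<^esub> x [^]\<^bsub>A\<^esub> (j::nat)"
        using uv(1,2) by (auto simp: A.ext_def)
      have "f g \<otimes>\<^bsub>D\<^esub> y [^]\<^bsub>D\<^esub> i = f h \<otimes>\<^bsub>D\<^esub> y [^]\<^bsub>D\<^esub> j" using uv(3) u F gh by simp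
      then have "f g = f h \<and> i mod p = j mod p"
        by (intro D.ext_unique[OF fH y]) (use gh in auto)
      then have "g = h" "x [^]\<^bsub>A\<^esub> i = x [^]\<^bsub>A\<^esub> j"
        using gh fD(2) A.pow_mod[OF x(1)] by (auto simp: inj_on_def) metis
      then show "u = v" using u by simp
    qed
    show "F \<one>\<^bsub>A\<^esub> = \<one>\<^bsub>D\<^esub>" by (rule F1)
    show "F (u \<otimes>\<^bsub>A\<^esub> v) = F u \<otimes>\<^bsub>D\<^esub> F v" if "u \<in> A.ext H x" "v \<in> A.ext H x" for u v using Fm that .
    show "F (linv A u) = linv D (F u)" if u: "u \<in> A.ext H x" for u
    proof -
      have uc: "u \<in> carrier A" using u cl by auto
      have li: "linv A u \<in> A.ext H x" using L_closedD(3)[OF cl(1) u] .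
      have "F (linv A u) \<otimes>\<^bsub>D\<^esub> F u = F (linv A u \<otimes>\<^bsub>A\<^esub> u)" using Fm[OF li u] by simp
      also have "\<dots> = \<one>\<^bsub>D\<^esub>" using F1 A.linv_eq[OF uc] uc by simp
      finally show ?thesis using D.inv_equality[OF _ Fc[OF u] Fc[OF li]] D.linv_eq[OF Fc[OF u]] by simp
    qed
    show "F (lconst A i) = lconst D i" if "i \<in> {1..n}" for i
      using Fg[OF L_closedD(4)[OF H(1) that]] fD(4)[OF that] by simp
  qed
  then show ?thesis using Fg Fx by blast
qed

text \<open>As \<open>H\<close> is normal, \<open>x g x\<^sup>-\<^sup>1 g\<^sup>-\<^sup>1\<close> is a homomorphism in \<open>g\<close> that kills the constants, so it is a functional of the coordinates
  of \<open>f g\<close> outside \<open>{1..n}\<close>, and some basis vector of the generic group realizes it.\<close>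

lemma generic_witness:
  assumes p: "prime p" "p > 2" and A: "gg p n A"
    and H: "L_closed n A H" "H \<subseteq> carrier A" "finite H"
    and f: "L_embedding n f (A\<lparr>carrier := H\<rparr>) (generic p n)" and x: "x \<in> carrier A"
  shows "\<exists>y\<in>carrier (generic p n). y \<notin> f ` H \<and>
    (\<forall>g\<in>H. gmult p n y (f g) = gmult p n (f (x \<otimes>\<^bsub>A\<^esub> g \<otimes>\<^bsub>A\<^esub> inv\<^bsub>A\<^esub> x)) y)"
proof -
  interpret A: gg p n A by (rule A)
  let ?D = "generic p n"
  interpret D: gg p n ?D using p generic_GG by unfold_locales
  have fD: "f \<one>\<^bsub>A\<^esub> = \<one>\<^bsub>?D\<^esub>" "inj_on f H"
    "\<And>g h. g \<in> H \<Longrightarrow> h \<in> H \<Longrightarrow> f (g \<otimes>\<^bsub>A\<^esub> h) = f g \<otimes>\<^bsub>?D\<^esub> f h" "\<And>g. g \<in> H \<Longrightarrow> f g \<in> carrier ?D"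
    using f unfolding L_embedding_restr_iff by blast+
  let ?cA = "cprod A (lconst A) n" and ?cD = "cprod ?D (lconst ?D) n"
  \<comment> \<open>\<open>cprod\<close> over the restricted structure is compared with the generic
    group through \<open>f\<close> and with \<open>A\<close> through the inclusion.\<close>
  have fc: "f (?cA a) = ?cD a" for a
    using embedding_cprod[OF structure_restr[OF H(1)] f order_refl, of a] embedding_cprod[OF structure_restr[OF H(1)]
      substructure_restr[OF H(2,1), unfolded L_substructure_def, THEN conjunct2, THEN conjunct2] order_refl, of a] by simp
  \<comment> \<open>\<open>a g\<close> collects the exponents of the commutator of \<open>x\<close>
    and \<open>g\<close>. They are determined only modulo \<open>p\<close>, so statements about them
    are congruences.\<close>
  have "\<exists>a. \<forall>g\<in>H. x \<otimes>\<^bsub>A\<^esub> g = ?cA (a g) \<otimes>\<^bsub>A\<^esub> (g \<otimes>\<^bsub>A\<^esub> x)"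
    using A.commutator_cprod[OF x] H(2) by (intro bchoice) (metis subsetD)
  then obtain a where a: "\<And>g. g \<in> H \<Longrightarrow> x \<otimes>\<^bsub>A\<^esub> g = ?cA (a g) \<otimes>\<^bsub>A\<^esub> (g \<otimes>\<^bsub>A\<^esub> x)" by blast
  have conj: "f (x \<otimes>\<^bsub>A\<^esub> g \<otimes>\<^bsub>A\<^esub> inv\<^bsub>A\<^esub> x) = gmult p n (?cD (a g)) (f g)" if g: "g \<in> H" for g
  proof -
    have "x \<otimes>\<^bsub>A\<^esub> g \<otimes>\<^bsub>A\<^esub> inv\<^bsub>A\<^esub> x = ?cA (a g) \<otimes>\<^bsub>A\<^esub> g"
      using a[OF g] g H(2) x by (simp add: A.m_assoc subset_iff)
    then show ?thesis using fD(3)[OF A.closed_cprod[OF H(1) order_refl] g] fc by simp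
  qed
  have a_eq: "[int (a' l) = int (b l)] (mod int p)" if "?cA a' = ?cA b" "l \<in> {1..n}" for a' b l
    using that by (simp add: A.cprod_eq_iff cong_def flip: zmod_int)
  \<comment> \<open>As \<open>H\<close> is finite, a single \<open>k\<close> bounds the supports of
    all \<open>f g\<close>.\<close>
  obtain k where k: "\<And>g i. g \<in> H \<Longrightarrow> i \<ge> k \<Longrightarrow> f g i = 0"
  proof -
    have "finite (\<Union>g\<in>H. supp (f g))" using H(3) fD(4) by (auto simp: generic_carrier)
    then obtain k where "\<forall>i\<in>(\<Union>g\<in>H. supp (f g)). i < k" unfolding finite_nat_set_iff_bounded by blast
    then show ?thesis by (intro that[of k]) (force simp: supp_def)
  qed
  define co where "co j g = (if j \<in> {1..n} then 0 else f g j)" for j g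
  have "\<exists>\<alpha>. \<forall>g\<in>H. [int (a g l) = (\<Sum>j<k. \<alpha> j * co j g)] (mod int p)" if l: "l \<in> {1..n}" for l
  proof (rule A.functional_extension[OF p(1) H(2) L_closedD(1)[OF H(1)] L_closedD(2)[OF H(1)]])
    fix j g h assume gh: "g \<in> H" "h \<in> H"
    show "[co j (g \<otimes>\<^bsub>A\<^esub> h) = co j g + co j h] (mod int p)"
      using fD(3)[OF gh] gmult_outside[of j n p "f g" "f h"] by (simp add: co_def)
    have c: "g \<in> carrier A" "h \<in> carrier A" "?cA (a g) \<in> carrier A" "?cA (a h) \<in> carrier A" using gh H by auto
    have "x \<otimes>\<^bsub>A\<^esub> (g \<otimes>\<^bsub>A\<^esub> h) = ?cA (a g) \<otimes>\<^bsub>A\<^esub> g \<otimes>\<^bsub>A\<^esub> (x \<otimes>\<^bsub>A\<^esub> h)"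
      using a[OF gh(1)] c x by (simp flip: A.m_assoc)
    also have "\<dots> = ?cA (a g) \<otimes>\<^bsub>A\<^esub> (g \<otimes>\<^bsub>A\<^esub> ?cA (a h)) \<otimes>\<^bsub>A\<^esub> (h \<otimes>\<^bsub>A\<^esub> x)"
      using a[OF gh(2)] c x by (simp add: A.m_assoc)
    also have "g \<otimes>\<^bsub>A\<^esub> ?cA (a h) = ?cA (a h) \<otimes>\<^bsub>A\<^esub> g" using A.cprod_comm[OF order_refl c(1)] by simp
    also have "?cA (a g) \<otimes>\<^bsub>A\<^esub> (?cA (a h) \<otimes>\<^bsub>A\<^esub> g) \<otimes>\<^bsub>A\<^esub> (h \<otimes>\<^bsub>A\<^esub> x) =
        ?cA (\<lambda>i. a g i + a h i) \<otimes>\<^bsub>A\<^esub> (g \<otimes>\<^bsub>A\<^esub> h \<otimes>\<^bsub>A\<^esub> x)"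
      using c x A.cprod_mult[OF order_refl, of "a g" "a h", symmetric] by (simp add: A.m_assoc)
    finally have "?cA (a (g \<otimes>\<^bsub>A\<^esub> h)) \<otimes>\<^bsub>A\<^esub> (g \<otimes>\<^bsub>A\<^esub> h \<otimes>\<^bsub>A\<^esub> x) =
        ?cA (\<lambda>i. a g i + a h i) \<otimes>\<^bsub>A\<^esub> (g \<otimes>\<^bsub>A\<^esub> h \<otimes>\<^bsub>A\<^esub> x)"
      using a[OF L_closedD(2)[OF H(1) gh]] by simp
    then have "?cA (a (g \<otimes>\<^bsub>A\<^esub> h)) = ?cA (\<lambda>i. a g i + a h i)" using c x by simp
    from a_eq[OF this l] show "[int (a (g \<otimes>\<^bsub>A\<^esub> h) l) = int (a g l) + int (a h l)] (mod int p)" by simp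
  next
    \<comment> \<open>If the coordinates outside \<open>{1..n}\<close> vanish, \<open>f g\<close> is
      a product of constants; by injectivity so is \<open>g\<close>, which therefore commutes with
      \<open>x\<close>.\<close>
    fix g assume g: "g \<in> H" and 0: "\<And>j. j < k \<Longrightarrow> [co j g = 0] (mod int p)"
    have gz: "f g j = 0" if "j \<notin> {1..n}" for j
    proof (cases "j < k")
      case True
      have "co j g = f g j" unfolding co_def using that by (rule if_not_P)
      then show ?thesis using 0[OF True] generic_carrier_mod[OF fD(4)[OF g], of j] by (simp add: cong_def)
    qed (use k g in auto)
    have "f g = ?cD (\<lambda>l. nat (f g l))"
      unfolding generic_cprod[OF p order_refl]
      using gz generic_carrier_mod[OF fD(4)[OF g]] fD(4)[OF g] by (auto simp: generic_carrier fun_eq_iff)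
    then have "f g = f (?cA (\<lambda>l. nat (f g l)))" using fc by simp
    then have "g = ?cA (\<lambda>l. nat (f g l))"
      using fD(2) g A.closed_cprod[OF H(1) order_refl] by (auto simp: inj_on_def)
    then have "x \<otimes>\<^bsub>A\<^esub> g = g \<otimes>\<^bsub>A\<^esub> x" using A.cprod_comm[OF order_refl x] by metis
    moreover have "g \<otimes>\<^bsub>A\<^esub> x \<in> carrier A" using g H(2) x by auto
    ultimately have "?cA (a g) = \<one>\<^bsub>A\<^esub>" using a[OF g]
      by (metis A.cprod_closed A.l_cancel_one' order_refl A.r_cancel_one)
    then have "?cA (a g) = ?cA (\<lambda>_. 0)" using A.cprod_zero by simp
    from a_eq[OF this l] show "[int (a g l) = 0] (mod int p)" by simp
  qed
  then obtain \<alpha> where \<alpha>: "\<And>l g. l \<in> {1..n} \<Longrightarrow> g \<in> H \<Longrightarrow> [int (a g l) = (\<Sum>j<k. \<alpha> l j * co j g)] (mod int p)"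
    by metis
  \<comment> \<open>The index \<open>m\<close> codes the functionals \<alpha>. Being at least
    \<open>k\<close>, it puts the new basis vector outside the image of \<open>H\<close>; being
    larger than \<open>n\<close>, it keeps the vector away from the constants.\<close>
  obtain m where m: "m \<ge> k" "m > n"
    "\<And>j l. j < k \<Longrightarrow> j \<notin> {1..n} \<Longrightarrow> l \<in> {1..n} \<Longrightarrow> table n m j l = \<alpha> l j"
    using table_exists[of k n "\<lambda>j l. \<alpha> l j"] by blast
  let ?y = "\<lambda>l. if l = m then 1 else (0::int)"
  have yc: "?y \<in> carrier ?D" by (rule unit_carrier[OF p])
  have "?y \<notin> f ` H"
  proof
    assume "?y \<in> f ` H"
    then obtain g where "g \<in> H" "f g = ?y" by auto
    then have "?y m = 0" using k[of g m] m(1) by simp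
    then show False by simp
  qed
  moreover have "gmult p n ?y (f g) = gmult p n (f (x \<otimes>\<^bsub>A\<^esub> g \<otimes>\<^bsub>A\<^esub> inv\<^bsub>A\<^esub> x)) ?y" if g: "g \<in> H" for g
  proof (rule generic_eqI[OF p])
    let ?c = "?cD (a g)"
    have cc: "?c \<in> carrier ?D" by (rule D.cprod_closed) simp
    have c0: "?c i = 0" if "i \<notin> {1..n}" for i
      using that unfolding generic_cprod[OF p order_refl] by auto
    have "f (x \<otimes>\<^bsub>A\<^esub> g \<otimes>\<^bsub>A\<^esub> inv\<^bsub>A\<^esub> x) \<in> carrier ?D" using A.closed_conj[OF H(1,2) g x] fD(4) by blast
    then show "gmult p n ?y (f g) \<in> carrier ?D" "gmult p n (f (x \<otimes>\<^bsub>A\<^esub> g \<otimes>\<^bsub>A\<^esub> inv\<^bsub>A\<^esub> x)) ?y \<in> carrier ?D"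
      using gmult_closed[OF p] yc fD(4)[OF g] by blast+
    fix l
    have s: "supp ?y = {m}" by (auto simp: supp_def)
    have "(\<Sum>j<m. f g j * table n m j l) = (\<Sum>j<k. f g j * table n m j l)"
      by (rule sum.mono_neutral_right) (use m(1) k[OF g] in auto)
    then have fy: "bform n ?y (f g) l = (\<Sum>j<k. f g j * table n m j l)" by (simp add: bform_def s)
    \<comment> \<open>Indices in the support of \<open>f g\<close> lie below
      \<open>k \<le> m\<close>, so the form vanishes in this order of arguments and the whole
      commutator is the value of the form at \<open>?y\<close> and \<open>f g\<close>.\<close>
    have yf: "bform n (f g) ?y l = 0"
      unfolding bform_def
    proof (intro sum.neutral ballI)
      fix i j assume i: "i \<in> supp (f g)" and j: "j \<in> {..<i}"
      have "i < k" using i k[OF g, of i] by (force simp: supp_def)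
      then have "j \<noteq> m" using j m(1) by simp
      then show "f g i * ?y j * table n i j l = 0" by simp
    qed
    have cz: "bform n ?c w l = 0" for w by (rule bform_supported(1)[OF p c0])
    have key: "[bform n ?y (f g) l = ?c l] (mod int p)"
    proof (cases "l \<in> {1..n}")
      case True
      have "(\<Sum>j<k. f g j * table n m j l) = (\<Sum>j<k. \<alpha> l j * co j g)"
      proof (rule sum.cong)
        fix j assume "j \<in> {..<k}"
        then show "f g j * table n m j l = \<alpha> l j * co j g"
          using m(3)[of j l] True by (cases "j \<in> {1..n}") (auto simp: co_def table_def)
      qed simp
      then show ?thesis using \<alpha>[OF True g] True unfolding fy generic_cprod[OF p order_refl]
        by (simp add: cong_def)
    next
      case False
      then show ?thesis using c0 by (simp add: bform_outside)
    qed
    have "[gmult p n (f (x \<otimes>\<^bsub>A\<^esub> g \<otimes>\<^bsub>A\<^esub> inv\<^bsub>A\<^esub> x)) ?y l = gmult p n ?c (gmult p n (f g) ?y) l] (mod int p)"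
      unfolding conj[OF g] gmult_assoc[OF p cc fD(4)[OF g] yc] by simp
    also have "[gmult p n ?c (gmult p n (f g) ?y) l = ?c l + (f g l + ?y l + 0) + 0] (mod int p)"
      using gmult_cong[of p n "f g" ?y l] cz yf
      by (intro cong_trans[OF gmult_cong] cong_add cong_refl) auto
    finally have 1: "[gmult p n (f (x \<otimes>\<^bsub>A\<^esub> g \<otimes>\<^bsub>A\<^esub> inv\<^bsub>A\<^esub> x)) ?y l = ?c l + f g l + ?y l] (mod int p)" by (simp add: add.assoc)
    have 2: "[gmult p n ?y (f g) l = ?y l + f g l + ?c l] (mod int p)"
      by (intro cong_trans[OF gmult_cong] cong_add cong_refl key)
    show "[gmult p n ?y (f g) l = gmult p n (f (x \<otimes>\<^bsub>A\<^esub> g \<otimes>\<^bsub>A\<^esub> inv\<^bsub>A\<^esub> x)) ?y l] (mod int p)"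
      using 1 2 by (simp add: cong_def algebra_simps)
  qed
  ultimately show ?thesis using yc by blast
qed

section \<open>The extension property in terms of tuples\<close>

text \<open>The source \<open>A\<close> ranges over all of \<open>GG\<close>, not only over finite
  structures, so that \<open>D\<close> itself can be taken as \<open>A\<close>; the type argument
  fixes where \<open>A\<close> lives. The index \<open>k\<close> is fresh and holds the new
  point.\<close>

definition extension_property :: "'a itself \<Rightarrow> nat \<Rightarrow> nat \<Rightarrow> 'b L_struct \<Rightarrow> bool" where
  "extension_property (u :: 'a itself) p n D \<longleftrightarrow>
     (\<forall>(A :: 'a L_struct) e d F x k. A \<in> GG p n \<longrightarrow> finite F \<longrightarrow> e ` F \<subseteq> carrier A \<longrightarrow> d ` F \<subseteq> carrier D \<longrightarrow>
        qfeq n A e D d F \<longrightarrow> x \<in> carrier A \<longrightarrow> k \<notin> F \<longrightarrow>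
        (\<exists>y\<in>carrier D. qfeq n A (e(k := x)) D (d(k := y)) (insert k F)))"

lemma generic_extension_property:
  assumes p: "prime p" "p > 2"
  shows "extension_property TYPE('a) p n (generic p n)"
  unfolding extension_property_def
proof (intro allI impI)
  fix A :: "'a L_struct" and e d F x and k :: nat
  let ?D = "generic p n"
  assume A: "A \<in> GG p n" and F: "finite F" "e ` F \<subseteq> carrier A" "d ` F \<subseteq> carrier ?D"
    and q: "qfeq n A e ?D d F" and x: "x \<in> carrier A" and k: "k \<notin> F"
  interpret A: gg p n A using p A by unfold_locales
  interpret D: gg p n ?D using p generic_GG by unfold_locales
  let ?H = "L_generated n A (e ` F)"
  have H: "L_closed n A ?H" "?H \<subseteq> carrier A" "finite ?H" "e ` F \<subseteq> ?H"
    using L_closed_generated[OF A.struct] L_generated_carrier[OF A.struct F(2)]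
      A.generated_finite[OF finite_imageI[OF F(1)] F(2)] L_generated_superset[of "e ` F" n A] by blast+
  obtain f where f: "L_embedding n f (A\<lparr>carrier := ?H\<rparr>) ?D" "\<And>i. i \<in> F \<Longrightarrow> f (e i) = d i"
    by (rule qfeq_imp_embedding[OF A.struct F(2) D.struct F(3) q]) (rule that)
  \<comment> \<open>\<open>Q\<close> is \<open>?H\<close> if \<open>x\<close> already lies in it,
    and the extension of \<open>?H\<close> by \<open>x\<close> otherwise.\<close>
  have "\<exists>f' Q. L_closed n A Q \<and> Q \<subseteq> carrier A \<and> ?H \<subseteq> Q \<and> x \<in> Q \<and> L_embedding n f' (A\<lparr>carrier := Q\<rparr>) ?D \<and>
    (\<forall>g\<in>?H. f' g = f g)"
  proof (cases "x \<in> ?H")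
    case True
    then show ?thesis using H f by blast
  next
    case False
    obtain y where y: "y \<in> carrier ?D" "y \<notin> f ` ?H"
      "\<And>g. g \<in> ?H \<Longrightarrow> y \<otimes>\<^bsub>?D\<^esub> f g = f (x \<otimes>\<^bsub>A\<^esub> g \<otimes>\<^bsub>A\<^esub> inv\<^bsub>A\<^esub> x) \<otimes>\<^bsub>?D\<^esub> y"
      using generic_witness[OF p A.gg_axioms H(1-3) f(1) x] by auto
    show ?thesis
      using ext_embedding[OF A.gg_axioms D.gg_axioms H(1,2) f(1) x False y] A.ext_closed[OF H(1,2) x] by blast
  qed
  then obtain f' Q where f': "L_closed n A Q" "Q \<subseteq> carrier A" "?H \<subseteq> Q" "x \<in> Q"
    "L_embedding n f' (A\<lparr>carrier := Q\<rparr>) ?D" "\<And>g. g \<in> ?H \<Longrightarrow> f' g = f g" by blast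
  have "qfeq n (A\<lparr>carrier := Q\<rparr>) (e(k := x)) ?D (d(k := f' x)) (insert k F)"
  proof (rule qfeq_embedding[OF structure_restr[OF f'(1)] f'(5)])
    show "(e(k := x)) ` insert k F \<subseteq> carrier (A\<lparr>carrier := Q\<rparr>)" using f' H by auto
    fix i assume i: "i \<in> insert k F"
    show "f' ((e(k := x)) i) = (d(k := f' x)) i"
    proof (cases "i = k")
      case False
      then have "i \<in> F" using i by simp
      then show ?thesis using False f'(6)[of "e i"] f(2) H(4) by auto
    qed simp
  qed
  then have "qfeq n A (e(k := x)) ?D (d(k := f' x)) (insert k F)" by (simp add: qfeq_restr)
  moreover have "f' x \<in> carrier ?D" using L_embeddingD(1)[OF f'(5)] f'(4) by simp
  ultimately show "\<exists>y\<in>carrier ?D. qfeq n A (e(k := x)) ?D (d(k := y)) (insert k F)" by blast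
qed

text \<open>A term without variables is a product of constants with exponents that do not depend on
  the structure, and independence decides equality of such products. So the empty tuple can always
  start an extension argument, which is what joint embedding rests on.\<close>

lemma qfeq_empty:
  assumes "prime p" "A \<in> GG p n" "B \<in> GG p n"
  shows "qfeq n A e B d {}"
proof -
  interpret A: gg p n A using assms by unfold_locales
  interpret B: gg p n B using assms by unfold_locales
  let ?cA = "cprod A (lconst A) n" and ?cB = "cprod B (lconst B) n"
  have "\<exists>a. term_val A e t = ?cA a \<and> term_val B d t = ?cB a" if "t \<in> tm n {}" for t
    using that
  proof (induction rule: tm_induct)
    case One
    show ?case using A.cprod_zero[OF order_refl] B.cprod_zero[OF order_refl] by (intro exI[of _ "\<lambda>_. 0"]) simp
  next
    case (Mult s t)
    then show ?case using A.cprod_mult[OF order_refl] B.cprod_mult[OF order_refl] by auto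
  next
    case (Inv t)
    then obtain a where "term_val A e t = ?cA a" "term_val B d t = ?cB a" by blast
    then show ?case
      by (intro exI[of _ "\<lambda>i. a i * (p - 1)"])
        (simp add: A.linv_eq B.linv_eq A.inv_pow B.inv_pow A.cprod_pow B.cprod_pow)
  next
    case (Const i)
    then show ?case
      using A.cprod_unit[OF order_refl] B.cprod_unit[OF order_refl] by (intro exI[of _ "\<lambda>j. if j = i then 1 else 0"]) auto
  qed auto
  then obtain a where "term_val A e t = ?cA (a t) \<and> term_val B d t = ?cB (a t)" if "t \<in> tm n {}" for t by metis
  then show ?thesis unfolding qfeq_def by (simp add: A.cprod_eq_iff B.cprod_eq_iff)
qed

subsection \<open>Fraisse limits\<close>

lemma L_isomorphism_of_back_and_forth:
  assumes M: "L_structure n M" "countable (carrier M)" and N: "L_structure n N" "countable (carrier N)"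
    and cong: "\<And>e d e' d' k. R e d k \<Longrightarrow> (\<And>i. i < k \<Longrightarrow> e i = e' i) \<Longrightarrow> (\<And>i. i < k \<Longrightarrow> d i = d' i) \<Longrightarrow>
      range e' \<subseteq> carrier M \<Longrightarrow> range d' \<subseteq> carrier N \<Longrightarrow> R e' d' k"
    and qf: "\<And>e d k. R e d k \<Longrightarrow> range e \<subseteq> carrier M \<Longrightarrow> range d \<subseteq> carrier N \<Longrightarrow> qfeq n M e N d {..<k}"
    and forth: "\<And>e d k x. R e d k \<Longrightarrow> range e \<subseteq> carrier M \<Longrightarrow> range d \<subseteq> carrier N \<Longrightarrow> x \<in> carrier M \<Longrightarrow>
      \<exists>y\<in>carrier N. R (e(k := x)) (d(k := y)) (Suc k)"
    and backw: "\<And>e d k y. R e d k \<Longrightarrow> range e \<subseteq> carrier M \<Longrightarrow> range d \<subseteq> carrier N \<Longrightarrow> y \<in> carrier N \<Longrightarrow>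
      \<exists>x\<in>carrier M. R (e(k := x)) (d(k := y)) (Suc k)"
    and start: "R e0 d0 k0" "range e0 \<subseteq> carrier M" "range d0 \<subseteq> carrier N"
  obtains g where "L_isomorphism n g M N" "\<And>i. i < k0 \<Longrightarrow> g (e0 i) = d0 i"
proof -
  have ne: "carrier M \<noteq> {}" "carrier N \<noteq> {}" using start(2,3) by auto
  obtain e d where ed: "range e = carrier M" "range d = carrier N" "\<And>k. k \<ge> k0 \<Longrightarrow> R e d k"
    "\<And>i. i < k0 \<Longrightarrow> e i = e0 i \<and> d i = d0 i"
  proof (rule back_and_forth[of "carrier M" "carrier N" R, OF M(2) ne(1) N(2) ne(2) _ _ _ start])
    fix e d e' d' and k :: nat
    assume "R e d k" "\<And>i. i < k \<Longrightarrow> e i = e' i" "\<And>i. i < k \<Longrightarrow> d i = d' i" "range e' \<subseteq> carrier M" "range d' \<subseteq> carrier N"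
    then show "R e' d' k" by (rule cong)
  next
    fix e d and k :: nat and x
    assume "R e d k" "range e \<subseteq> carrier M" "range d \<subseteq> carrier N" "x \<in> carrier M"
    then show "\<exists>y\<in>carrier N. R (e(k := x)) (d(k := y)) (Suc k)" by (rule forth)
  next
    fix e d and k :: nat and y
    assume "R e d k" "range e \<subseteq> carrier M" "range d \<subseteq> carrier N" "y \<in> carrier N"
    then show "\<exists>x\<in>carrier M. R (e(k := x)) (d(k := y)) (Suc k)" by (rule backw)
  qed (rule that)
  have "qfeq n M e N d {..<k}" for k
  proof (rule qfeq_mono)
    \<comment> \<open>\<open>R\<close> is available only from \<open>k0\<close> on; smaller
      \<open>k\<close> follow by restriction.\<close>
    show "qfeq n M e N d {..<max k k0}" using qf ed(1-3) by simp
  qed auto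
  then have "qfeq n M e N d UNIV" by (rule qfeq_UNIV)
  then obtain g where g: "L_isomorphism n g M N" "\<And>i. g (e i) = d i"
    by (rule qfeq_isomorphism[OF M(1) ed(1) N(1) ed(2)]) (rule that)
  have "g (e0 i) = d0 i" if "i < k0" for i using g(2)[of i] ed(4)[OF that] by simp
  with g(1) show ?thesis by (rule that)
qed

lemma finite_enumeration:
  assumes "finite S" "S \<subseteq> carrier M" "L_structure n M"
  obtains e :: "nat \<Rightarrow> 'a" and k where "range e \<subseteq> carrier M" "e ` {..<k} = S"
proof -
  obtain xs where xs: "set xs = S" using assms(1) finite_list by blast
  define e where "e i = (if i < length xs then xs ! i else \<one>\<^bsub>M\<^esub>)" for i
  have "\<one>\<^bsub>M\<^esub> \<in> carrier M" using assms(3) by (simp add: L_structure_def L_closed_def)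
  moreover have "e i \<in> S" if "i < length xs" for i using xs that by (auto simp: e_def)
  ultimately have "range e \<subseteq> carrier M" using assms(2) by (auto simp: e_def)
  moreover have "e ` {..<length xs} = S"
  proof
    show "S \<subseteq> e ` {..<length xs}"
    proof
      fix x assume "x \<in> S"
      then obtain i where "i < length xs" "xs ! i = x" using xs by (metis in_set_conv_nth)
      then show "x \<in> e ` {..<length xs}" by (intro image_eqI[of _ _ i]) (auto simp: e_def)
    qed
  qed (use \<open>\<And>i. i < length xs \<Longrightarrow> e i \<in> S\<close> in auto)
  ultimately show ?thesis by (rule that)
qed

lemma fg_substructureD:
  assumes "fg_substructure n B D"
  shows "L_structure n B" "carrier B \<subseteq> carrier D" "L_embedding n (\<lambda>x. x) B D"
  using assms by (auto simp: fg_substructure_def L_substructure_def)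

lemma fg_image:
  assumes "L_structure n A" "finite (carrier A)" "L_embedding n f A D" "L_structure n D"
  shows "fg_substructure n (D\<lparr>carrier := f ` carrier A\<rparr>) D"
    "L_isomorphism n f A (D\<lparr>carrier := f ` carrier A\<rparr>)"
proof -
  have cl: "L_closed n D (f ` carrier A)" by (rule L_closed_image[OF assms(1,3)])
  have sub: "f ` carrier A \<subseteq> carrier D" using L_embeddingD(1)[OF assms(3)] by auto
  have "L_generated n D (f ` carrier A) = f ` carrier A"
    by (intro subset_antisym L_generated_subset[OF order_refl sub cl] L_generated_superset)
  then show "fg_substructure n (D\<lparr>carrier := f ` carrier A\<rparr>) D"
    using fg_restr_generated[OF assms(4) sub] assms(2) by simp
  show "L_isomorphism n f A (D\<lparr>carrier := f ` carrier A\<rparr>)"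
    unfolding L_isomorphism_def using L_embedding_into[OF assms(3) order_refl] by simp
qed

lemma L_isomorphism_comp:
  assumes "L_isomorphism n f A B" "L_isomorphism n g B C"
  shows "L_isomorphism n (g \<circ> f) A C"
  using assms L_embedding_comp unfolding L_isomorphism_def by (metis image_comp)

text \<open>Both images are finite substructures, and \<open>v\<close> after the inverse of
  \<open>u\<close> is an isomorphism between them, to which homogeneity applies.\<close>

lemma ultrahomogeneous_embeddings:
  assumes D: "ultrahomogeneous n D" "L_structure n D" and A: "L_structure n A" "finite (carrier A)"
    and u: "L_embedding n u A D" and v: "L_embedding n v A D"
  obtains g where "L_isomorphism n g D D" "\<And>a. a \<in> carrier A \<Longrightarrow> g (u a) = v a"
proof -
  let ?U = "D\<lparr>carrier := u ` carrier A\<rparr>" and ?V = "D\<lparr>carrier := v ` carrier A\<rparr>"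
  let ?w = "inv_into (carrier A) u"
  have U: "fg_substructure n ?U D" "L_isomorphism n u A ?U" and V: "fg_substructure n ?V D" "L_isomorphism n v A ?V"
    using fg_image[OF A _ D(2)] u v by blast+
  have w: "L_isomorphism n ?w ?U A" by (rule L_isomorphism_inv[OF A(1) U(2)])
  then have "L_isomorphism n (v \<circ> ?w) ?U ?V"
    using V(2) by (rule L_isomorphism_comp)
  then obtain g where g: "L_isomorphism n g D D" "\<forall>x\<in>carrier ?U. g x = (v \<circ> ?w) x"
    using D(1) U(1) V(1) unfolding ultrahomogeneous_def by blast
  have "g (u a) = v a" if "a \<in> carrier A" for a
    using g(2) that L_embeddingD(2)[OF u] by simp
  then show ?thesis using g(1) that by blast
qed

lemma ultrahomogeneous_qfeq:
  assumes D: "ultrahomogeneous n D" "L_structure n D" and F: "finite F"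
    and e: "e ` F \<subseteq> carrier D" and d: "d ` F \<subseteq> carrier D" and q: "qfeq n D e D d F"
  obtains g where "L_isomorphism n g D D" "\<And>i. i \<in> F \<Longrightarrow> g (e i) = d i"
proof -
  let ?U = "D\<lparr>carrier := L_generated n D (e ` F)\<rparr>" and ?V = "D\<lparr>carrier := L_generated n D (d ` F)\<rparr>"
  obtain f where f: "L_embedding n f ?U D" "\<And>t. t \<in> tm n F \<Longrightarrow> f (term_val D e t) = term_val D d t"
    "\<And>i. i \<in> F \<Longrightarrow> f (e i) = d i"
    by (rule qfeq_imp_embedding[OF D(2) e D(2) d q]) (rule that)
  have im: "f ` carrier ?U = carrier ?V"
    using f(2) by (simp add: L_generated_eq[OF D(2) e] L_generated_eq[OF D(2) d] image_image)
  then have "L_isomorphism n f ?U ?V"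
    unfolding L_isomorphism_def using L_embedding_into[OF f(1), of "carrier ?V"] by simp
  moreover have "fg_substructure n ?U D" "fg_substructure n ?V D"
    using fg_restr_generated[OF D(2)] e d F by auto
  ultimately obtain g where g: "L_isomorphism n g D D" "\<forall>x\<in>carrier ?U. g x = f x"
    using D(1) unfolding ultrahomogeneous_def by blast
  have "g (e i) = d i" if "i \<in> F" for i
    using g(2) f(3)[OF that] that L_generated_superset[of "e ` F" n D] by auto
  then show ?thesis using g(1) that by blast
qed

lemma fraisse_limit_embeds:
  assumes D: "fraisse_limit n K D" and D': "fraisse_limit n K D'" and B: "fg_substructure n B D"
  obtains h where "L_embedding n h B D'"
proof -
  obtain A where "A \<in> K" "L_isomorphic n B A" using D B unfolding fraisse_limit_def by blast
  moreover obtain B' where B': "fg_substructure n B' D'" "L_isomorphic n B' A"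
    using D' \<open>A \<in> K\<close> unfolding fraisse_limit_def by blast
  ultimately obtain f g where f: "L_isomorphism n f B A" and g: "L_isomorphism n g B' A"
    unfolding L_isomorphic_def by blast
  have "L_embedding n (inv_into (carrier B') g) A B'"
    using L_isomorphism_inv[OF fg_substructureD(1)[OF B'(1)] g] by (simp add: L_isomorphism_def)
  then have "L_embedding n ((\<lambda>x. x) \<circ> (inv_into (carrier B') g \<circ> f)) B D'"
    using f fg_substructureD(3)[OF B'(1)] by (intro L_embedding_comp) (auto simp: L_isomorphism_def)
  then show ?thesis by (rule that)
qed

text \<open>\<open>D'\<close> contains a copy of the substructure generated by the tuple and
  \<open>x\<close>, but possibly in the wrong place. An automorphism of \<open>D'\<close> carries
  the copy of the tuple to \<open>d\<close>, and takes the copy of \<open>x\<close> along.\<close>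

lemma fraisse_limit_forth:
  assumes D: "fraisse_limit n K D" and D': "fraisse_limit n K D'" and F: "finite F"
    and e: "e ` F \<subseteq> carrier D" and d: "d ` F \<subseteq> carrier D'" and q: "qfeq n D e D' d F"
    and x: "x \<in> carrier D" and k: "k \<notin> F"
  shows "\<exists>y\<in>carrier D'. qfeq n D (e(k := x)) D' (d(k := y)) (insert k F)"
proof -
  have sD: "L_structure n D" and sD': "L_structure n D'" and uh: "ultrahomogeneous n D'"
    using D D' by (auto simp: fraisse_limit_def)
  let ?S = "insert x (e ` F)"
  let ?B = "D\<lparr>carrier := L_generated n D ?S\<rparr>"
  have S: "?S \<subseteq> carrier D" "finite ?S" using e x F by auto
  have B: "fg_substructure n ?B D" by (rule fg_restr_generated[OF sD S])
  have SB: "?S \<subseteq> carrier ?B" using L_generated_superset[of ?S n D] by simp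
  obtain h where h: "L_embedding n h ?B D'" by (rule fraisse_limit_embeds[OF D D' B])
  have sB: "L_structure n ?B" by (rule fg_substructureD(1)[OF B])
  have "qfeq n ?B e D' (\<lambda>i. h (e i)) F"
    by (rule qfeq_embedding[OF sB h]) (use SB in auto)
  then have "qfeq n D' (\<lambda>i. h (e i)) D' d F"
    using q qfeq_trans[OF qfeq_sym] by (simp only: qfeq_restr)
  then obtain g where g: "L_isomorphism n g D' D'" "\<And>i. i \<in> F \<Longrightarrow> g (h (e i)) = d i"
    using L_embeddingD(1)[OF h] SB d by (elim ultrahomogeneous_qfeq[OF uh sD' F, rotated 2]) auto
  have gh: "L_embedding n (g \<circ> h) ?B D'" 
    by (rule L_embedding_comp[OF h]) (use g(1) in \<open>simp add: L_isomorphism_def\<close>)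
  have "qfeq n ?B (e(k := x)) D' (d(k := g (h x))) (insert k F)"
    by (rule qfeq_embedding[OF sB gh]) (use SB g(2) k in \<open>auto simp: image_subset_iff\<close>)
  moreover have "g (h x) \<in> carrier D'" using L_embeddingD(1)[OF gh, of x] SB by simp
  ultimately show ?thesis by (auto simp: qfeq_restr)
qed

text \<open>Two limits have the same age, so \<open>fraisse_limit_forth\<close> supplies both
  directions of the back-and-forth. Through this, properties of the constructed group reach an
  arbitrary limit.\<close>

theorem fraisse_limit_unique:
  assumes D: "fraisse_limit n K D" and D': "fraisse_limit n K D'"
  shows "L_isomorphic n D D'"
proof -
  have sD: "L_structure n D" "countable (carrier D)" and sD': "L_structure n D'" "countable (carrier D')"
    using D D' by (auto simp: fraisse_limit_def)
  \<comment> \<open>The substructure generated by the empty set belongs to the common age, so the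
    empty tuples have equal atomic types.\<close>
  let ?B = "D\<lparr>carrier := L_generated n D {}\<rparr>"
  have B: "fg_substructure n ?B D" by (rule fg_restr_generated[OF sD(1)]) auto
  obtain h where h: "L_embedding n h ?B D'" by (rule fraisse_limit_embeds[OF D D' B])
  let ?e = "\<lambda>_. \<one>\<^bsub>D\<^esub>" and ?d = "\<lambda>_. \<one>\<^bsub>D'\<^esub>"
  have "qfeq n ?B ?e D' ?d {}"
    by (rule qfeq_embedding[OF fg_substructureD(1)[OF B] h]) auto
  then have q: "qfeq n D ?e D' ?d {..<0}" by (simp add: qfeq_restr)
  have one: "range ?e \<subseteq> carrier D" "range ?d \<subseteq> carrier D'"
    using sD(1) sD'(1) by (auto simp: L_structure_def L_closed_def)
  obtain g where "L_isomorphism n g D D'"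
  proof (rule L_isomorphism_of_back_and_forth[where R = "\<lambda>e d k. qfeq n D e D' d {..<k}", OF sD sD' _ _ _ _ q one])
    fix e d and k :: nat and x assume "qfeq n D e D' d {..<k}" "range e \<subseteq> carrier D" "range d \<subseteq> carrier D'" "x \<in> carrier D"
    then show "\<exists>y\<in>carrier D'. qfeq n D (e(k := x)) D' (d(k := y)) {..<Suc k}"
      unfolding lessThan_Suc by (intro fraisse_limit_forth[OF D D']) auto
  next
    fix e d and k :: nat and y assume "qfeq n D e D' d {..<k}" "range e \<subseteq> carrier D" "range d \<subseteq> carrier D'" "y \<in> carrier D'"
    then have "\<exists>x\<in>carrier D. qfeq n D' (d(k := y)) D (e(k := x)) {..<Suc k}"
      unfolding lessThan_Suc by (intro fraisse_limit_forth[OF D' D] qfeq_sym[of n D]) auto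
    then show "\<exists>x\<in>carrier D. qfeq n D (e(k := x)) D' (d(k := y)) {..<Suc k}" using qfeq_sym by blast
  next
    fix e d e' d' and k :: nat
    assume "qfeq n D e D' d {..<k}" "\<And>i. i < k \<Longrightarrow> e i = e' i" "\<And>i. i < k \<Longrightarrow> d i = d' i"
    then show "qfeq n D e' D' d' {..<k}" by (elim qfeq_cong) auto
  qed (blast+)
  then show ?thesis by (auto simp: L_isomorphic_def)
qed

section \<open>From the extension property to the properties of the class\<close>

lemma extension_propertyD:
  assumes "extension_property TYPE('a) p n D" "(A :: 'a L_struct) \<in> GG p n" "finite F" "e ` F \<subseteq> carrier A"
    "d ` F \<subseteq> carrier D" "qfeq n A e D d F" "x \<in> carrier A" "k \<notin> F"
  shows "\<exists>y\<in>carrier D. qfeq n A (e(k := x)) D (d(k := y)) (insert k F)"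
  using assms unfolding extension_property_def by blast

text \<open>Starting from \<open>qfeq_empty\<close>, the elements of an enumeration of
  \<open>A\<close> are placed in \<open>D\<close> one after the other.\<close>

lemma extension_property_embeds:
  fixes A :: "'a L_struct"
  assumes p: "prime p" and D: "D \<in> GG p n" "extension_property TYPE('a) p n D"
    and A: "A \<in> GG p n" "finite (carrier A)"
  obtains f where "L_embedding n f A D"
proof -
  interpret A: gg p n A using p A(1) by unfold_locales
  interpret D: gg p n D using p D(1) by unfold_locales
  obtain e and k :: nat where e: "range e \<subseteq> carrier A" "e ` {..<k} = carrier A"
    by (rule finite_enumeration[OF A(2) order_refl A.struct])
  have "\<exists>d. range d \<subseteq> carrier D \<and> qfeq n A e D d {..<j}" for j
  proof (induction j)
    case 0
    show ?case using qfeq_empty[OF p A(1) D(1)] by (intro exI[of _ "\<lambda>_. \<one>\<^bsub>D\<^esub>"]) auto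
  next
    case (Suc j)
    then obtain d where d: "range d \<subseteq> carrier D" "qfeq n A e D d {..<j}" by blast
    have "e ` {..<j} \<subseteq> carrier A" "d ` {..<j} \<subseteq> carrier D" "e j \<in> carrier A" using e(1) d(1) by auto
    from extension_propertyD[OF D(2) A(1) finite_lessThan this(1,2) d(2) this(3), of j]
    obtain y where y: "y \<in> carrier D" "qfeq n A (e(j := e j)) D (d(j := y)) (insert j {..<j})" by auto
    from y(2) have "qfeq n A e D (d(j := y)) {..<Suc j}" by (simp add: lessThan_Suc)
    moreover have "range (d(j := y)) \<subseteq> carrier D" using d(1) y(1) by (auto simp: image_subset_iff)
    ultimately show ?case by blast
  qed
  then obtain d where d: "range d \<subseteq> carrier D" "qfeq n A e D d {..<k}" by blast
  have im: "e ` {..<k} \<subseteq> carrier A" "d ` {..<k} \<subseteq> carrier D" using e d by auto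
  obtain f where f: "L_embedding n f (A\<lparr>carrier := L_generated n A (e ` {..<k})\<rparr>) D"
    by (rule qfeq_imp_embedding[OF A.struct im(1) D.struct im(2) d(2)]) (rule that)
  have "L_generated n A (e ` {..<k}) = carrier A"
    using L_generated_carrier[OF A.struct im(1)] L_generated_superset[of "e ` {..<k}" n A] e(2) by simp
  then have "A\<lparr>carrier := L_generated n A (e ` {..<k})\<rparr> = A" by simp
  then show ?thesis using f that by simp
qed

lemma fg_substructure_KK:
  assumes p: "prime p" and A: "A \<in> GG p n" and B: "fg_substructure n B A"
  shows "B \<in> KK p n"
proof -
  interpret A: gg p n A using p A by unfold_locales
  obtain S where S: "finite S" "S \<subseteq> carrier A" "carrier B = L_generated n A S"
    using B by (auto simp: fg_substructure_def)
  have "B \<in> GG p n" using GG_embedding[OF A.p_pos fg_substructureD(1,3)[OF B] A] .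
  then show ?thesis using A.generated_finite[OF S(1,2)] S(3) by (simp add: KK_def)
qed

text \<open>Taking \<open>D\<close> itself as the source in the extension property gives both
  directions of the back-and-forth. It starts from an enumeration of the domain of \<open>f\<close>
  and its image, so the resulting automorphism extends \<open>f\<close>.\<close>

lemma extension_property_ultrahomogeneous:
  fixes D :: "'a L_struct"
  assumes p: "prime p" and D: "D \<in> GG p n" "countable (carrier D)" "extension_property TYPE('a) p n D"
  shows "ultrahomogeneous n D"
  unfolding ultrahomogeneous_def
proof (intro allI impI)
  fix A B :: "'a L_struct" and f
  assume A: "fg_substructure n A D" and B: "fg_substructure n B D" and f: "L_isomorphism n f A B"
  interpret D: gg p n D using p D(1) by unfold_locales
  have fe: "L_embedding n f A D"
    using L_embedding_comp[OF _ fg_substructureD(3)[OF B]] f by (auto simp: L_isomorphism_def comp_def)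
  note sA = fg_substructureD(1)[OF A] and iA = fg_substructureD(3)[OF A]
  have finA: "finite (carrier A)" using fg_substructure_KK[OF p D(1) A] by (simp add: KK_def)
  obtain e and k :: nat where e: "range e \<subseteq> carrier A" "e ` {..<k} = carrier A"
    by (rule finite_enumeration[OF finA order_refl sA])
  let ?d = "\<lambda>i. f (e i)"
  have "qfeq n A e D e {..<k}" by (rule qfeq_embedding[OF sA iA]) (use e in auto)
  moreover have "qfeq n A e D ?d {..<k}" by (rule qfeq_embedding[OF sA fe]) (use e in auto)
  ultimately have q: "qfeq n D e D ?d {..<k}" using qfeq_trans[OF qfeq_sym] by blast
  have rng: "range e \<subseteq> carrier D" "range ?d \<subseteq> carrier D"
    using e(1) fg_substructureD(2)[OF A] L_embeddingD(1)[OF fe] by auto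
  obtain g where g: "L_isomorphism n g D D" "\<And>i. i < k \<Longrightarrow> g (e i) = ?d i"
  proof (rule L_isomorphism_of_back_and_forth[where R = "\<lambda>e d k. qfeq n D e D d {..<k}", OF D.struct D(2) D.struct D(2) _ _ _ _ q rng])
    fix e d and k :: nat and x assume "qfeq n D e D d {..<k}" "range e \<subseteq> carrier D" "range d \<subseteq> carrier D" "x \<in> carrier D"
    then show "\<exists>y\<in>carrier D. qfeq n D (e(k := x)) D (d(k := y)) {..<Suc k}"
      unfolding lessThan_Suc by (intro extension_propertyD[OF D(3,1)]) auto
  next
    fix e d and k :: nat and y assume "qfeq n D e D d {..<k}" "range e \<subseteq> carrier D" "range d \<subseteq> carrier D" "y \<in> carrier D"
    then have "\<exists>x\<in>carrier D. qfeq n D (d(k := y)) D (e(k := x)) {..<Suc k}"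
      unfolding lessThan_Suc by (intro extension_propertyD[OF D(3,1)] qfeq_sym[of n D e]) auto
    then show "\<exists>x\<in>carrier D. qfeq n D (e(k := x)) D (d(k := y)) {..<Suc k}" using qfeq_sym by blast
  next
    fix e d e' d' and k :: nat
    assume "qfeq n D e D d {..<k}" "\<And>i. i < k \<Longrightarrow> e i = e' i" "\<And>i. i < k \<Longrightarrow> d i = d' i"
    then show "qfeq n D e' D d' {..<k}" by (elim qfeq_cong) auto
  qed (blast+)
  have "g x = f x" if x: "x \<in> carrier A" for x
  proof -
    obtain i where "i < k" "x = e i" using x e(2) by auto
    then show ?thesis using g(2) by simp
  qed
  then show "\<exists>g. L_isomorphism n g D D \<and> (\<forall>x\<in>carrier A. g x = f x)" using g(1) by blast
qed

lemma L_isomorphic_refl: "L_isomorphic n A A"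
  unfolding L_isomorphic_def L_isomorphism_def L_embedding_def by (intro exI[of _ "\<lambda>x. x"]) auto

lemma extension_property_fraisse_limit:
  fixes D :: "'a L_struct"
  assumes p: "prime p" and D: "D \<in> GG p n" "countable (carrier D)" "extension_property TYPE('a) p n D"
  shows "fraisse_limit n (KK p n) D"
  unfolding fraisse_limit_def
proof (intro conjI allI ballI impI)
  interpret D: gg p n D using p D(1) by unfold_locales
  show "L_structure n D" by (rule D.struct)
  show "countable (carrier D)" by (rule D(2))
  show "ultrahomogeneous n D" by (rule extension_property_ultrahomogeneous[OF p D])
  show "\<exists>A\<in>KK p n :: 'a L_struct set. L_isomorphic n B A" if "fg_substructure n B D" for B
    using fg_substructure_KK[OF p D(1) that] L_isomorphic_refl by blast
  show "\<exists>B. fg_substructure n B D \<and> L_isomorphic n B A" if "A \<in> KK p n" for A :: "'a L_struct"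
  proof -
    have A: "A \<in> GG p n" "finite (carrier A)" using that by (auto simp: KK_def)
    interpret A: gg p n A using p A(1) by unfold_locales
    obtain f where f: "L_embedding n f A D" by (rule extension_property_embeds[OF p D(1,3) A])
    have "fg_substructure n (D\<lparr>carrier := f ` carrier A\<rparr>) D" "L_isomorphism n f A (D\<lparr>carrier := f ` carrier A\<rparr>)"
      using fg_image[OF A.struct A(2) f D.struct] .
    then show ?thesis using L_isomorphism_inv[OF A.struct] unfolding L_isomorphic_def by blast
  qed
qed

lemma KK_hereditary: "prime p \<Longrightarrow> hereditary n (KK p n)"
  unfolding hereditary_def using fg_substructure_KK by (auto simp: KK_def)

text \<open>\<open>D\<close> itself may be infinite; the two images together generate a finite
  substructure, which serves as the common target.\<close>

lemma KK_join:
  fixes D :: "'a L_struct"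
  assumes p: "prime p" and D: "D \<in> GG p n" and B: "finite (carrier B)" "L_embedding n h B D"
    and C: "finite (carrier C)" "L_embedding n k C D"
  shows "\<exists>E\<in>KK p n :: 'a L_struct set. L_embedding n h B E \<and> L_embedding n k C E"
proof -
  interpret D: gg p n D using p D by unfold_locales
  let ?S = "h ` carrier B \<union> k ` carrier C"
  have S: "?S \<subseteq> carrier D" "finite ?S" using B C L_embeddingD(1)[OF B(2)] L_embeddingD(1)[OF C(2)] by auto
  have "fg_substructure n (D\<lparr>carrier := L_generated n D ?S\<rparr>) D" by (rule fg_restr_generated[OF D.struct S])
  then have "D\<lparr>carrier := L_generated n D ?S\<rparr> \<in> KK p n" by (rule fg_substructure_KK[OF p D])
  moreover have "h ` carrier B \<subseteq> L_generated n D ?S" "k ` carrier C \<subseteq> L_generated n D ?S"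
    using L_generated_superset[of ?S n D] by auto
  ultimately show ?thesis using L_embedding_into[OF B(2)] L_embedding_into[OF C(2)] by blast
qed

lemma KK_joint_embedding:
  fixes D :: "'a L_struct"
  assumes p: "prime p" and D: "D \<in> GG p n" "extension_property TYPE('a) p n D"
  shows "joint_embedding n (KK p n :: 'a L_struct set)"
  unfolding joint_embedding_def
proof (intro ballI)
  fix A B :: "'a L_struct" assume "A \<in> KK p n" "B \<in> KK p n"
  then have A: "A \<in> GG p n" "finite (carrier A)" and B: "B \<in> GG p n" "finite (carrier B)" by (auto simp: KK_def)
  obtain f g where "L_embedding n f A D" "L_embedding n g B D"
    using extension_property_embeds[OF p D A] extension_property_embeds[OF p D B] by metis
  then show "\<exists>C\<in>KK p n :: 'a L_struct set. \<exists>f g. L_embedding n f A C \<and> L_embedding n g B C"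
    using KK_join[OF p D(1) A(2) _ B(2)] by blast
qed

text \<open>Embedding \<open>B\<close> and \<open>C\<close> into \<open>D\<close> separately places
  \<open>A\<close> there in two ways; an automorphism of \<open>D\<close> makes the two copies
  agree.\<close>

lemma KK_amalgamation:
  fixes D :: "'a L_struct"
  assumes p: "prime p" and D: "D \<in> GG p n" "countable (carrier D)" "extension_property TYPE('a) p n D"
  shows "amalgamation n (KK p n :: 'a L_struct set)"
  unfolding amalgamation_def
proof (intro ballI allI impI)
  fix A B C :: "'a L_struct" and f g
  assume K: "A \<in> KK p n" "B \<in> KK p n" "C \<in> KK p n"
    and f: "L_embedding n f A B" and g: "L_embedding n g A C"
  have A: "A \<in> GG p n" "finite (carrier A)" and B: "B \<in> GG p n" "finite (carrier B)"
    and C: "C \<in> GG p n" "finite (carrier C)" using K by (auto simp: KK_def)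
  interpret A: gg p n A using p A(1) by unfold_locales
  interpret D: gg p n D using p D(1) by unfold_locales
  obtain h k where h: "L_embedding n h B D" and k: "L_embedding n k C D"
    using extension_property_embeds[OF p D(1,3) B] extension_property_embeds[OF p D(1,3) C] by metis
  obtain s where s: "L_isomorphism n s D D" "\<And>a. a \<in> carrier A \<Longrightarrow> s ((h \<circ> f) a) = (k \<circ> g) a"
    using ultrahomogeneous_embeddings[OF extension_property_ultrahomogeneous[OF p D] D.struct A.struct A(2)
      L_embedding_comp[OF f h] L_embedding_comp[OF g k]] by blast
  have sh: "L_embedding n (s \<circ> h) B D" 
    by (rule L_embedding_comp[OF h]) (use s(1) in \<open>simp add: L_isomorphism_def\<close>)
  have "\<forall>x\<in>carrier A. (s \<circ> h) (f x) = k (g x)" using s(2) by simp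
  then show "\<exists>E\<in>KK p n :: 'a L_struct set. \<exists>h k. L_embedding n h B E \<and> L_embedding n k C E \<and> (\<forall>x\<in>carrier A. h (f x) = k (g x))"
    using KK_join[OF p D(1) B(2) sh C(2) k] by blast
qed

section \<open>Copying the generic group into an arbitrary infinite type\<close>

definition transport :: "('a \<Rightarrow> 'b) \<Rightarrow> 'a L_struct \<Rightarrow> 'b L_struct" where
  "transport h A = (let i = inv_into (carrier A) h in
     \<lparr>carrier = h ` carrier A, monoid.mult = (\<lambda>x y. h (i x \<otimes>\<^bsub>A\<^esub> i y)), one = h \<one>\<^bsub>A\<^esub>,
      linv = (\<lambda>x. h (linv A (i x))), lconst = (\<lambda>j. h (lconst A j))\<rparr>)"

lemma transport_isomorphism: "inj_on h (carrier A) \<Longrightarrow> L_isomorphism n h A (transport h A)"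
  unfolding L_isomorphism_def L_embedding_def transport_def Let_def by auto

lemma transport_GG:
  assumes p: "prime p" and A: "A \<in> GG p n" and h: "inj_on h (carrier A)"
  shows "transport h A \<in> GG p n"
proof -
  interpret A: gg p n A using p A by unfold_locales
  have iso: "L_isomorphism n h A (transport h A)" by (rule transport_isomorphism[OF h])
  have "L_structure n (transport h A)"
    using L_closed_image[OF A.struct, of h "transport h A"] iso by (simp add: L_isomorphism_def L_structure_def)
  moreover have "L_embedding n (inv_into (carrier A) h) (transport h A) A"
    using L_isomorphism_inv[OF A.struct iso] by (simp add: L_isomorphism_def)
  ultimately show ?thesis by (rule GG_embedding[OF A.p_pos _ _ A])
qed

lemma transport_extension_property:
  assumes p: "prime p" and D: "D \<in> GG p n" "extension_property TYPE('a) p n D" and h: "inj_on h (carrier D)"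
  shows "extension_property TYPE('a) p n (transport h D)"
  unfolding extension_property_def
proof (intro allI impI)
  fix A :: "'a L_struct" and e d F x and k :: nat
  let ?D = "transport h D" and ?i = "inv_into (carrier D) h"
  assume A: "A \<in> GG p n" and F: "finite F" "e ` F \<subseteq> carrier A" "d ` F \<subseteq> carrier ?D"
    and q: "qfeq n A e ?D d F" and x: "x \<in> carrier A" and k: "k \<notin> F"
  interpret D: gg p n D using p D(1) by unfold_locales
  have emb: "L_embedding n h D ?D" and im: "h ` carrier D = carrier ?D"
    using transport_isomorphism[OF h] by (auto simp: L_isomorphism_def)
  have hi: "?i y \<in> carrier D" "h (?i y) = y" if "y \<in> carrier ?D" for y
    using that im by (metis inv_into_into f_inv_into_f)+
  have dF: "(\<lambda>j. ?i (d j)) ` F \<subseteq> carrier D" using F(3) hi(1) by auto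
  have "qfeq n D (\<lambda>j. ?i (d j)) ?D d F"
    by (rule qfeq_embedding[OF D.struct emb dF]) (use F(3) hi(2) in auto)
  then have "qfeq n A e D (\<lambda>j. ?i (d j)) F" using q qfeq_trans qfeq_sym by blast
  then obtain y where y: "y \<in> carrier D" "qfeq n A (e(k := x)) D ((\<lambda>j. ?i (d j))(k := y)) (insert k F)"
    using extension_propertyD[OF D(2) A F(1,2) dF _ x k] by auto
  have "qfeq n D ((\<lambda>j. ?i (d j))(k := y)) ?D (d(k := h y)) (insert k F)"
    by (rule qfeq_embedding[OF D.struct emb]) (use y(1) dF F(3) hi(2) k in \<open>auto simp: image_subset_iff\<close>)
  then show "\<exists>y\<in>carrier ?D. qfeq n A (e(k := x)) ?D (d(k := y)) (insert k F)"
    using y L_embeddingD(1)[OF emb] qfeq_trans by blast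
qed

text \<open>The generic group consists of functions, while the type of the class is arbitrary; its
  countable carrier can be copied into any infinite type. The extension property is obtained for
  sources in the same type \<open>'u\<close>, so that the structure can be its own source.\<close>

lemma generic_in_type:
  assumes p: "prime p" "p > 2" and inf: "infinite (UNIV :: 'u set)"
  obtains D :: "'u L_struct" where "D \<in> GG p n" "countable (carrier D)" "infinite (carrier D)"
    "extension_property TYPE('u) p n D"
proof -
  let ?D = "generic p n"
  obtain \<iota> :: "nat \<Rightarrow> 'u" where \<iota>: "inj \<iota>" using infinite_countable_subset[OF inf] by blast
  define h where "h = \<iota> \<circ> to_nat_on (carrier ?D)"
  have h: "inj_on h (carrier ?D)"
    unfolding h_def using \<iota> inj_on_to_nat_on[OF countable_generic[OF p]] by (intro comp_inj_on) (auto intro: inj_on_subset)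
  have G: "?D \<in> GG p n" by (rule generic_GG[OF p])
  have c: "carrier (transport h ?D) = h ` carrier ?D" by (simp add: transport_def Let_def)
  show ?thesis
  proof (rule that)
    show "transport h ?D \<in> GG p n" by (rule transport_GG[OF p(1) G h])
    show "countable (carrier (transport h ?D))" unfolding c using countable_generic[OF p] by simp
    show "infinite (carrier (transport h ?D))" unfolding c using infinite_generic[OF p] finite_imageD[OF _ h] by blast
    show "extension_property TYPE('u) p n (transport h ?D)"
      by (rule transport_extension_property[OF p(1) G generic_extension_property[OF p] h])
  qed
qed

subsection \<open>Quantifier elimination and categoricity\<close>

lemma sat_cong:
  assumes "\<And>i. i \<in> free_vars \<phi> \<Longrightarrow> e i = d i"
  shows "sat M e \<phi> \<longleftrightarrow> sat M d \<phi>"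
  using assms
proof (induction \<phi> arbitrary: e d)
  case (FEq s t)
  have "term_val M e u = term_val M d u" if "\<And>i. i \<in> term_vars u \<Longrightarrow> e i = d i" for u
    using that by (induction u) auto
  then show ?case using FEq by simp
next
  case (FEx x \<phi>)
  have "sat M (e(x := a)) \<phi> \<longleftrightarrow> sat M (d(x := a)) \<phi>" for a
    by (rule FEx.IH) (use FEx.prems in auto)
  then show ?case by simp
next
  case (FNot \<phi>)
  then show ?case by (metis free_vars.simps(2) sat.simps(2))
next
  case (FAnd \<phi> \<psi>)
  have "sat M e \<phi> = sat M d \<phi>" "sat M e \<psi> = sat M d \<psi>"
    by (rule FAnd.IH, use FAnd.prems in simp)+
  then show ?case by simp
qed

lemma sat_isomorphism:
  assumes "L_structure n M" "L_isomorphism n g M N" "form_in n \<phi>" "range e \<subseteq> carrier M"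
  shows "sat M e \<phi> \<longleftrightarrow> sat N (g \<circ> e) \<phi>"
  using assms(3,4)
proof (induction \<phi> arbitrary: e)
  case (FEq s t)
  have emb: "L_embedding n g M N" using assms(2) by (simp add: L_isomorphism_def)
  have "qfeq n M e N (g \<circ> e) UNIV"
    by (rule qfeq_embedding[OF assms(1) emb]) (use FEq.prems in auto)
  moreover have "s \<in> tm n UNIV" "t \<in> tm n UNIV" using FEq.prems by (auto simp: tm_def)
  ultimately show ?case unfolding qfeq_def sat.simps by blast
next
  case (FEx x \<phi>)
  have upd: "(g \<circ> e)(x := g a) = g \<circ> e(x := a)" for a by auto
  have "sat M (e(x := a)) \<phi> \<longleftrightarrow> sat N ((g \<circ> e)(x := g a)) \<phi>" if "a \<in> carrier M" for a
    unfolding upd by (rule FEx.IH) (use FEx.prems that in auto)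
  moreover have "carrier N = g ` carrier M" using assms(2) by (simp add: L_isomorphism_def)
  ultimately show ?case by (simp only: sat.simps bex_simps cong: bex_cong)
qed auto

section \<open>Formulas built from finite lists of atoms\<close>

definition conj_list :: "L_form list \<Rightarrow> L_form" where
  "conj_list \<phi>s = foldr FAnd \<phi>s (FEq TOne TOne)"

text \<open>De Morgan's law, as the formulas have only negation and conjunction.\<close>

definition disj_list :: "L_form list \<Rightarrow> L_form" where
  "disj_list \<phi>s = FNot (conj_list (map FNot \<phi>s))"

definition literal :: "L_form set \<Rightarrow> L_form \<Rightarrow> L_form" where
  "literal S \<alpha> = (if \<alpha> \<in> S then \<alpha> else FNot \<alpha>)"

lemma literal_simps [simp]:
  "sat M e (literal S \<alpha>) \<longleftrightarrow> (sat M e \<alpha> \<longleftrightarrow> \<alpha> \<in> S)"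
  "form_in n (literal S \<alpha>) \<longleftrightarrow> form_in n \<alpha>"
  "quantifier_free (literal S \<alpha>) \<longleftrightarrow> quantifier_free \<alpha>"
  "free_vars (literal S \<alpha>) = free_vars \<alpha>"
  by (simp_all add: literal_def)

definition diagram :: "L_form list \<Rightarrow> L_form set \<Rightarrow> L_form" where
  "diagram \<alpha>s S = conj_list (map (literal S) \<alpha>s)"

lemma conj_list_simps [simp]:
  "sat M e (conj_list \<phi>s) \<longleftrightarrow> (\<forall>\<phi>\<in>set \<phi>s. sat M e \<phi>)"
  "form_in n (conj_list \<phi>s) \<longleftrightarrow> (\<forall>\<phi>\<in>set \<phi>s. form_in n \<phi>)"
  "quantifier_free (conj_list \<phi>s) \<longleftrightarrow> (\<forall>\<phi>\<in>set \<phi>s. quantifier_free \<phi>)"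
  "free_vars (conj_list \<phi>s) = (\<Union>\<phi>\<in>set \<phi>s. free_vars \<phi>)"
  unfolding conj_list_def by (induction \<phi>s) auto

lemma disj_list_simps [simp]:
  "sat M e (disj_list \<phi>s) \<longleftrightarrow> (\<exists>\<phi>\<in>set \<phi>s. sat M e \<phi>)"
  "form_in n (disj_list \<phi>s) \<longleftrightarrow> (\<forall>\<phi>\<in>set \<phi>s. form_in n \<phi>)"
  "quantifier_free (disj_list \<phi>s) \<longleftrightarrow> (\<forall>\<phi>\<in>set \<phi>s. quantifier_free \<phi>)"
  "free_vars (disj_list \<phi>s) = (\<Union>\<phi>\<in>set \<phi>s. free_vars \<phi>)"
  unfolding disj_list_def by auto

lemma diagram_simps [simp]:
  "sat M e (diagram \<alpha>s S) \<longleftrightarrow> (\<forall>\<alpha>\<in>set \<alpha>s. sat M e \<alpha> \<longleftrightarrow> \<alpha> \<in> S)"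
  "form_in n (diagram \<alpha>s S) \<longleftrightarrow> (\<forall>\<alpha>\<in>set \<alpha>s. form_in n \<alpha>)"
  "quantifier_free (diagram \<alpha>s S) \<longleftrightarrow> (\<forall>\<alpha>\<in>set \<alpha>s. quantifier_free \<alpha>)"
  "free_vars (diagram \<alpha>s S) = (\<Union>\<alpha>\<in>set \<alpha>s. free_vars \<alpha>)"
  unfolding diagram_def by simp_all

definition FIff :: "L_form \<Rightarrow> L_form \<Rightarrow> L_form" where
  "FIff \<phi> \<psi> = FAnd (FNot (FAnd \<phi> (FNot \<psi>))) (FNot (FAnd \<psi> (FNot \<phi>)))"

lemma FIff_simps [simp]:
  "sat M e (FIff \<phi> \<psi>) \<longleftrightarrow> (sat M e \<phi> \<longleftrightarrow> sat M e \<psi>)"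
  "form_in n (FIff \<phi> \<psi>) \<longleftrightarrow> form_in n \<phi> \<and> form_in n \<psi>"
  by (auto simp: FIff_def)

section \<open>Transfer from a structure to the models of its theory\<close>

definition all_closure :: "nat list \<Rightarrow> L_form \<Rightarrow> L_form" where
  "all_closure xs \<phi> = foldr (\<lambda>x \<psi>. FNot (FEx x (FNot \<psi>))) xs \<phi>"

text \<open>\<open>holds\<close> quantifies over all assignments anyway, so the closure keeps its
  meaning. Closing is necessary because \<open>Th\<close> consists of sentences, while the
  equivalences to be transferred have free variables.\<close>

lemma all_closure_simps:
  "holds M (all_closure xs \<phi>) \<longleftrightarrow> holds M \<phi>"
  "form_in n (all_closure xs \<phi>) \<longleftrightarrow> form_in n \<phi>"
  "free_vars (all_closure xs \<phi>) = free_vars \<phi> - set xs"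
proof -
  have step: "holds M (FNot (FEx x (FNot \<psi>))) \<longleftrightarrow> holds M \<psi>" for x \<psi>
  proof
    assume *: "holds M (FNot (FEx x (FNot \<psi>)))"
    show "holds M \<psi>"
      unfolding holds_def
    proof (intro allI impI)
      fix e :: "nat \<Rightarrow> 'a" assume e: "range e \<subseteq> carrier M"
      then have "e x \<in> carrier M" by auto
      moreover have "sat M e (FNot (FEx x (FNot \<psi>)))" using * e unfolding holds_def by blast
      ultimately have "sat M (e(x := e x)) \<psi>" unfolding sat.simps by blast
      then show "sat M e \<psi>" by simp
    qed
  next
    assume "holds M \<psi>"
    then show "holds M (FNot (FEx x (FNot \<psi>)))"
      unfolding holds_def by (auto simp: image_subset_iff)
  qed
  show "holds M (all_closure xs \<phi>) \<longleftrightarrow> holds M \<phi>"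
    unfolding all_closure_def by (induction xs) (auto simp: step)
  show "form_in n (all_closure xs \<phi>) \<longleftrightarrow> form_in n \<phi>"
    unfolding all_closure_def by (induction xs) auto
  show "free_vars (all_closure xs \<phi>) = free_vars \<phi> - set xs"
    unfolding all_closure_def by (induction xs) auto
qed

lemma finite_free_vars: "finite (free_vars \<phi>)"
proof -
  have "finite (term_vars t)" for t by (induction t) auto
  then show ?thesis by (induction \<phi>) auto
qed

lemma holds_transfer:
  assumes "model n (Th n D) M" "form_in n \<phi>" "holds D \<phi>"
  shows "holds M \<phi>"
proof -
  obtain xs where "set xs = free_vars \<phi>" using finite_list[OF finite_free_vars] by blast
  then have "all_closure xs \<phi> \<in> Th n D" using assms(2,3) by (simp add: Th_def sentence_def all_closure_simps)
  then show ?thesis using assms(1) by (auto simp: model_def all_closure_simps)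
qed

text \<open>The theory of a structure is complete: \<open>Th n D\<close> contains each sentence or
  its negation.\<close>

lemma sentence_transfer:
  assumes "model n (Th n D) M" "sentence n \<phi>" "range e \<subseteq> carrier M" "range d \<subseteq> carrier D"
  shows "sat M e \<phi> \<longleftrightarrow> sat D d \<phi>"
proof -
  have D: "holds D \<psi> \<longleftrightarrow> sat D d \<psi>" if "free_vars \<psi> = {}" for \<psi>
  proof -
    have "sat D e \<psi> \<longleftrightarrow> sat D d \<psi>" for e by (rule sat_cong) (simp add: that)
    then show ?thesis using assms(4) unfolding holds_def by blast
  qed
  show ?thesis
  proof (cases "sat D d \<phi>")
    case True
    then have "holds D \<phi>" using D assms(2) by (simp add: sentence_def)
    then have "holds M \<phi>" using holds_transfer[OF assms(1)] assms(2) by (simp add: sentence_def)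
    then show ?thesis using True assms(3) by (simp add: holds_def)
  next
    case False
    then have "holds D (FNot \<phi>)" using D[of "FNot \<phi>"] assms(2) by (simp add: sentence_def)
    then have "holds M (FNot \<phi>)" using holds_transfer[OF assms(1)] assms(2) by (simp add: sentence_def)
    then show ?thesis using False assms(3) by (simp add: holds_def)
  qed
qed

section \<open>Finitely many atoms determine the type of a tuple\<close>

definition list_of :: "'a set \<Rightarrow> 'a list" where
  "list_of A = (SOME xs. set xs = A)"

lemma set_list_of: "finite A \<Longrightarrow> set (list_of A) = A"
  unfolding list_of_def by (rule someI_ex) (rule finite_list)

text \<open>\<open>T F\<close> is a finite set of terms that represents the whole substructure generated by any \<open>F\<close>-tuple.\<close>

locale uniformly_locally_finite =
  fixes n :: nat and D :: "'a L_struct" and T :: "nat set \<Rightarrow> L_term set"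
  assumes struct: "L_structure n D" and homogeneous: "ultrahomogeneous n D"
    and T_finite: "finite F \<Longrightarrow> finite (T F)" and T_tm: "finite F \<Longrightarrow> T F \<subseteq> tm n F"
    and T_closed: "finite F \<Longrightarrow> range d \<subseteq> carrier D \<Longrightarrow> L_closed n D (term_val D d ` T F)"
    and T_vars: "finite F \<Longrightarrow> range d \<subseteq> carrier D \<Longrightarrow> d ` F \<subseteq> term_val D d ` T F"
begin

text \<open>The representatives in \<open>T F\<close> together with one application of each symbol:
  equations between these terms express the complete operation tables of the substructure generated
  by an \<open>F\<close>-tuple, and there are only finitely many of them.\<close>

definition basic_terms :: "nat set \<Rightarrow> L_term set" where
  "basic_terms F = T F \<union> (\<lambda>(s, t). TMult s t) ` (T F \<times> T F) \<union> TInv ` T F \<union> {TOne} \<union> TConst ` {1..n} \<union> TVar ` F"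

definition atoms :: "nat set \<Rightarrow> L_form set" where
  "atoms F = (\<lambda>(s, t). FEq s t) ` (basic_terms F \<times> basic_terms F)"

lemma atoms_finite: "finite F \<Longrightarrow> finite (atoms F)"
  unfolding atoms_def basic_terms_def using T_finite by auto

lemma atomsD:
  assumes "finite F" "\<alpha> \<in> atoms F"
  shows "form_in n \<alpha>" "quantifier_free \<alpha>" "free_vars \<alpha> \<subseteq> F"
proof -
  have "basic_terms F \<subseteq> tm n F" using T_tm[OF assms(1)] unfolding basic_terms_def by auto
  moreover obtain s t where "\<alpha> = FEq s t" "s \<in> basic_terms F" "t \<in> basic_terms F"
    using assms(2) by (auto simp: atoms_def)
  ultimately have "\<alpha> = FEq s t" "s \<in> tm n F" "t \<in> tm n F" by auto
  then show "form_in n \<alpha>" "quantifier_free \<alpha>" "free_vars \<alpha> \<subseteq> F"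
    by (simp_all add: tm_def)
qed

text \<open>Every term is reduced to a representative in \<open>T F\<close> for both tuples at once:
  each reduction step is an equation from the finite list \<open>atoms F\<close>, so it holds for
  \<open>d'\<close> as soon as it holds for \<open>d\<close>.\<close>

lemma atoms_qfeq:
  assumes F: "finite F" and d: "range d \<subseteq> carrier D" and d': "range d' \<subseteq> carrier D"
    and eq: "\<And>\<alpha>. \<alpha> \<in> atoms F \<Longrightarrow> sat D d \<alpha> \<longleftrightarrow> sat D d' \<alpha>"
  shows "qfeq n D d D d' F"
proof -
  have TB: "T F \<subseteq> basic_terms F" by (auto simp: basic_terms_def)
  have eq': "term_val D d s = term_val D d t \<longleftrightarrow> term_val D d' s = term_val D d' t"
    if "s \<in> basic_terms F" "t \<in> basic_terms F" for s t
    using eq[of "FEq s t"] that by (auto simp: atoms_def)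
  have red: "\<exists>u\<in>T F. term_val D d w = term_val D d u \<and> term_val D d' w = term_val D d' u"
    if "w \<in> basic_terms F" "term_val D d w \<in> term_val D d ` T F" for w
    using that eq' TB by blast
  note cl = L_closedD[OF T_closed[OF F d]]
  have norm: "\<exists>u\<in>T F. term_val D d t = term_val D d u \<and> term_val D d' t = term_val D d' u" if "t \<in> tm n F" for t
    using that
  proof (induction rule: tm_induct)
    case (Var x)
    then show ?case using T_vars[OF F d] by (intro red) (auto simp: basic_terms_def)
  next
    case One
    then show ?case using cl(1) by (intro red) (auto simp: basic_terms_def)
  next
    case (Mult s t)
    then obtain u v where uv: "u \<in> T F" "v \<in> T F" "term_val D d s = term_val D d u" "term_val D d' s = term_val D d' u"
      "term_val D d t = term_val D d v" "term_val D d' t = term_val D d' v" by blast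
    have "\<exists>w\<in>T F. term_val D d (TMult u v) = term_val D d w \<and> term_val D d' (TMult u v) = term_val D d' w"
      using uv(1,2) cl(2) by (intro red) (auto simp: basic_terms_def)
    then show ?case using uv by simp
  next
    case (Inv t)
    then obtain u where u: "u \<in> T F" "term_val D d t = term_val D d u" "term_val D d' t = term_val D d' u" by blast
    have "\<exists>w\<in>T F. term_val D d (TInv u) = term_val D d w \<and> term_val D d' (TInv u) = term_val D d' w"
      using u(1) cl(3) by (intro red) (auto simp: basic_terms_def)
    then show ?case using u by simp
  next
    case (Const i)
    then show ?case using cl(4) by (intro red) (auto simp: basic_terms_def)
  qed
  show ?thesis
    unfolding qfeq_def
  proof (intro ballI)
    fix t u assume "t \<in> tm n F" "u \<in> tm n F"
    then obtain t' u' where "t' \<in> T F" "term_val D d t = term_val D d t'" "term_val D d' t = term_val D d' t'"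
      "u' \<in> T F" "term_val D d u = term_val D d u'" "term_val D d' u = term_val D d' u'" using norm by meson
    then show "term_val D d t = term_val D d u \<longleftrightarrow> term_val D d' t = term_val D d' u"
      using eq'[of t' u'] TB by auto
  qed
qed

lemma atoms_determine:
  assumes F: "finite F" "form_in n \<phi>" "free_vars \<phi> \<subseteq> F"
    and d: "range d \<subseteq> carrier D" and d': "range d' \<subseteq> carrier D"
    and eq: "\<And>\<alpha>. \<alpha> \<in> atoms F \<Longrightarrow> sat D d \<alpha> \<longleftrightarrow> sat D d' \<alpha>"
  shows "sat D d \<phi> \<longleftrightarrow> sat D d' \<phi>"
proof -
  have dF: "d ` F \<subseteq> carrier D" "d' ` F \<subseteq> carrier D" using d d' by auto
  have q: "qfeq n D d D d' F" by (rule atoms_qfeq[OF F(1) d d' eq])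
  obtain g where g: "L_isomorphism n g D D" "\<And>i. i \<in> F \<Longrightarrow> g (d i) = d' i"
    by (rule ultrahomogeneous_qfeq[OF homogeneous struct F(1) dF q]) (rule that)
  have "sat D d \<phi> \<longleftrightarrow> sat D (g \<circ> d) \<phi>" by (rule sat_isomorphism[OF struct g(1) F(2) d])
  also have "\<dots> \<longleftrightarrow> sat D d' \<phi>" by (rule sat_cong) (use g(2) F(3) in auto)
  finally show ?thesis .
qed

text \<open>A disjunction over admissible sets of true atoms. As \<S> is arbitrary, it is cut down
  to subsets of \<open>atoms F\<close>, of which there are only finitely many to list.\<close>

definition type_form :: "nat set \<Rightarrow> L_form set set \<Rightarrow> L_form" where
  "type_form F \<S> = disj_list (map (diagram (list_of (atoms F))) (list_of (\<S> \<inter> Pow (atoms F))))"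

lemma type_form_simps:
  assumes "finite F"
  shows "sat M e (type_form F \<S>) \<longleftrightarrow> {\<alpha> \<in> atoms F. sat M e \<alpha>} \<in> \<S>"
    "form_in n (type_form F \<S>)" "quantifier_free (type_form F \<S>)" "free_vars (type_form F \<S>) \<subseteq> F"
proof -
  have l: "set (list_of (atoms F)) = atoms F" "set (list_of (\<S> \<inter> Pow (atoms F))) = \<S> \<inter> Pow (atoms F)"
    by (rule set_list_of, simp add: atoms_finite[OF assms])+
  let ?A = "{\<alpha> \<in> atoms F. sat M e \<alpha>}"
  have "sat M e (type_form F \<S>) \<longleftrightarrow> (\<exists>S\<in>\<S> \<inter> Pow (atoms F). \<forall>\<alpha>\<in>atoms F. sat M e \<alpha> \<longleftrightarrow> \<alpha> \<in> S)"
    by (simp only: type_form_def disj_list_simps set_map l bex_simps diagram_simps)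
  also have "\<dots> \<longleftrightarrow> ?A \<in> \<S>"
  proof
    assume "\<exists>S\<in>\<S> \<inter> Pow (atoms F). \<forall>\<alpha>\<in>atoms F. sat M e \<alpha> \<longleftrightarrow> \<alpha> \<in> S"
    then obtain S where S: "S \<in> \<S>" "S \<subseteq> atoms F" "\<forall>\<alpha>\<in>atoms F. sat M e \<alpha> \<longleftrightarrow> \<alpha> \<in> S" by blast
    then have "?A = S" by blast
    then show "?A \<in> \<S>" using S(1) by simp
  next
    assume "?A \<in> \<S>"
    then show "\<exists>S\<in>\<S> \<inter> Pow (atoms F). \<forall>\<alpha>\<in>atoms F. sat M e \<alpha> \<longleftrightarrow> \<alpha> \<in> S"
      by (intro bexI[of _ ?A]) auto
  qed
  finally show "sat M e (type_form F \<S>) \<longleftrightarrow> ?A \<in> \<S>" .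
  show "form_in n (type_form F \<S>)" "quantifier_free (type_form F \<S>)"
    using atomsD(1,2)[OF assms] by (simp_all add: type_form_def l)
  show "free_vars (type_form F \<S>) \<subseteq> F"
    using atomsD(3)[OF assms] by (auto simp: type_form_def l)
qed

text \<open>The equivalence is stated in \<open>D\<close> alone, where ultrahomogeneity is available; being first order, it transfers to all
  models of the theory.\<close>

lemma equivalent_type_form:
  assumes F: "finite F" "form_in n \<phi>" "free_vars \<phi> \<subseteq> F"
  obtains \<S> where "holds D (FIff \<phi> (type_form F \<S>))"
proof
  \<comment> \<open>The atomic types realized in \<open>D\<close> by the solutions of \<phi>; by
    \<open>atoms_determine\<close> no other tuple of \<open>D\<close> realizes any of them.\<close>
  let ?\<S> = "{{\<alpha> \<in> atoms F. sat D d \<alpha>} | d. range d \<subseteq> carrier D \<and> sat D d \<phi>}"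
  show "holds D (FIff \<phi> (type_form F ?\<S>))"
    unfolding holds_def FIff_simps type_form_simps(1)[OF F(1)]
  proof (intro allI impI iffI)
    fix e assume e: "range e \<subseteq> carrier D" "{\<alpha> \<in> atoms F. sat D e \<alpha>} \<in> ?\<S>"
    then obtain d where d: "range d \<subseteq> carrier D" "sat D d \<phi>" "{\<alpha> \<in> atoms F. sat D e \<alpha>} = {\<alpha> \<in> atoms F. sat D d \<alpha>}"
      by blast
    have "sat D d \<alpha> \<longleftrightarrow> sat D e \<alpha>" if "\<alpha> \<in> atoms F" for \<alpha> using d(3) that by blast
    then show "sat D e \<phi>" using atoms_determine[OF F d(1) e(1)] d(2) by blast
  qed blast
qed

lemma quantifier_elimination: "quantifier_elimination TYPE('b) n (Th n D)"
  unfolding quantifier_elimination_def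
proof (intro allI impI)
  fix \<phi> assume \<phi>: "form_in n \<phi>"
  note F = finite_free_vars[of \<phi>]
  obtain \<S> where S: "holds D (FIff \<phi> (type_form (free_vars \<phi>) \<S>))"
    by (rule equivalent_type_form[OF F \<phi> order_refl])
  let ?\<psi> = "type_form (free_vars \<phi>) \<S>"
  have "sat M e \<phi> \<longleftrightarrow> sat M e ?\<psi>" if "model n (Th n D) M" "range e \<subseteq> carrier M" for M :: "'b L_struct" and e
    using holds_transfer[OF that(1) _ S] \<phi> type_form_simps(2)[OF F] that(2) by (simp add: holds_def)
  then show "\<exists>\<psi>. form_in n \<psi> \<and> quantifier_free \<psi> \<and> free_vars \<psi> \<subseteq> free_vars \<phi> \<and>
      (\<forall>M :: 'b L_struct. model n (Th n D) M \<longrightarrow> (\<forall>e. range e \<subseteq> carrier M \<longrightarrow> sat M e \<phi> = sat M e \<psi>))"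
    using type_form_simps(2-4)[OF F] by blast
qed

section \<open>Complete types and the isomorphism of countable models\<close>

definition elem_eq :: "'b L_struct \<Rightarrow> (nat \<Rightarrow> 'b) \<Rightarrow> 'c L_struct \<Rightarrow> (nat \<Rightarrow> 'c) \<Rightarrow> nat \<Rightarrow> bool" where
  "elem_eq M e N d k \<longleftrightarrow> (\<forall>\<phi>. form_in n \<phi> \<longrightarrow> free_vars \<phi> \<subseteq> {..<k} \<longrightarrow> (sat M e \<phi> \<longleftrightarrow> sat N d \<phi>))"

text \<open>A model is not known to be ultrahomogeneous, so complete types replace atomic ones.
  Modulo the theory the atoms true at the extended tuple decide every formula, so the single formula
  \<open>?\<delta>\<close> isolates its type; quantified existentially, it belongs to the type of
  the old tuple and can be carried over.\<close>

lemma elem_eq_forth: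
  assumes M: "model n (Th n D) M" and N: "model n (Th n D) N" and eq: "elem_eq M e N d k"
    and e: "range e \<subseteq> carrier M" and d: "range d \<subseteq> carrier N" and x: "x \<in> carrier M"
  shows "\<exists>y\<in>carrier N. elem_eq M (e(k := x)) N (d(k := y)) (Suc k)"
proof -
  let ?F = "{..<Suc k}"
  let ?S = "{\<alpha> \<in> atoms ?F. sat M (e(k := x)) \<alpha>}"
  let ?\<delta> = "diagram (list_of (atoms ?F)) ?S"
  have F: "finite ?F" by simp
  have l: "set (list_of (atoms ?F)) = atoms ?F" by (rule set_list_of[OF atoms_finite[OF F]])
  have "form_in n ?\<delta>" unfolding diagram_simps l using atomsD(1)[OF F] by blast
  then have "form_in n (FEx k ?\<delta>)" by simp
  moreover have "free_vars ?\<delta> \<subseteq> {..<Suc k}" unfolding diagram_simps l using atomsD(3)[OF F] by blast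
  then have "free_vars (FEx k ?\<delta>) \<subseteq> {..<k}" unfolding free_vars.simps lessThan_Suc by blast
  moreover have "sat M (e(k := x)) ?\<delta>" unfolding diagram_simps l by simp
  then have "sat M e (FEx k ?\<delta>)" unfolding sat.simps using x by blast
  ultimately have "sat N d (FEx k ?\<delta>)" using eq unfolding elem_eq_def by blast
  then obtain y where y: "y \<in> carrier N" "\<And>\<alpha>. \<alpha> \<in> atoms ?F \<Longrightarrow> sat N (d(k := y)) \<alpha> \<longleftrightarrow> sat M (e(k := x)) \<alpha>"
    unfolding sat.simps diagram_simps l by blast
  have rng: "range (e(k := x)) \<subseteq> carrier M" "range (d(k := y)) \<subseteq> carrier N"
    using e d x y(1) by (auto simp: image_subset_iff)
  have "elem_eq M (e(k := x)) N (d(k := y)) (Suc k)"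
    unfolding elem_eq_def
  proof (intro allI impI)
    fix \<phi> assume \<phi>: "form_in n \<phi>" "free_vars \<phi> \<subseteq> ?F"
    obtain \<S> where S: "holds D (FIff \<phi> (type_form ?F \<S>))" by (rule equivalent_type_form[OF F \<phi>])
    have fi: "form_in n (FIff \<phi> (type_form ?F \<S>))" using \<phi>(1) type_form_simps(2)[OF F] by simp
    have "{\<alpha> \<in> atoms ?F. sat N (d(k := y)) \<alpha>} = {\<alpha> \<in> atoms ?F. sat M (e(k := x)) \<alpha>}" using y(2) by blast
    then have "sat M (e(k := x)) (type_form ?F \<S>) \<longleftrightarrow> sat N (d(k := y)) (type_form ?F \<S>)"
      unfolding type_form_simps(1)[OF F] by simp
    moreover have "sat M (e(k := x)) \<phi> \<longleftrightarrow> sat M (e(k := x)) (type_form ?F \<S>)"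
      using holds_transfer[OF M fi S] rng(1) unfolding holds_def FIff_simps by blast
    moreover have "sat N (d(k := y)) \<phi> \<longleftrightarrow> sat N (d(k := y)) (type_form ?F \<S>)"
      using holds_transfer[OF N fi S] rng(2) unfolding holds_def FIff_simps by blast
    ultimately show "sat M (e(k := x)) \<phi> \<longleftrightarrow> sat N (d(k := y)) \<phi>" by blast
  qed
  then show ?thesis using y(1) by blast
qed

lemma elem_eq_sym: "elem_eq M e N d k \<Longrightarrow> elem_eq N d M e k"
  by (simp add: elem_eq_def)

lemma countable_models_isomorphic:
  assumes M: "model n (Th n D) M" "countable (carrier M)" and N: "model n (Th n D) N" "countable (carrier N)"
  shows "L_isomorphic n M N"
proof -
  have s: "L_structure n M" "L_structure n N" using M(1) N(1) by (auto simp: model_def)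
  let ?e = "\<lambda>_. \<one>\<^bsub>M\<^esub>" and ?d = "\<lambda>_. \<one>\<^bsub>N\<^esub>" and ?c = "\<lambda>_. \<one>\<^bsub>D\<^esub>"
  have one: "range ?e \<subseteq> carrier M" "range ?d \<subseteq> carrier N" "range ?c \<subseteq> carrier D"
    using s struct by (auto simp: L_structure_def L_closed_def)
  \<comment> \<open>For length 0 only sentences are compared, and the theory decides these.\<close>
  have start: "elem_eq M ?e N ?d 0"
    unfolding elem_eq_def
    using sentence_transfer[OF M(1) _ one(1,3)] sentence_transfer[OF N(1) _ one(2,3)] by (auto simp: sentence_def)
  obtain g where "L_isomorphism n g M N"
  proof (rule L_isomorphism_of_back_and_forth[where R = "\<lambda>e d k. elem_eq M e N d k", OF s(1) M(2) s(2) N(2) _ _ _ _ start one(1,2)])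
    fix e d e' d' and k :: nat
    assume *: "elem_eq M e N d k" "\<And>i. i < k \<Longrightarrow> e i = e' i" "\<And>i. i < k \<Longrightarrow> d i = d' i"
    show "elem_eq M e' N d' k"
      unfolding elem_eq_def
    proof (intro allI impI)
      fix \<phi> assume \<phi>: "form_in n \<phi>" "free_vars \<phi> \<subseteq> {..<k}"
      have "e i = e' i" "d i = d' i" if "i \<in> free_vars \<phi>" for i using *(2,3) \<phi>(2) that by auto
      then have "sat M e \<phi> = sat M e' \<phi>" "sat N d \<phi> = sat N d' \<phi>"
        using sat_cong[of \<phi> e e' M] sat_cong[of \<phi> d d' N] by blast+
      then show "sat M e' \<phi> = sat N d' \<phi>" using *(1) \<phi> by (simp add: elem_eq_def)
    qed
  next
    fix e d and k :: nat assume *: "elem_eq M e N d k"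
    have "sat M e (FEq t u) = sat N d (FEq t u)" if "t \<in> tm n {..<k}" "u \<in> tm n {..<k}" for t u
      using * that unfolding elem_eq_def tm_def by (metis (mono_tags, lifting) Un_least form_in.simps(1) free_vars.simps(1) mem_Collect_eq)
    then show "qfeq n M e N d {..<k}" by (simp add: qfeq_def)
  next
    fix e d and k :: nat and x assume "elem_eq M e N d k" "range e \<subseteq> carrier M" "range d \<subseteq> carrier N" "x \<in> carrier M"
    then show "\<exists>y\<in>carrier N. elem_eq M (e(k := x)) N (d(k := y)) (Suc k)" by (rule elem_eq_forth[OF M(1) N(1)])
  next
    fix e d and k :: nat and y assume "elem_eq M e N d k" "range e \<subseteq> carrier M" "range d \<subseteq> carrier N" "y \<in> carrier N"
    then have "\<exists>x\<in>carrier M. elem_eq N (d(k := y)) M (e(k := x)) (Suc k)"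
      by (intro elem_eq_forth[OF N(1) M(1)] elem_eq_sym[of M])
    then show "\<exists>x\<in>carrier M. elem_eq M (e(k := x)) N (d(k := y)) (Suc k)" using elem_eq_sym by blast
  qed (rule that)
  then show ?thesis by (auto simp: L_isomorphic_def)
qed

lemma aleph0_categorical:
  assumes "countable (carrier D)" "infinite (carrier D)"
  shows "aleph0_categorical TYPE('a) n (Th n D)"
proof -
  have "model n (Th n D) D" using struct by (simp add: model_def Th_def)
  then show ?thesis
    unfolding aleph0_categorical_def using assms countable_models_isomorphic by blast
qed

end

text \<open>Normal terms depend on the order of the variables; sorting selects one list for each
  finite set.\<close>

lemma (in gg) uniformly_locally_finite:
  assumes "ultrahomogeneous n G"
  shows "uniformly_locally_finite n G (\<lambda>F. normal_terms p n (sorted_list_of_set F))"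
proof
  fix F :: "nat set" and d :: "nat \<Rightarrow> 'a" assume F: "finite F"
  show "normal_terms p n (sorted_list_of_set F) \<subseteq> tm n F"
    using normal_terms_tm[of p n "sorted_list_of_set F"] F by simp
  assume "range d \<subseteq> carrier G"
  then have "d ` set (sorted_list_of_set F) \<subseteq> carrier G" by auto
  from normal_terms_closed[OF this] F
  show "L_closed n G (term_val G d ` normal_terms p n (sorted_list_of_set F))"
    "d ` F \<subseteq> term_val G d ` normal_terms p n (sorted_list_of_set F)" by simp_all
qed (use struct assms finite_normal_terms in auto)

theorem theorem3p2:
  fixes p n :: nat
  assumes "prime p" and "p > 2" and "n \<ge> 1"
    and "infinite (UNIV :: 'u set)"
  shows "hereditary n (KK p n :: 'u L_struct set)
       \<and> joint_embedding n (KK p n :: 'u L_struct set)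
       \<and> amalgamation n (KK p n :: 'u L_struct set)
       \<and> (\<exists>D :: 'u L_struct. fraisse_limit n (KK p n) D)
       \<and> (\<forall>(D :: 'u L_struct) (D' :: 'u L_struct). fraisse_limit n (KK p n) D \<longrightarrow> fraisse_limit n (KK p n) D' \<longrightarrow>
            L_isomorphic n D D')
       \<and> (\<forall>D :: 'u L_struct. fraisse_limit n (KK p n) D \<longrightarrow>
            aleph0_categorical TYPE('u) n (Th n D) \<and>
            quantifier_elimination TYPE('u) n (Th n D))"
proof -
  note p = assms(1,2)
  obtain E :: "'u L_struct" where E: "E \<in> GG p n" "countable (carrier E)" "infinite (carrier E)"
    "extension_property TYPE('u) p n E"
    by (rule generic_in_type[OF p assms(4)])
  note E' = E(1,2,4)
  have limit: "fraisse_limit n (KK p n) E" by (rule extension_property_fraisse_limit[OF p(1) E'])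
  have "aleph0_categorical TYPE('u) n (Th n D) \<and> quantifier_elimination TYPE('u) n (Th n D)"
    if D: "fraisse_limit n (KK p n) D" for D :: "'u L_struct"
  proof -
    have sD: "L_structure n D" "countable (carrier D)" "ultrahomogeneous n D"
      using D by (auto simp: fraisse_limit_def)
    \<comment> \<open>The isomorphism with \<open>E\<close> shows that \<open>D\<close> lies in
      \<open>GG\<close> and is infinite; homogeneity is part of \<open>D\<close> being a
      limit.\<close>
    obtain f where f: "L_embedding n f D E" "f ` carrier D = carrier E"
      using fraisse_limit_unique[OF D limit] by (auto simp: L_isomorphic_def L_isomorphism_def)
    have "D \<in> GG p n" using GG_embedding[OF prime_gt_0_nat[OF p(1)] sD(1) f(1) E(1)] .
    then interpret gg p n D using p by unfold_locales
    interpret uniformly_locally_finite n D "\<lambda>F. normal_terms p n (sorted_list_of_set F)"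
      by (rule uniformly_locally_finite[OF sD(3)])
    have "infinite (carrier D)" using f(2) E(3) finite_imageI by metis
    then show ?thesis using aleph0_categorical[OF sD(2)] quantifier_elimination by blast
  qed
  then show ?thesis
    using KK_hereditary[OF p(1)] KK_joint_embedding[OF p(1) E(1,4)] KK_amalgamation[OF p(1) E']
      limit fraisse_limit_unique by blast
qed

end
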